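(* Let $\lambda$ be a partition and write its bottom Schur function as $\hat{s}_\lambda=\sum_\mu c_\mu\tilde{p}_\mu$ with $c_\mu\in\mathbb{Q}$. Then $\sum_\mu c_\mu p_\mu=\sum_\mu c_\mu\tilde{m}_\mu$.
   Context: For $\lambda\vdash n$, $\mathrm{rank}(\lambda)$ is the largest $i$ with $\lambda_i\ge i$; $\ell(\nu)$ is the number of parts of $\nu$; $p_\nu=\prod_i p_{\nu_i}$ are power sums; $z_\nu=\prod_i i^{m_i(\nu)}m_i(\nu)!$, where $m_i(\nu)$ is the number of parts of $\nu$ equal to $i$; $\chi^\lambda(\nu)$ is the irreducible character of $S_n$ indexed by $\lambda$ evaluated at cycle type $\nu$. The bottom Schur function is $\hat{s}_\lambda=\sum_{\nu\vdash n,\ \ell(\nu)=\mathrm{rank}(\lambda)}\chi^\lambda(\nu)\,p_\nu/z_\nu$. Further $\tilde{p}_\mu=\prod_i (p_{\mu_i}/\mu_i)$ (a basis, so the $c_\mu$ are uniquely determined), and $\tilde{m}_\mu=\big(\prod_{i\ge1}m_i(\mu)!\big)m_\mu$ is the augmented monomial symmetric function, $m_\mu$ being the monomial symmetric function. *)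

theory Defs
  imports Complex_Main "HOL-Library.Multiset" "HOL-Library.Function_Algebras"
    "HOL-Combinatorics.Permutations" "HOL-Combinatorics.Orbits"
begin

section \<open>Partitions\<close>

definition is_partition :: "nat list \<Rightarrow> bool" where
  "is_partition lam \<longleftrightarrow> sorted_wrt (\<ge>) lam \<and> 0 \<notin> set lam"

definition partitions_of :: "nat \<Rightarrow> nat list set" where
  "partitions_of n = {\<nu>. is_partition \<nu> \<and> sum_list \<nu> = n}"

text \<open>
  Parts are numbered from 1. The junk value at index 0 puts 0 into the set defining the rank,
  so that the empty partition has rank 0.
\<close>

definition nth_part :: "nat list \<Rightarrow> nat \<Rightarrow> nat" where
  "nth_part lam i = (if 1 \<le> i \<and> i \<le> length lam then lam ! (i - 1) else 0)"

definition partition_rank :: "nat list \<Rightarrow> nat" where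
  "partition_rank lam = Max {i. i \<le> nth_part lam i}"

definition zee :: "nat list \<Rightarrow> nat" where
  "zee \<nu> = (\<Prod>i\<in>set \<nu>. i ^ count_list \<nu> i * fact (count_list \<nu> i))"


section \<open>Formal power series in infinitely many variables\<close>

text \<open>
  Symmetric functions over the rationals live in the ring of formal power series in the variables
  \<open>x\<^sub>0, x\<^sub>1, \<dots>\<close>. A monomial is the multiset of the indices of its factors, and a series is
  the function giving the coefficient of each monomial.
\<close>

typedef series = "UNIV :: (nat multiset \<Rightarrow> rat) set"
  morphisms series_coeff Series ..

setup_lifting type_definition_series

lemma series_eq_iff: "f = g \<longleftrightarrow> (\<forall>\<alpha>. series_coeff f \<alpha> = series_coeff g \<alpha>)"
  by transfer auto

lemma finite_subseteq_mset: "finite {\<beta>. \<beta> \<subseteq># \<alpha>}"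
proof (induction \<alpha>)
  case (add x \<alpha>)
  have "{\<beta>. \<beta> \<subseteq># add_mset x \<alpha>} \<subseteq> {\<beta>. \<beta> \<subseteq># \<alpha>} \<union> add_mset x ` {\<beta>. \<beta> \<subseteq># \<alpha>}"
  proof
    fix \<beta> assume \<beta>: "\<beta> \<in> {\<beta>. \<beta> \<subseteq># add_mset x \<alpha>}"
    show "\<beta> \<in> {\<beta>. \<beta> \<subseteq># \<alpha>} \<union> add_mset x ` {\<beta>. \<beta> \<subseteq># \<alpha>}"
    proof (cases "x \<in># \<beta>")
      case True
      then obtain \<beta>' where "\<beta> = add_mset x \<beta>'" by (meson multi_member_split)
      then show ?thesis using \<beta> by auto
    next
      case False
      then have "\<beta> \<subseteq># \<alpha>" using \<beta>
        by (metis mem_Collect_eq diff_single_trivial subset_eq_diff_conv add_mset_add_single)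
      then show ?thesis by simp
    qed
  qed
  then show ?case using add.IH by (meson finite_Un finite_imageI finite_subset)
qed auto

lemma finite_splittings: "finite {(\<beta>, \<gamma>). \<beta> + \<gamma> = (\<alpha> :: 'a multiset)}"
proof (rule finite_subset)
  show "{(\<beta>, \<gamma>). \<beta> + \<gamma> = \<alpha>} \<subseteq> {\<beta>. \<beta> \<subseteq># \<alpha>} \<times> {\<gamma>. \<gamma> \<subseteq># \<alpha>}" by auto
qed (simp add: finite_subseteq_mset)

instantiation series :: comm_ring_1
begin

lift_definition zero_series :: series is "\<lambda>_. 0" .
lift_definition one_series :: series is "\<lambda>\<alpha>. if \<alpha> = {#} then 1 else 0" .
lift_definition plus_series :: "series \<Rightarrow> series \<Rightarrow> series" is "\<lambda>f g \<alpha>. f \<alpha> + g \<alpha>" .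
lift_definition minus_series :: "series \<Rightarrow> series \<Rightarrow> series" is "\<lambda>f g \<alpha>. f \<alpha> - g \<alpha>" .
lift_definition uminus_series :: "series \<Rightarrow> series" is "\<lambda>f \<alpha>. - f \<alpha>" .
lift_definition times_series :: "series \<Rightarrow> series \<Rightarrow> series" is
  "\<lambda>f g \<alpha>. \<Sum>(\<beta>, \<gamma>) | \<beta> + \<gamma> = \<alpha>. f \<beta> * g \<gamma>" .

instance
proof
  fix f g h :: series
  show "f * g * h = f * (g * h)"
  proof (transfer, rule ext)
    fix f g h :: "nat multiset \<Rightarrow> rat" and \<alpha> :: "nat multiset"
    let ?S = "\<lambda>\<alpha>. {(\<beta>, \<gamma>). \<beta> + \<gamma> = (\<alpha> :: nat multiset)}"
    have "(\<Sum>(\<delta>, \<gamma>)\<in>?S \<alpha>. (\<Sum>(\<beta>, \<beta>')\<in>?S \<delta>. f \<beta> * g \<beta>') * h \<gamma>)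
        = (\<Sum>p\<in>?S \<alpha>. \<Sum>q\<in>?S (fst p). f (fst q) * g (snd q) * h (snd p))"
      by (simp add: sum_distrib_right case_prod_beta)
    also have "\<dots> = (\<Sum>(p, q)\<in>(SIGMA p:?S \<alpha>. ?S (fst p)). f (fst q) * g (snd q) * h (snd p))"
      by (rule sum.Sigma) (auto simp: finite_splittings)
    also have "\<dots> = (\<Sum>(p, q)\<in>(SIGMA p:?S \<alpha>. ?S (snd p)). f (fst p) * (g (fst q) * h (snd q)))"
      by (rule sum.reindex_bij_witness
          [where j = "\<lambda>(p, q). ((fst q, snd q + snd p), (snd q, snd p))"
             and i = "\<lambda>(p, q). ((fst p + fst q, snd q), (fst p, fst q))"])
        (auto simp: add.assoc)
    also have "\<dots> = (\<Sum>p\<in>?S \<alpha>. \<Sum>q\<in>?S (snd p). f (fst p) * (g (fst q) * h (snd q)))"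
      by (rule sum.Sigma [symmetric]) (auto simp: finite_splittings)
    also have "\<dots> = (\<Sum>(\<beta>, \<delta>)\<in>?S \<alpha>. f \<beta> * (\<Sum>(\<beta>', \<gamma>)\<in>?S \<delta>. g \<beta>' * h \<gamma>))"
      by (simp add: sum_distrib_left case_prod_beta)
    finally show "(\<Sum>(\<delta>, \<gamma>)\<in>?S \<alpha>. (\<Sum>(\<beta>, \<beta>')\<in>?S \<delta>. f \<beta> * g \<beta>') * h \<gamma>)
        = (\<Sum>(\<beta>, \<delta>)\<in>?S \<alpha>. f \<beta> * (\<Sum>(\<beta>', \<gamma>)\<in>?S \<delta>. g \<beta>' * h \<gamma>))" .
  qed
  show "f * g = g * f"
    by (transfer, rule ext,
        rule sum.reindex_bij_witness [where i = prod.swap and j = prod.swap])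
      (auto simp: add.commute)
  show "1 * f = f"
  proof (transfer, rule ext)
    fix f :: "nat multiset \<Rightarrow> rat" and \<alpha> :: "nat multiset"
    have "(\<Sum>(\<beta>, \<gamma>) | \<beta> + \<gamma> = \<alpha>. (if \<beta> = {#} then 1 else 0) * f \<gamma>)
        = (\<Sum>(\<beta>, \<gamma>)\<in>{({#} :: nat multiset, \<alpha>)}. (if \<beta> = {#} then 1 else 0) * f \<gamma>)"
      by (rule sum.mono_neutral_right) (auto simp: finite_splittings split: if_splits)
    then show "(\<Sum>(\<beta>, \<gamma>) | \<beta> + \<gamma> = \<alpha>. (if \<beta> = {#} then 1 else 0) * f \<gamma>) = f \<alpha>" by simp
  qed
  show "(f + g) * h = f * h + g * h"
    by transfer (auto simp: fun_eq_iff algebra_simps sum.distrib case_prod_beta)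
  show "(0 :: series) \<noteq> 1"
    by transfer (metis zero_neq_one)
qed (transfer; simp add: fun_eq_iff)+

end

lift_definition scale_series :: "rat \<Rightarrow> series \<Rightarrow> series"  (infixr \<open>\<cdot>\<close> 75) is "\<lambda>a f \<alpha>. a * f \<alpha>" .


section \<open>Power sums and monomial symmetric functions\<close>

text \<open>
  \<open>p\<^sub>k = \<Sum>\<^sub>i x\<^sub>i\<^sup>k\<close>; only used for \<open>k \<ge> 1\<close>.
\<close>

lift_definition power_sum1 :: "nat \<Rightarrow> series" is
  "\<lambda>k \<alpha>. if \<exists>i. \<alpha> = replicate_mset k i then 1 else 0" .

definition power_sum :: "nat list \<Rightarrow> series" where
  "power_sum \<mu> = (\<Prod>k\<leftarrow>\<mu>. power_sum1 k)"

definition power_sum_tilde :: "nat list \<Rightarrow> series" where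
  "power_sum_tilde \<mu> = (\<Prod>k\<leftarrow>\<mu>. (1 / of_nat k) \<cdot> power_sum1 k)"

text \<open>
  \<open>m\<^sub>\<mu>\<close> is the sum of all distinct monomials whose multiset of nonzero exponents is the multiset
  of parts of \<open>\<mu>\<close>.
\<close>

lift_definition monomial_sym :: "nat list \<Rightarrow> series" is
  "\<lambda>\<mu> \<alpha>. if image_mset (count \<alpha>) (mset_set (set_mset \<alpha>)) = mset \<mu> then 1 else 0" .

definition augmented_monomial_sym :: "nat list \<Rightarrow> series" where
  "augmented_monomial_sym \<mu> = (\<Prod>i\<in>set \<mu>. fact (count_list \<mu> i)) \<cdot> monomial_sym \<mu>"


section \<open>Irreducible characters of symmetric groups\<close>

text \<open>
  \<open>S\<^sub>n\<close> is the group of permutations of \<open>{..<n}\<close>. An element of the rational group algebra is the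
  function of its coefficients, vanishing outside \<open>S\<^sub>n\<close>; the product of the basis elements
  \<open>\<sigma>\<close> and \<open>\<tau>\<close> is \<open>\<sigma> \<circ> \<tau>\<close>.
\<close>

type_synonym galg = "(nat \<Rightarrow> nat) \<Rightarrow> rat"

interpretation galg: vector_space "\<lambda>(a :: rat) (f :: galg) \<pi>. a * f \<pi>"
  by standard (auto simp: fun_eq_iff algebra_simps)

definition group_algebra :: "nat \<Rightarrow> galg set" where
  "group_algebra n = {f. \<forall>\<pi>. \<not> \<pi> permutes {..<n} \<longrightarrow> f \<pi> = 0}"

definition galg_mult :: "nat \<Rightarrow> galg \<Rightarrow> galg \<Rightarrow> galg" where
  "galg_mult n f g = (\<lambda>\<pi>. \<Sum>\<sigma> | \<sigma> permutes {..<n}. f \<sigma> * g (inv \<sigma> \<circ> \<pi>))"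

text \<open>
  The cells of the Young diagram in reading order, from row to row. The cell containing the label
  \<open>k\<close> in the canonical tableau (the one filled row by row with \<open>0, 1, 2, \<dots>\<close>) is \<open>cells lam ! k\<close>.
\<close>

definition cells :: "nat list \<Rightarrow> (nat \<times> nat) list" where
  "cells lam = concat (map (\<lambda>i. map (Pair i) [0..<lam ! i]) [0..<length lam])"

definition row_group :: "nat list \<Rightarrow> (nat \<Rightarrow> nat) set" where
  "row_group lam = {\<pi>. \<pi> permutes {..<sum_list lam} \<and>
     (\<forall>k<sum_list lam. fst (cells lam ! \<pi> k) = fst (cells lam ! k))}"

definition column_group :: "nat list \<Rightarrow> (nat \<Rightarrow> nat) set" where
  "column_group lam = {\<pi>. \<pi> permutes {..<sum_list lam} \<and>
     (\<forall>k<sum_list lam. snd (cells lam ! \<pi> k) = snd (cells lam ! k))}"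

definition young_symmetrizer :: "nat list \<Rightarrow> galg" where
  "young_symmetrizer lam = galg_mult (sum_list lam)
     (\<lambda>\<pi>. if \<pi> \<in> row_group lam then 1 else 0)
     (\<lambda>\<pi>. if \<pi> \<in> column_group lam then of_int (sign \<pi>) else 0)"

text \<open>
  The irreducible representation of \<open>S\<^sub>n\<close> indexed by \<open>lam\<close>, with \<open>S\<^sub>n\<close> acting from the left:
  the left ideal generated by the Young symmetrizer (isomorphic to the Specht module). It is
  absolutely irreducible, so its trace is that of the corresponding complex representation.
\<close>

definition specht :: "nat list \<Rightarrow> galg set" where
  "specht lam =
     (\<lambda>f. galg_mult (sum_list lam) f (young_symmetrizer lam)) ` group_algebra (sum_list lam)"

definition left_mult :: "(nat \<Rightarrow> nat) \<Rightarrow> galg \<Rightarrow> galg" where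
  "left_mult \<pi> f = (\<lambda>\<sigma>. f (inv \<pi> \<circ> \<sigma>))"

text \<open>
  The trace of an operator on a finite-dimensional invariant subspace \<open>V\<close>, as the sum of the
  diagonal entries of its matrix with respect to some basis of \<open>V\<close>.
\<close>

definition trace_on :: "galg set \<Rightarrow> (galg \<Rightarrow> galg) \<Rightarrow> rat" where
  "trace_on V T = (let B = (SOME B. galg.independent B \<and> galg.span B = V)
     in \<Sum>b\<in>B. galg.representation B (T b) b)"

definition cycle_type :: "nat \<Rightarrow> (nat \<Rightarrow> nat) \<Rightarrow> nat multiset" where
  "cycle_type n \<pi> = image_mset card (mset_set (orbit \<pi> ` {..<n}))"

definition irr_char :: "nat list \<Rightarrow> nat list \<Rightarrow> rat" where
  "irr_char lam \<nu> = trace_on (specht lam)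
     (left_mult (SOME \<pi>. \<pi> permutes {..<sum_list lam} \<and> cycle_type (sum_list lam) \<pi> = mset \<nu>))"


section \<open>Bottom Schur functions\<close>

definition bottom_schur :: "nat list \<Rightarrow> series" where
  "bottom_schur lam =
     (\<Sum>\<nu> | \<nu> \<in> partitions_of (sum_list lam) \<and> length \<nu> = partition_rank lam.
        (irr_char lam \<nu> / of_nat (zee \<nu>)) \<cdot> power_sum \<nu>)"

end

theory Submission
  imports Defs "HOL-Combinatorics.Cycles" "HOL-Combinatorics.Multiset_Permutations" "HOL-Library.FuncSet"
begin

text \<open>
  Put \<open>r = rank \<lambda>\<close>. By the linear independence of the power sums, \<open>c\<^sub>\<mu> = \<chi>\<^sup>\<lambda>(\<mu>) / \<Prod>\<^sub>i m\<^sub>i(\<mu>)!\<close> for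
  \<open>\<mu>\<close> with \<open>r\<close> parts, so \<open>r!\<close> times the two sides of the claim are the sums of \<open>\<chi>\<^sup>\<lambda>(\<beta>) \<Prod>\<^sub>k x\<^bsub>f k\<^esub>\<^bsup>\<beta> k\<^esup>\<close>
  over the compositions \<open>\<beta>\<close> with \<open>r\<close> parts and over all words \<open>f\<close>, respectively over the words \<open>f\<close> with distinct
  letters. If \<open>f k = f l\<close>, then only \<open>\<beta> k + \<beta> l\<close> enters the monomial, and the terms cancel because
  \<open>\<Sum>\<^bsub>i + j = s\<^esub> \<chi>\<^sup>\<lambda>(i, j, \<rho>) = 0\<close> whenever \<open>\<rho>\<close> has \<open>r - 2\<close> parts.

  For the last identity let \<open>\<phi>\<^sub>m(\<nu>)\<close> be the coefficient of \<open>x\<^sup>m\<close> in the product of \<open>p\<^sub>\<nu>\<close> and the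
  Vandermonde determinant. In terms of beads on an abacus, a part removes \<open>k\<close> from the position of one bead.
  If \<open>m\<close> has at least \<open>r\<close> beads outside the final positions, then each of the \<open>r\<close> parts has to move a
  different one of them, and exchanging the targets of the two beads moved by \<open>i\<close> and \<open>j\<close> cancels
  \<open>\<Sum>\<^bsub>i + j = s\<^esub> \<phi>\<^sub>m(i, j, \<rho>)\<close>. By the commutation relations of raising and lowering operators the
  \<open>\<phi>\<^sub>m\<close> satisfy column orthogonality, so \<open>\<chi>\<^sup>\<lambda>\<close> is a combination of those \<open>\<phi>\<^sub>m\<close> that are not orthogonal
  to it. Orthogonality is decided by the classical tableau argument: a nonzero product with \<open>\<phi>\<^sub>m\<close> bounds the
  first \<open>q\<close> rows of the partition of \<open>m\<close> by those of \<open>\<lambda>\<close>, and, since conjugation amounts to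
  complementing and reversing the bead positions, likewise for the columns. If \<open>m\<close> had rank \<open>q < r\<close>, these rows
  and columns would cover it, contradicting the cell \<open>(q + 1, q + 1)\<close> of \<open>\<lambda>\<close>.
\<close>

section \<open>Coefficients of alternants\<close>

text \<open>The coefficient of \<open>x\<^sup>m\<close> in the product of the alternant \<open>\<Sum>\<^sub>w sign w \<Prod>\<^bsub>i < N\<^esub> x\<^sub>i\<^bsup>w i\<^esup>\<close> and the
  power sums \<open>p\<^sub>\<nu>\<close> in \<open>x\<^sub>0, \<dots>, x\<^bsub>N - 1\<^esub>\<close>. Only the values of \<open>m\<close> below \<open>N\<close> matter.\<close>

fun alt_coeff :: "nat \<Rightarrow> nat list \<Rightarrow> (nat \<Rightarrow> nat) \<Rightarrow> rat" where
  "alt_coeff N [] m = (\<Sum>w | w permutes {..<N} \<and> (\<forall>i<N. m i = w i). of_int (sign w))"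
| "alt_coeff N (k # \<nu>) m = (\<Sum>i | i < N \<and> k \<le> m i. alt_coeff N \<nu> (m(i := m i - k)))"

lemma alt_coeff_cong:
  assumes "\<And>i. i < N \<Longrightarrow> m i = m' i"
  shows "alt_coeff N \<nu> m = alt_coeff N \<nu> m'"
  using assms
proof (induction \<nu> arbitrary: m m')
  case Nil
  then show ?case by (auto intro!: sum.cong)
next
  case (Cons k \<nu>)
  have "alt_coeff N \<nu> (m(i := m i - k)) = alt_coeff N \<nu> (m'(i := m' i - k))" if "i < N" for i
    using that Cons.prems by (intro Cons.IH) auto
  then show ?case using Cons.prems by (auto intro!: sum.cong)
qed

lemma permutation_of_permutes: "p permutes {..<N::nat} \<Longrightarrow> permutation p"
  using permutation_permutes by blast

text \<open>The alternant is antisymmetric and the power sums are symmetric; in the recursion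
  \<open>\<pi>\<close> only renames the bead that is lowered.\<close>

lemma alt_coeff_permute:
  assumes \<pi>: "\<pi> permutes {..<N}"
  shows "alt_coeff N \<nu> (m \<circ> \<pi>) = of_int (sign \<pi>) * alt_coeff N \<nu> m"
proof (induction \<nu> arbitrary: m)
  case Nil
  have *: "(\<forall>i<N. m (\<pi> i) = w i) \<longleftrightarrow> (\<forall>i<N. m i = w (inv \<pi> i))" if "w permutes {..<N}" for w
  proof
    assume H: "\<forall>i<N. m (\<pi> i) = w i"
    show "\<forall>i<N. m i = w (inv \<pi> i)"
    proof (intro allI impI)
      fix i assume "i < N"
      then have "inv \<pi> i < N" using permutes_in_image[OF permutes_inv[OF \<pi>]] by auto
      then show "m i = w (inv \<pi> i)" using H permutes_inverses[OF \<pi>] by metis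
    qed
  next
    assume H: "\<forall>i<N. m i = w (inv \<pi> i)"
    show "\<forall>i<N. m (\<pi> i) = w i"
      using H permutes_inverses[OF \<pi>] permutes_in_image[OF \<pi>] by (metis lessThan_iff)
  qed
  have "alt_coeff N [] (m \<circ> \<pi>) = (\<Sum>w | w permutes {..<N} \<and> (\<forall>i<N. m i = w i). of_int (sign w) * of_int (sign \<pi>))"
    unfolding alt_coeff.simps
    by (rule sum.reindex_bij_witness[where i = "\<lambda>w. w \<circ> \<pi>" and j = "\<lambda>w. w \<circ> inv \<pi>"])
      (auto simp: * permutes_compose[OF _ \<pi>] permutes_compose[OF permutes_inv[OF \<pi>]] \<pi> comp_assoc
        permutes_inv_o[OF \<pi>] sign_compose permutation_of_permutes permutation_of_permutes[OF permutes_inv[OF \<pi>]]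
        sign_inverse[OF permutation_of_permutes[OF \<pi>]] permutes_compose permutes_inverses[OF \<pi>] permutes_inv[OF \<pi>]
        permutes_in_image[OF \<pi>, simplified] permutes_inverses mult.commute
       simp flip: of_int_mult)
  then show ?case by (simp add: sum_distrib_left mult.commute)
next
  case (Cons k \<nu>)
  have "alt_coeff N (k # \<nu>) (m \<circ> \<pi>) = (\<Sum>i | i < N \<and> k \<le> m i. alt_coeff N \<nu> (m(i := m i - k) \<circ> \<pi>))"
    unfolding alt_coeff.simps
  proof (rule sum.reindex_bij_witness[where i = "inv \<pi>" and j = \<pi>])
    fix a
    show "alt_coeff N \<nu> (m(\<pi> a := m (\<pi> a) - k) \<circ> \<pi>) = alt_coeff N \<nu> ((m \<circ> \<pi>)(a := (m \<circ> \<pi>) a - k))"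
      by (rule alt_coeff_cong) (use permutes_inj[OF \<pi>] in \<open>auto simp: inj_eq\<close>)
  qed (use permutes_in_image[OF \<pi>] permutes_in_image[OF permutes_inv[OF \<pi>]] in \<open>auto simp: permutes_inverses[OF \<pi>]\<close>)
  also have "\<dots> = of_int (sign \<pi>) * alt_coeff N (k # \<nu>) m"
    by (simp only: Cons.IH sum_distrib_left alt_coeff.simps)
  finally show ?case .
qed

lemma alt_coeff_transpose:
  assumes "a < N" "b < N" "a \<noteq> b"
  shows "alt_coeff N \<nu> (m \<circ> transpose a b) = - alt_coeff N \<nu> m"
  using alt_coeff_permute[of "transpose a b" N \<nu> m] assms
  by (simp add: permutes_swap_id sign_swap_id)

text \<open>Transposing two beads at the same position leaves \<open>m\<close> unchanged but
  reverses the sign.\<close>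

lemma alt_coeff_not_inj:
  assumes "\<not> inj_on m {..<N}"
  shows "alt_coeff N \<nu> m = 0"
proof -
  obtain a b where ab: "a < N" "b < N" "a \<noteq> b" "m a = m b" using assms by (auto simp: inj_on_def)
  have "m \<circ> transpose a b = m" using ab by (auto simp: fun_eq_iff transpose_def)
  then show ?thesis using alt_coeff_transpose[of a N b \<nu> m] ab by simp
qed

lemma alt_coeff_swap: "alt_coeff N (k # l # \<nu>) m = alt_coeff N (l # k # \<nu>) m"
proof -
  \<comment> \<open>For \<open>i = j\<close> the two conditions amount to
    \<open>k + l \<le> m i\<close>, so the sum over pairs is symmetric in the two parts on the
    diagonal as well.\<close>
  have dep: "alt_coeff N (k # l # \<nu>) m =
    (\<Sum>(i,j) | i < N \<and> j < N \<and> k \<le> m i \<and> l \<le> (m(i := m i - k)) j.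
       alt_coeff N \<nu> ((m(i := m i - k))(j := (m(i := m i - k)) j - l)))" for k l
    unfolding alt_coeff.simps
    by (subst sum.Sigma) (auto intro!: sum.cong)
  show ?thesis unfolding dep
    by (rule sum.reindex_bij_witness[where i = prod.swap and j = prod.swap])
      (auto simp: fun_eq_iff add.commute split: if_splits intro!: arg_cong[where f = "alt_coeff N \<nu>"])
qed

lemma alt_coeff_move: "alt_coeff N (xs @ k # ys) m = alt_coeff N (k # xs @ ys) m"
proof (induction xs arbitrary: m)
  case (Cons x xs)
  have "alt_coeff N ((x # xs) @ k # ys) m = alt_coeff N (x # k # xs @ ys) m"
    by (simp only: alt_coeff.simps append_Cons Cons.IH)
  then show ?case using alt_coeff_swap[of N x k] by simp
qed simp

lemma alt_coeff_mset: "mset \<nu> = mset \<nu>' \<Longrightarrow> alt_coeff N \<nu> m = alt_coeff N \<nu>' m"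
proof (induction \<nu> arbitrary: \<nu>' m)
  case (Cons k \<nu>)
  then have "k \<in> set \<nu>'" by (metis list.set_intros(1) set_mset_mset)
  then obtain xs ys where \<nu>': "\<nu>' = xs @ k # ys" by (meson split_list)
  then have "mset \<nu> = mset (xs @ ys)" using Cons.prems by simp
  then have "alt_coeff N (k # \<nu>) m = alt_coeff N (k # xs @ ys) m" by (simp only: alt_coeff.simps Cons.IH)
  then show ?case by (simp only: \<nu>' alt_coeff_move)
qed simp

section \<open>Degree and position bounds for nonvanishing coefficients\<close>

lemma sum_permutes_lessThan: "w permutes {..<N::nat} \<Longrightarrow> sum w {..<N} = \<Sum>{..<N}"
  using sum.permute[of w "{..<N}" "\<lambda>x. x"] by simp

lemma sum_fun_upd:
  fixes m :: "nat \<Rightarrow> nat"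
  assumes "i < N"
  shows "sum (m(i := v)) {..<N} + m i = sum m {..<N} + v"
proof -
  have "sum (m(i := v)) {..<N} = v + sum (m(i := v)) ({..<N} - {i})"
    using assms by (subst sum.remove[of _ i]) auto
  also have "sum (m(i := v)) ({..<N} - {i}) = sum m ({..<N} - {i})"
    by (rule sum.cong) auto
  finally show ?thesis using assms by (simp add: sum.remove[of "{..<N}" i m])
qed

text \<open>Homogeneity: the alternant has degree \<open>\<Sum>{..<N}\<close> and every part
  \<open>k\<close> adds \<open>k\<close>.\<close>

lemma alt_coeff_sum:
  assumes "alt_coeff N \<nu> m \<noteq> 0"
  shows "sum m {..<N} = \<Sum>{..<N} + sum_list \<nu>"
  using assms
proof (induction \<nu> arbitrary: m)
  case Nil
  then obtain w where "w permutes {..<N}" "\<forall>i<N. m i = w i"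
    by (auto elim: sum.not_neutral_contains_not_neutral)
  then show ?case using sum_permutes_lessThan[of w N] by (metis (no_types, lifting) add_0_right lessThan_iff sum.cong sum_list.Nil)
next
  case (Cons k \<nu>)
  then obtain i where i: "i < N" "k \<le> m i" "alt_coeff N \<nu> (m(i := m i - k)) \<noteq> 0"
    by (auto elim: sum.not_neutral_contains_not_neutral)
  have "sum (m(i := m i - k)) {..<N} + k = sum m {..<N}"
    using sum_fun_upd[OF i(1), of m "m i - k"] i(2) by linarith
  then show ?case using Cons.IH[OF i(3)] by simp
qed

text \<open>In the alternant all beads lie below \<open>N\<close>, and the parts together lower a
  bead by at most \<open>sum_list \<nu>\<close>. This confines sums over \<open>m\<close> to a
  finite box.\<close>

lemma alt_coeff_bound:
  assumes "alt_coeff N \<nu> m \<noteq> 0" "i < N"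
  shows "m i < N + sum_list \<nu>"
  using assms
proof (induction \<nu> arbitrary: m)
  case Nil
  then obtain w where "w permutes {..<N}" "\<forall>i<N. m i = w i"
    by (auto elim: sum.not_neutral_contains_not_neutral)
  then show ?case using \<open>i < N\<close> permutes_in_image[of w "{..<N}" i] by auto
next
  case (Cons k \<nu>)
  then obtain j where j: "j < N" "k \<le> m j" "alt_coeff N \<nu> (m(j := m j - k)) \<noteq> 0"
    by (auto elim: sum.not_neutral_contains_not_neutral)
  from Cons.IH[OF j(3) \<open>i < N\<close>] j(2) show ?case by (auto split: if_splits)
qed

text \<open>Each part lowers one bead, and in the end all beads have to lie below
  \<open>N\<close>.\<close>

lemma alt_coeff_large_beads:
  assumes "alt_coeff N \<nu> m \<noteq> 0"
  shows "card {i. i < N \<and> N \<le> m i} \<le> length \<nu>"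
  using assms
proof (induction \<nu> arbitrary: m)
  case Nil
  then have "{i. i < N \<and> N \<le> m i} = {}" using alt_coeff_bound[of N "[]" m] by force
  then show ?case by simp
next
  case (Cons k \<nu>)
  then obtain j where j: "j < N" "k \<le> m j" "alt_coeff N \<nu> (m(j := m j - k)) \<noteq> 0"
    by (auto elim: sum.not_neutral_contains_not_neutral)
  have "card {i. i < N \<and> N \<le> m i} \<le> card (insert j {i. i < N \<and> N \<le> (m(j := m j - k)) i})"
    by (rule card_mono) auto
  also have "\<dots> \<le> Suc (card {i. i < N \<and> N \<le> (m(j := m j - k)) i})"
    by (simp add: card_insert_le_m1)
  finally show ?case using Cons.IH[OF j(3)] by simp
qed

lemma alt_coeff_Nil_permutes:
  assumes "w permutes {..<N}"
  shows "alt_coeff N [] w = of_int (sign w)"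
proof -
  have "{w'. w' permutes {..<N} \<and> (\<forall>i<N. w i = w' i)} = {w}"
    using assms by (auto simp: fun_eq_iff) (metis lessThan_iff permutes_not_in)
  then show ?thesis by simp
qed

lemma alt_coeff_Nil_iff: "alt_coeff N [] m \<noteq> 0 \<longleftrightarrow> (\<exists>w. w permutes {..<N} \<and> (\<forall>i<N. m i = w i))"
proof
  assume "alt_coeff N [] m \<noteq> 0"
  then show "\<exists>w. w permutes {..<N} \<and> (\<forall>i<N. m i = w i)"
    by (auto elim: sum.not_neutral_contains_not_neutral)
next
  assume "\<exists>w. w permutes {..<N} \<and> (\<forall>i<N. m i = w i)"
  then obtain w where w: "w permutes {..<N}" "\<forall>i<N. m i = w i" by blast
  have "alt_coeff N [] m = alt_coeff N [] w" by (rule alt_coeff_cong) (use w in auto)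
  then show "alt_coeff N [] m \<noteq> 0" using alt_coeff_Nil_permutes[OF w(1)] by simp
qed

text \<open>Condition and update depend only on the position of a bead, so transposing two beads at
  the same position permutes the summands and reverses their signs.\<close>

lemma sum_alt_coeff_update_not_inj:
  assumes "\<not> inj_on m {..<N}"
  shows "(\<Sum>i | i < N \<and> P (m i). alt_coeff N \<nu> (m(i := \<phi> (m i)))) = 0"
proof -
  obtain a b where ab: "a < N" "b < N" "a \<noteq> b" "m a = m b" using assms by (auto simp: inj_on_def)
  let ?t = "transpose a b"
  have mt: "m (?t i) = m i" for i using ab by (auto simp: transpose_def)
  have *: "alt_coeff N \<nu> (m(?t i := \<phi> (m i))) = - alt_coeff N \<nu> (m(i := \<phi> (m i)))" for i
  proof -
    have "m(?t i := \<phi> (m i)) = m(i := \<phi> (m i)) \<circ> ?t"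
      using mt by (auto simp: fun_eq_iff)
    then show ?thesis using alt_coeff_transpose[OF ab(1-3)] by simp
  qed
  have "(\<Sum>i | i < N \<and> P (m i). alt_coeff N \<nu> (m(i := \<phi> (m i)))) =
    (\<Sum>i | i < N \<and> P (m i). alt_coeff N \<nu> (m(?t i := \<phi> (m i))))"
    by (rule sum.reindex_bij_witness[where i = ?t and j = ?t]) (use ab mt in \<open>auto simp: transpose_def\<close>)
  then show ?thesis by (simp add: * sum_negf)
qed

section \<open>Raising beads and the commutation relation\<close>

lemma sum_lessThan_card_le:
  fixes X :: "nat set"
  assumes "finite X"
  shows "\<Sum>{..<card X} \<le> \<Sum>X"
  using assms
proof (induction X rule: finite_linorder_max_induct)
  case (insert b A)
  have "A \<subseteq> {..<b}" using insert by auto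
  then have "card A \<le> b" by (metis card_lessThan card_mono finite_lessThan)
  then show ?case using insert by (auto simp: lessThan_Suc)
qed simp

text \<open>Together with the gap \<open>y\<close> the beads are \<open>N + 1\<close> distinct
  numbers, whose sum is at least \<open>0 + ... + N\<close>.\<close>

lemma sum_inj_missing:
  assumes "inj_on m {..<N::nat}" "y \<notin> m ` {..<N}"
  shows "\<Sum>{..<N} + N \<le> y + sum m {..<N}"
proof -
  let ?X = "insert y (m ` {..<N})"
  have "card ?X = Suc N" using assms by (simp add: card_image)
  then have "\<Sum>{..<Suc N} \<le> \<Sum>?X" using sum_lessThan_card_le[of ?X] by simp
  also have "\<Sum>?X = y + sum m {..<N}" using assms by (simp add: sum.reindex)
  finally show ?thesis by (simp add: lessThan_Suc)
qed

text \<open>The boundary term of the commutator of lowering by \<open>k\<close> and raising by \<open>l\<close>: the beads \<open>m\<close>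
  fill all small positions, so moving a bead across the boundary collides with another one.\<close>

lemma alt_coeff_boundary:
  assumes "1 \<le> k" "1 \<le> l" "2 * (k + sum_list \<nu>) \<le> N"
  shows "(\<Sum>i | i < N \<and> (m i < k \<and> k \<le> m i + l). alt_coeff N \<nu> (m(i := m i + l - k)))
    = (if k = l then of_nat l * alt_coeff N \<nu> m else 0)"
proof (cases "inj_on m {..<N}")
  case False
  then show ?thesis
    using sum_alt_coeff_update_not_inj[OF False, where P = "\<lambda>v. v < k \<and> k \<le> v + l" and \<nu> = \<nu> and \<phi> = "\<lambda>v. v + l - k"]
    by (simp add: alt_coeff_not_inj)
next
  case inj: True
  show ?thesis
  \<comment> \<open>If all positions below \<open>max k l\<close> are occupied, then either
    \<open>k = l\<close>, nothing moves and exactly \<open>k\<close> beads lie below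
    \<open>k\<close>, or the target position is occupied by a different bead.\<close>
  proof (cases "\<forall>y < max k l. y \<in> m ` {..<N}")
    case full: True
    show ?thesis
    proof (cases "k = l")
      case True
      have "m ` {i. i < N \<and> m i < k} = {..<k}" using full True by auto
      moreover have "inj_on m {i. i < N \<and> m i < k}" using inj by (rule inj_on_subset) auto
      ultimately have "card {i. i < N \<and> m i < k} = k" using card_image by fastforce
      then show ?thesis using True by (simp add: fun_upd_idem)
    next
      case False
      have "alt_coeff N \<nu> (m(i := m i + l - k)) = 0" if i: "i < N" "m i < k" "k \<le> m i + l" for i
      proof (rule alt_coeff_not_inj)
        have "m i + l - k < max k l" using i by auto
        then obtain j where j: "j < N" "m j = m i + l - k" using full by (metis imageE lessThan_iff)
        then have "j \<noteq> i" using False i by auto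
        then show "\<not> inj_on (m(i := m i + l - k)) {..<N}"
          unfolding inj_on_def using i j
          by (metis fun_upd_other fun_upd_same lessThan_iff)
      qed
      then show ?thesis using False by (auto intro!: sum.neutral)
    qed
  next
    \<comment> \<open>With a gap this low the beads sum to more than homogeneity allows, because
      \<open>N \<ge> 2 * (k + sum_list \<nu>)\<close>.\<close>
    case False
    then obtain y where y: "y < max k l" "y \<notin> m ` {..<N}" by blast
    have le: "\<Sum>{..<N} + N \<le> y + sum m {..<N}" by (rule sum_inj_missing[OF inj y(2)])
    have zero: "sum m {..<N} + l \<noteq> \<Sum>{..<N} + sum_list \<nu> + k"
      using le y(1) assms by (auto simp: max_def split: if_splits)
    have "alt_coeff N \<nu> (m(i := m i + l - k)) = 0" if i: "i < N" "m i < k" "k \<le> m i + l" for i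
    proof (rule ccontr)
      assume "\<not> ?thesis"
      from alt_coeff_sum[OF this] show False using zero sum_fun_upd[OF i(1), of m "m i + l - k"] i by linarith
    qed
    moreover have "alt_coeff N \<nu> m = 0" if "k = l"
      using alt_coeff_sum[of N \<nu> m] zero that by force
    ultimately show ?thesis by (auto intro!: sum.neutral)
  qed
qed

text \<open>Raising by \<open>l\<close> acts on products of power sums as \<open>l\<close> times the
  derivative with respect to \<open>p\<^sub>l\<close>: it kills the alternant, and its commutator
  with lowering by \<open>k\<close> is the boundary term computed above.\<close>

lemma alt_coeff_raise:
  assumes "1 \<le> l" "\<forall>k\<in>set \<nu>. 1 \<le> k" "2 * sum_list \<nu> \<le> N"
  shows "(\<Sum>i<N. alt_coeff N \<nu> (m(i := m i + l)))
    = of_nat (l * count_list \<nu> l) * alt_coeff N (remove1 l \<nu>) m"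
  using assms(2,3)
proof (induction \<nu> arbitrary: m)
  case Nil
  have "(\<Sum>i | i < N \<and> True. alt_coeff N [] (m(i := m i + l))) = 0"
  proof (cases "inj_on m {..<N}")
    case False
    from sum_alt_coeff_update_not_inj[OF this, where P = "\<lambda>_. True" and \<nu> = "[]" and \<phi> = "\<lambda>v. v + l"] show ?thesis .
  next
    case True
    have "alt_coeff N [] (m(i := m i + l)) = 0" if i: "i < N" for i
    proof (rule ccontr)
      assume *: "\<not> ?thesis"
      then obtain w where w: "w permutes {..<N}" "\<forall>j<N. (m(i := m i + l)) j = w j"
        unfolding alt_coeff_Nil_iff by blast
      have "w i < N" using w(1) i permutes_in_image by fastforce
      then have "m i < N" using w(2) i by auto
      \<comment> \<open>Before being raised, bead \<open>i\<close> stood at a position below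
        \<open>N\<close>, which the permutation \<open>w\<close> assigns to another, unmoved
        bead.\<close>
      then obtain j where "j < N" "w j = m i" using w(1) by (metis imageE lessThan_iff permutes_image)
      then show False using w(2) i True \<open>1 \<le> l\<close> by (metis add_cancel_right_right fun_upd_apply inj_onD lessThan_iff not_one_le_zero)
    qed
    then show ?thesis by simp
  qed
  then show ?case by (simp only: lessThan_def simp_thms list.size count_list.simps mult_0_right of_nat_0 mult_zero_left)
next
  case (Cons k \<nu>)
  let ?F = "alt_coeff N \<nu>"
  \<comment> \<open>\<open>A\<close> holds the pairs that also occur with raising and lowering in
    the other order. \<open>B\<close> holds the excess: the raised bead is lowered itself, and
    raising was needed to make that possible.\<close>
  define A where "A = {(i, j). i < N \<and> j < N \<and> k \<le> m j}"
  define B where "B = (\<lambda>i. (i, i)) ` {i. i < N \<and> (m i < k \<and> k \<le> m i + l)}"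
  let ?h = "\<lambda>(i, j). ?F ((m(i := m i + l))(j := (m(i := m i + l)) j - k))"
  have fin: "finite A" "finite B"
    by (rule finite_subset[of _ "{..<N} \<times> {..<N}"]; auto simp: A_def B_def)+
  have "(\<Sum>i<N. alt_coeff N (k # \<nu>) (m(i := m i + l))) =
    sum ?h (SIGMA i:{..<N}. {j. j < N \<and> k \<le> (m(i := m i + l)) j})"
    unfolding alt_coeff.simps by (subst sum.Sigma) auto
  also have "(SIGMA i:{..<N}. {j. j < N \<and> k \<le> (m(i := m i + l)) j}) = A \<union> B"
    by (auto simp: A_def B_def split: if_splits)
  also have "sum ?h (A \<union> B) = sum ?h A + sum ?h B"
    by (rule sum.union_disjoint) (use fin in \<open>auto simp: A_def B_def\<close>)
  also have "sum ?h B = (\<Sum>i | i < N \<and> (m i < k \<and> k \<le> m i + l). ?F (m(i := m i + l - k)))"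
    unfolding B_def by (subst sum.reindex) (auto simp: inj_on_def intro!: sum.cong)
  also have "\<dots> = (if k = l then of_nat l * ?F m else 0)"
    using assms(1) Cons.prems by (intro alt_coeff_boundary) auto
  also have "sum ?h A = (\<Sum>(j, i)\<in>{j. j < N \<and> k \<le> m j} \<times> {..<N}. ?F ((m(j := m j - k))(i := (m(j := m j - k)) i + l)))"
    by (rule sum.reindex_bij_witness[where i = prod.swap and j = prod.swap])
      (auto simp: A_def fun_eq_iff intro!: arg_cong[where f = ?F])
  also have "\<dots> = (\<Sum>j | j < N \<and> k \<le> m j. \<Sum>i<N. ?F ((m(j := m j - k))(i := (m(j := m j - k)) i + l)))"
    by (subst sum.cartesian_product) simp
  also have "\<dots> = of_nat (l * count_list \<nu> l) * alt_coeff N (k # remove1 l \<nu>) m"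
  proof -
    have "(\<Sum>i<N. ?F ((m(j := m j - k))(i := (m(j := m j - k)) i + l))) =
      of_nat (l * count_list \<nu> l) * alt_coeff N (remove1 l \<nu>) (m(j := m j - k))" for j
      using Cons.prems by (intro Cons.IH) auto
    then show ?thesis by (simp only: alt_coeff.simps sum_distrib_left)
  qed
  finally have *: "(\<Sum>i<N. alt_coeff N (k # \<nu>) (m(i := m i + l))) =
    of_nat (l * count_list \<nu> l) * alt_coeff N (k # remove1 l \<nu>) m + (if k = l then of_nat l * ?F m else 0)" .
  show ?case
  proof (cases "k = l")
    case True
    show ?thesis
    \<comment> \<open>\<open>remove1\<close> deletes the leading \<open>l\<close> of
      \<open>l # \<nu>\<close>, whereas the induction hypothesis keeps it and deletes an
      \<open>l\<close> in \<open>\<nu>\<close>; the two results are rearrangements of each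
      other.\<close>
    proof (cases "l \<in> set \<nu>")
      case True
      then have "alt_coeff N (l # remove1 l \<nu>) m = ?F m" by (intro alt_coeff_mset) simp
      then show ?thesis unfolding *[unfolded \<open>k = l\<close>] \<open>k = l\<close>
        by (simp add: algebra_simps del: alt_coeff.simps)
    next
      case False
      then have "count_list \<nu> l = 0" by (simp add: count_list_0_iff)
      then show ?thesis unfolding *[unfolded \<open>k = l\<close>] \<open>k = l\<close> by (simp del: alt_coeff.simps)
    qed
  next
    case False
    then show ?thesis unfolding * by simp
  qed
qed

section \<open>Column orthogonality\<close>

text \<open>For large \<open>N\<close> and \<open>M\<close> this is \<open>N!\<close> times the Hall
  scalar product of \<open>p\<^sub>\<kappa>\<close> and \<open>p\<^sub>\<nu>\<close>. Extensional
  functions count each exponent vector once.\<close>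

definition alt_pair :: "nat \<Rightarrow> nat \<Rightarrow> nat list \<Rightarrow> nat list \<Rightarrow> rat" where
  "alt_pair N M \<kappa> \<nu> = (\<Sum>m\<in>{..<N} \<rightarrow>\<^sub>E {..<M}. alt_coeff N \<kappa> m * alt_coeff N \<nu> m)"

lemma alt_pair_commute: "alt_pair N M \<kappa> \<nu> = alt_pair N M \<nu> \<kappa>"
  by (simp add: alt_pair_def mult.commute)

text \<open>Lowering by \<open>l\<close> in one factor is adjoint to raising by \<open>l\<close> in
  the other, and \<open>alt_coeff_raise\<close> evaluates the latter.\<close>

lemma alt_pair_Cons:
  assumes "1 \<le> l" "\<forall>k\<in>set \<kappa>. 1 \<le> k" "2 * sum_list \<kappa> \<le> N" "N + sum_list \<kappa> \<le> M"
  shows "alt_pair N M \<kappa> (l # \<nu>) = of_nat (l * count_list \<kappa> l) * alt_pair N M (remove1 l \<kappa>) \<nu>"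
proof -
  let ?E = "{..<N} \<rightarrow>\<^sub>E {..<M}"
  have finE: "finite ?E" by (simp add: finite_PiE)
  have "alt_pair N M \<kappa> (l # \<nu>) =
    (\<Sum>(m, i)\<in>(SIGMA m:?E. {i. i < N \<and> l \<le> m i}). alt_coeff N \<kappa> m * alt_coeff N \<nu> (m(i := m i - l)))"
    unfolding alt_pair_def alt_coeff.simps sum_distrib_left by (subst sum.Sigma) (auto simp: finE)
  also have "\<dots> = (\<Sum>(m, i)\<in>(SIGMA m:?E. {i. i < N \<and> m i + l < M}). alt_coeff N \<kappa> (m(i := m i + l)) * alt_coeff N \<nu> m)"
    by (rule sum.reindex_bij_witness[where i = "\<lambda>(m, i). (m(i := m i + l), i)" and j = "\<lambda>(m, i). (m(i := m i - l), i)"])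
      (use \<open>1 \<le> l\<close> in \<open>force simp: PiE_iff extensional_def less_imp_diff_less\<close>)+
  also have "\<dots> = (\<Sum>(m, i)\<in>?E \<times> {..<N}. alt_coeff N \<kappa> (m(i := m i + l)) * alt_coeff N \<nu> m)"
  \<comment> \<open>Beads raised to \<open>M\<close> or beyond contribute nothing by
    \<open>alt_coeff_bound\<close>, so leaving the box does no harm.\<close>
  proof (rule sum.mono_neutral_left)
    have "alt_coeff N \<kappa> (m(i := m i + l)) = 0" if "i < N" "\<not> m i + l < M" for m i
      using alt_coeff_bound[of N \<kappa> "m(i := m i + l)" i] that assms(4) by force
    then show "\<forall>x\<in>?E \<times> {..<N} - (SIGMA m:?E. {i. i < N \<and> m i + l < M}).
       (case x of (m, i) \<Rightarrow> alt_coeff N \<kappa> (m(i := m i + l)) * alt_coeff N \<nu> m) = 0" by auto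
  qed (auto simp: finE)
  also have "\<dots> = (\<Sum>m\<in>?E. (\<Sum>i<N. alt_coeff N \<kappa> (m(i := m i + l))) * alt_coeff N \<nu> m)"
    by (simp add: sum.cartesian_product sum_distrib_right)
  also have "\<dots> = of_nat (l * count_list \<kappa> l) * alt_pair N M (remove1 l \<kappa>) \<nu>"
    using assms by (simp add: alt_coeff_raise alt_pair_def sum_distrib_left mult.assoc)
  finally show ?thesis .
qed

text \<open>The parts of \<open>\<nu>\<close> are split off one at a time: each is either missing in
  \<open>\<kappa>\<close>, giving the factor 0, or removed on both sides.\<close>

lemma alt_pair_orthogonal:
  assumes "\<forall>k\<in>set \<kappa>. 1 \<le> k" "\<forall>k\<in>set \<nu>. 1 \<le> k" "2 * sum_list \<kappa> \<le> N" "N + sum_list \<kappa> \<le> M"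
    and "mset \<kappa> \<noteq> mset \<nu>"
  shows "alt_pair N M \<kappa> \<nu> = 0"
  using assms
proof (induction \<nu> arbitrary: \<kappa>)
  case Nil
  then obtain l \<kappa>' where "\<kappa> = l # \<kappa>'" by (cases \<kappa>) auto
  then show ?case using Nil alt_pair_Cons[of l "[]" N M \<kappa>'] by (simp add: alt_pair_commute)
next
  case (Cons l \<nu>)
  show ?case
  proof (cases "l \<in> set \<kappa>")
    case True
    have le: "sum_list (remove1 l \<kappa>) \<le> sum_list \<kappa>" using True by (simp add: sum_list_map_remove1[of l \<kappa> "\<lambda>x. x", simplified])
    have "mset (remove1 l \<kappa>) \<noteq> mset \<nu>" using Cons.prems(5) True
      by (auto simp: insert_DiffM dest!: arg_cong[of "mset \<kappa> - {#l#}" _ "add_mset l"])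
    moreover have "set (remove1 l \<kappa>) \<subseteq> set \<kappa>" by (rule set_remove1_subset)
    ultimately have "alt_pair N M (remove1 l \<kappa>) \<nu> = 0" using Cons.prems le by (intro Cons.IH) auto
    then show ?thesis using Cons.prems by (subst alt_pair_Cons) auto
  next
    case False
    then show ?thesis using Cons.prems by (subst alt_pair_Cons) (auto simp: count_list_0_iff)
  qed
qed

lemma alt_pair_pos:
  assumes "\<forall>k\<in>set \<nu>. 1 \<le> k" "2 * sum_list \<nu> \<le> N" "N + sum_list \<nu> \<le> M"
  shows "alt_pair N M \<nu> \<nu> > 0"
  using assms
proof (induction \<nu>)
  case Nil
  let ?m = "restrict id {..<N}"
  have "alt_coeff N [] ?m = alt_coeff N [] id" by (rule alt_coeff_cong) auto
  also have "\<dots> = 1" by (subst alt_coeff_Nil_permutes) (auto simp: permutes_id)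
  finally have "0 < alt_coeff N [] ?m * alt_coeff N [] ?m" by (simp del: alt_coeff.simps)
  also have "\<dots> \<le> alt_pair N M [] []" unfolding alt_pair_def
  proof (rule member_le_sum)
    show "?m \<in> {..<N} \<rightarrow>\<^sub>E {..<M}" using Nil by auto
  qed (auto simp: finite_PiE simp del: alt_coeff.simps)
  finally show ?case .
next
  case (Cons l \<nu>)
  then have "0 < alt_pair N M \<nu> \<nu>" "0 < l * count_list (l # \<nu>) l" by auto
  then show ?case using Cons.prems by (subst alt_pair_Cons) (auto simp del: of_nat_mult of_nat_add count_list.simps)
qed

text \<open>Only \<open>length \<rho> + 2\<close> parts are available to bring at least that many
  beads below \<open>N\<close>, so the first two parts take two different beads across
  \<open>N\<close>. Exchanging the targets of these beads is a sign-reversing involution that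
  preserves \<open>s\<close>.\<close>

lemma sum_two_part_removals:
  assumes "length \<rho> + 2 \<le> card {i. i < N \<and> N \<le> m i}"
  shows "(\<Sum>i\<in>{1..<s}. alt_coeff N (i # (s - i) # \<rho>) m) = 0"
proof -
  let ?m = "\<lambda>i a b. (m(a := m a - i))(b := (m(a := m a - i)) b - (s - i))"
  let ?L = "\<lambda>m. {i. i < N \<and> N \<le> m i}"
  define U where "U = (SIGMA i:{1..<s}. SIGMA a:{a. a < N \<and> i \<le> m a}. {b. b < N \<and> s - i \<le> (m(a := m a - i)) b})"
  define T where "T = {(i, a, b). i \<in> {1..<s} \<and> a < N \<and> b < N \<and> a \<noteq> b \<and> N \<le> m a \<and> N \<le> m b \<and>
     i \<le> m a \<and> s - i \<le> m b \<and> m a - i < N \<and> m b - (s - i) < N}"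
  let ?g = "\<lambda>(i, a, b). alt_coeff N \<rho> (?m i a b)"
  have "(\<Sum>i\<in>{1..<s}. alt_coeff N (i # (s - i) # \<rho>) m) = sum ?g U"
    unfolding alt_coeff.simps U_def
    by (subst sum.Sigma, simp, simp, subst sum.Sigma) (simp_all add: case_prod_beta)
  also have "\<dots> = sum ?g T"
  proof (rule sum.mono_neutral_right)
    show "finite U" unfolding U_def by auto
    show "T \<subseteq> U" by (auto simp: T_def U_def)
    show "\<forall>x\<in>U - T. ?g x = 0"
    proof clarify
      fix i a b assume x: "(i, a, b) \<in> U" "(i, a, b) \<notin> T"
      show "alt_coeff N \<rho> (?m i a b) = 0"
      proof (rule ccontr)
        assume "alt_coeff N \<rho> (?m i a b) \<noteq> 0"
        then have le: "card (?L (?m i a b)) \<le> length \<rho>" by (rule alt_coeff_large_beads)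
        \<comment> \<open>At most \<open>length \<rho>\<close> large beads may be left for
          \<open>\<rho>\<close>, so the first two moves must take two beads below
          \<open>N\<close>.\<close>
        have sub: "?L m - ?L (?m i a b) \<subseteq> {a, b}" by auto
        have "?L m \<subseteq> ?L (?m i a b) \<union> (?L m - ?L (?m i a b))" by auto
        then have "card (?L m) \<le> card (?L (?m i a b) \<union> (?L m - ?L (?m i a b)))"
          by (intro card_mono) auto
        also have "\<dots> \<le> card (?L (?m i a b)) + card (?L m - ?L (?m i a b))" by (rule card_Un_le)
        finally have "card (?L m) \<le> card (?L (?m i a b)) + card (?L m - ?L (?m i a b))" .
        then have ge: "2 \<le> card (?L m - ?L (?m i a b))" using le assms by linarith
        have "card {a, b} \<le> 2" by (simp add: card_insert_if)
        then have eq: "?L m - ?L (?m i a b) = {a, b}"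
          using sub ge by (intro card_seteq) auto
        have "a \<noteq> b" using ge unfolding eq by (cases "a = b") auto
        moreover have "a \<in> ?L m - ?L (?m i a b)" "b \<in> ?L m - ?L (?m i a b)" by (simp_all only: eq) auto
        ultimately have "N \<le> m a" "N \<le> m b" "m a - i < N" "m b - (s - i) < N" "a < N" "b < N" "a \<noteq> b"
          by (auto split: if_splits)
        then show False using x by (auto simp: T_def U_def)
      qed
    qed
  qed
  finally have to_T: "(\<Sum>i\<in>{1..<s}. alt_coeff N (i # (s - i) # \<rho>) m) = sum ?g T" .
  \<comment> \<open>The new first part takes bead \<open>a\<close> to the old target of
    \<open>b\<close>; the rest of \<open>s\<close> then takes \<open>b\<close> to the old target of
    \<open>a\<close>.\<close>
  define \<phi> where "\<phi> = (\<lambda>(i, a :: nat, b :: nat). (m a - (m b - (s - i)), a, b))"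
  have \<phi>: "\<phi> x \<in> T \<and> \<phi> (\<phi> x) = x \<and> ?g (\<phi> x) = - ?g x" if "x \<in> T" for x
  proof -
    from that obtain i a b where x: "x = (i, a, b)" and T: "1 \<le> i" "i < s" "a < N" "b < N" "a \<noteq> b" "N \<le> m a" "N \<le> m b"
      "i \<le> m a" "s - i \<le> m b" "m a - i < N" "m b - (s - i) < N" by (auto simp: T_def)
    define i' where "i' = m a - (m b - (s - i))"
    have si: "s - i' = m b - (m a - i)" unfolding i'_def using T(1,2,6,8,9,11) by linarith
    have i': "1 \<le> i'" unfolding i'_def using T(6,11) by linarith
    have i's: "i' < s" using si T(7,10) by linarith
    have ma: "m a - i' = m b - (s - i)" unfolding i'_def using T(6,11) by linarith
    have mb: "m b - (s - i') = m a - i" unfolding si using T(7,10) by linarith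
    have le: "i' \<le> m a" "s - i' \<le> m b" unfolding si by (simp_all add: i'_def)
    have "?m i' a b = ?m i a b \<circ> transpose a b"
      using ma mb T(5) by (simp add: fun_eq_iff transpose_def del: diff_diff_left diff_diff_right)
    then have "alt_coeff N \<rho> (?m i' a b) = - alt_coeff N \<rho> (?m i a b)"
      using alt_coeff_transpose[OF T(3,4,5)] by simp
    moreover have "(i', a, b) \<in> T"
      unfolding T_def using T(3-7) i' i's le ma mb T(10,11) by simp
    moreover have "m a - (m b - (s - i')) = i" unfolding mb using T(8) by simp
    ultimately show ?thesis by (simp add: x \<phi>_def i'_def[symmetric] del: diff_diff_left diff_diff_right)
  qed
  have "sum ?g T = (\<Sum>x\<in>T. - ?g x)"
    by (rule sum.reindex_bij_witness[where i = \<phi> and j = \<phi>])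
      (simp_all only: \<phi>[THEN conjunct1] \<phi>[THEN conjunct2, THEN conjunct1]
        \<phi>[THEN conjunct2, THEN conjunct2] minus_minus)
  also have "\<dots> = - sum ?g T" by (rule sum_negf)
  finally show ?thesis unfolding to_T by (simp only: equal_neg_zero)
qed

section \<open>Conjugation of bead configurations\<close>

text \<open>If \<open>u\<close> permutes \<open>{..<N + N'}\<close>, its first \<open>N\<close>
  values are the beads and the other \<open>N'\<close> values the gaps. The gaps, counted from the
  far end, are the beads of the conjugate partition.\<close>

definition complement_beads :: "nat \<Rightarrow> nat \<Rightarrow> (nat \<Rightarrow> nat) \<Rightarrow> nat \<Rightarrow> nat" where
  "complement_beads N N' u = (\<lambda>j. N + N' - 1 - u (N + j))"

lemma complement_beads_Nil_upper:
  assumes "v permutes {N..<N + N'}"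
  shows "alt_coeff N' [] (complement_beads N N' v) = of_int (sign v) * alt_coeff N' [] (complement_beads N N' id)"
  using finite_atLeastLessThan assms
proof (induction rule: permutes_rev_induct)
  case (swap a b p)
  have ab: "a - N < N'" "b - N < N'" "a - N \<noteq> b - N" using swap by auto
  have "permutation p" using swap(4) finite_atLeastLessThan by (metis permutation_permutes)
  then have s: "sign (p \<circ> transpose a b) = - sign p"
    using swap(3) by (simp add: sign_compose permutation_swap_id sign_swap_id)
  have "alt_coeff N' [] (complement_beads N N' (p \<circ> transpose a b))
      = alt_coeff N' [] (complement_beads N N' p \<circ> transpose (a - N) (b - N))"
    by (rule alt_coeff_cong) (use swap(1,2) in \<open>auto simp: complement_beads_def transpose_def\<close>)
  then show ?case by (simp only: swap(5) s alt_coeff_transpose[OF ab] of_int_minus mult_minus_left)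
qed simp

text \<open>The beads fill the positions below \<open>N\<close> exactly if the gaps fill the others.
  Then \<open>u\<close> splits into a permutation of the beads and one of the gaps, and the sign is
  multiplicative.\<close>

lemma complement_beads_Nil:
  assumes u: "u permutes {..<N + N'}"
  shows "alt_coeff N' [] (complement_beads N N' u)
    = alt_coeff N' [] (complement_beads N N' id) * of_int (sign u) * alt_coeff N [] u"
proof (cases "alt_coeff N [] u = 0")
  case False
  then obtain w where w: "w permutes {..<N}" "\<forall>i<N. u i = w i" unfolding alt_coeff_Nil_iff by blast
  let ?v = "inv w \<circ> u"
  have w': "w permutes {..<N + N'}" by (rule permutes_subset[OF w(1)]) auto
  have "?v permutes {..<N + N'}" by (rule permutes_compose[OF u permutes_inv[OF w']])
  then have v: "?v permutes {N..<N + N'}"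
    by (rule permutes_superset) (use w permutes_inverses[OF w(1)] in auto)
  have uv: "u = w \<circ> ?v" by (simp add: fun_eq_iff permutes_inverses[OF w(1)])
  have sg: "sign u = sign w * sign ?v"
    by (subst uv, rule sign_compose) (use w' u permutation_of_permutes permutes_compose[OF u permutes_inv[OF w']] in blast)+
  have "alt_coeff N [] u = alt_coeff N [] w" by (rule alt_coeff_cong) (use w in auto)
  then have su: "alt_coeff N [] u = of_int (sign w)" using alt_coeff_Nil_permutes[OF w(1)] by simp
  have "alt_coeff N' [] (complement_beads N N' u) = alt_coeff N' [] (complement_beads N N' ?v)"
  proof (rule alt_coeff_cong)
    fix j assume "j < N'"
    then have "?v (N + j) \<in> {N..<N + N'}" using permutes_in_image[OF v] by auto
    then have "w (?v (N + j)) = ?v (N + j)" using w(1) by (auto simp: permutes_def)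
    then show "complement_beads N N' u j = complement_beads N N' ?v j"
      using uv unfolding complement_beads_def by (metis comp_apply)
  qed
  also have "\<dots> = of_int (sign ?v) * alt_coeff N' [] (complement_beads N N' id)"
    by (rule complement_beads_Nil_upper[OF v])
  finally show ?thesis unfolding su sg by (simp flip: of_int_mult del: alt_coeff.simps)
next
  case True
  have "alt_coeff N' [] (complement_beads N N' u) = 0"
  proof (rule ccontr)
    assume "\<not> ?thesis"
    then obtain w' where w': "w' permutes {..<N'}" "\<forall>j<N'. complement_beads N N' u j = w' j"
      unfolding alt_coeff_Nil_iff by blast
    have up: "u x \<in> {N..<N + N'}" if "x \<in> {N..<N + N'}" for x
    proof -
      have "w' (x - N) < N'" using that permutes_in_image[OF w'(1), of "x - N"] by auto
      then have "N + N' - 1 - u x < N'" using w'(2)[rule_format, of "x - N"] that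
        by (auto simp: complement_beads_def)
      moreover have "u x < N + N'" using that permutes_in_image[OF u, of x] by auto
      ultimately show ?thesis by auto
    qed
    have "u ` {N..<N + N'} = {N..<N + N'}"
      by (rule card_subset_eq) (use up permutes_inj[OF u] in \<open>auto simp: card_image inj_on_subset\<close>)
    then have im: "u ` {N..<N + N'} = {N..<N + N'}" .
    have lo: "u i < N" if "i < N" for i
    proof (rule ccontr)
      assume "\<not> u i < N"
      then have "u i \<in> u ` {N..<N + N'}" using that permutes_in_image[OF u, of i] by (simp add: im)
      then have "i \<in> {N..<N + N'}" using permutes_inj[OF u] by (simp add: inj_image_mem_iff)
      then show False using that by simp
    qed
    have "(\<lambda>i. if i < N then u i else i) permutes {..<N}"
      by (rule inj_imp_permutes) (auto simp: inj_on_def lo dest: injD[OF permutes_inj[OF u]])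
    then have "alt_coeff N [] u \<noteq> 0" unfolding alt_coeff_Nil_iff by (intro exI[of _ "\<lambda>i. if i < N then u i else i"]) simp
    then show False using True by blast
  qed
  then show ?thesis using True by (simp del: alt_coeff.simps)
qed

lemma complement_beads_id_Nil_nonzero: "alt_coeff N' [] (complement_beads N N' id) \<noteq> 0"
  unfolding alt_coeff_Nil_iff
proof (intro exI conjI)
  show "(\<lambda>j. if j < N' then N' - 1 - j else j) permutes {..<N'}"
    by (rule inj_imp_permutes) (auto simp: inj_on_def)
qed (auto simp: complement_beads_def)

text \<open>Removing a part moves the bead \<open>u i\<close> into the gap \<open>u (N + j)\<close>. Seen from the complement, with
  positions reversed, it moves a bead of the complement in the same way, so conjugation of partitions
  becomes the transposition of two values of \<open>u\<close>.\<close>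

lemma alt_coeff_complement:
  assumes "u permutes {..<N + N'}" "\<forall>k\<in>set \<nu>. 1 \<le> k"
  shows "alt_coeff N' \<nu> (complement_beads N N' u)
    = alt_coeff N' [] (complement_beads N N' id) * (-1) ^ length \<nu> * of_int (sign u) * alt_coeff N \<nu> u"
  using assms
proof (induction \<nu> arbitrary: u)
  case Nil
  then show ?case using complement_beads_Nil[OF Nil(1)] by (simp only: list.size power_0 mult_1_right)
next
  case (Cons k \<nu>)
  note u = Cons.prems(1)
  let ?M = "N + N'" and ?\<eta> = "alt_coeff N' [] (complement_beads N N' id)" and ?c = "complement_beads N N'"
  have k: "1 \<le> k" using Cons.prems by simp
  \<comment> \<open>Pairs of a bead and a gap \<open>k\<close> positions below it: the moves common
    to both sides.\<close>
  define P where "P = {(i, j). i < N \<and> j < N' \<and> u i = u (N + j) + k}"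
  have inj: "u x = u y \<longleftrightarrow> x = y" for x y using permutes_inj[OF u] by (simp add: inj_eq)
  have uM: "u x < ?M" if "x < ?M" for x using permutes_in_image[OF u, of x] that by auto
  have finP: "finite P" by (rule finite_subset[of _ "{..<N} \<times> {..<N'}"]) (auto simp: P_def)
  have surj: "\<exists>p<?M. u p = y" if "y < ?M" for y
    using permutes_image[OF u] that by (metis imageE lessThan_iff)
  have L: "alt_coeff N (k # \<nu>) u = (\<Sum>(i, j)\<in>P. alt_coeff N \<nu> (u \<circ> transpose i (N + j)))"
  proof -
    have "(\<Sum>(i, j)\<in>P. alt_coeff N \<nu> (u \<circ> transpose i (N + j))) = (\<Sum>(i, j)\<in>P. alt_coeff N \<nu> (u(i := u i - k)))"
      by (rule sum.cong) (auto simp: P_def transpose_def intro!: alt_coeff_cong)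
    also have "\<dots> = (\<Sum>i\<in>fst ` P. alt_coeff N \<nu> (u(i := u i - k)))"
      by (subst sum.reindex) (auto simp: P_def inj_on_def inj case_prod_beta)
    also have "\<dots> = (\<Sum>i | i < N \<and> k \<le> u i. alt_coeff N \<nu> (u(i := u i - k)))"
    \<comment> \<open>A bead that lands on another bead contributes 0, so only moves into gaps
      survive.\<close>
    proof (rule sum.mono_neutral_left)
      show "\<forall>i\<in>{i. i < N \<and> k \<le> u i} - fst ` P. alt_coeff N \<nu> (u(i := u i - k)) = 0"
      proof
        fix i assume i: "i \<in> {i. i < N \<and> k \<le> u i} - fst ` P"
        have "u i - k < ?M" using uM[of i] i by auto
        then obtain p where p: "p < ?M" "u p = u i - k" using surj by blast
        have "p < N"
        proof (rule ccontr)
          assume "\<not> p < N"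
          then have "(i, p - N) \<in> P" using p i by (auto simp: P_def)
          then show False using i by force
        qed
        moreover have "p \<noteq> i" using p i k by auto
        ultimately have "\<not> inj_on (u(i := u i - k)) {..<N}" unfolding inj_on_def using i p
          by (metis (no_types, lifting) DiffD1 fun_upd_other fun_upd_same lessThan_iff mem_Collect_eq)
        then show "alt_coeff N \<nu> (u(i := u i - k)) = 0" by (rule alt_coeff_not_inj)
      qed
    qed (auto simp: P_def)
    finally show ?thesis by simp
  qed
  have R: "alt_coeff N' (k # \<nu>) (?c u) = (\<Sum>(i, j)\<in>P. alt_coeff N' \<nu> (?c (u \<circ> transpose i (N + j))))"
  proof -
    have "(\<Sum>(i, j)\<in>P. alt_coeff N' \<nu> (?c (u \<circ> transpose i (N + j)))) = (\<Sum>(i, j)\<in>P. alt_coeff N' \<nu> ((?c u)(j := ?c u j - k)))"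
      by (rule sum.cong) (auto simp: P_def transpose_def complement_beads_def intro!: alt_coeff_cong)
    also have "\<dots> = (\<Sum>j\<in>snd ` P. alt_coeff N' \<nu> ((?c u)(j := ?c u j - k)))"
      by (subst sum.reindex) (auto simp: P_def inj_on_def inj case_prod_beta dest: sym)
    also have "\<dots> = (\<Sum>j | j < N' \<and> k \<le> ?c u j. alt_coeff N' \<nu> ((?c u)(j := ?c u j - k)))"
    proof (rule sum.mono_neutral_left)
      show "snd ` P \<subseteq> {j. j < N' \<and> k \<le> ?c u j}"
      proof clarify
        fix i j assume "(i, j) \<in> P"
        then show "snd (i, j) < N' \<and> k \<le> ?c u (snd (i, j))"
          using uM[of i] by (auto simp: P_def complement_beads_def)
      qed
      show "\<forall>j\<in>{j. j < N' \<and> k \<le> ?c u j} - snd ` P. alt_coeff N' \<nu> ((?c u)(j := ?c u j - k)) = 0"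
      proof
        fix j assume j: "j \<in> {j. j < N' \<and> k \<le> ?c u j} - snd ` P"
        then have lt: "u (N + j) + k < ?M" using k by (auto simp: complement_beads_def)
        then obtain p where p: "p < ?M" "u p = u (N + j) + k" using surj by blast
        have "N \<le> p"
        proof (rule ccontr)
          assume "\<not> N \<le> p"
          then have "(p, j) \<in> P" using p j by (auto simp: P_def)
          then show False using j by force
        qed
        then have p': "p - N < N'" "?c u (p - N) = ?c u j - k" "p - N \<noteq> j"
          using p k lt by (auto simp: complement_beads_def)
        then have "\<not> inj_on ((?c u)(j := ?c u j - k)) {..<N'}" unfolding inj_on_def using j
          by (metis (no_types, lifting) DiffD1 fun_upd_other fun_upd_same lessThan_iff mem_Collect_eq)
        then show "alt_coeff N' \<nu> ((?c u)(j := ?c u j - k)) = 0" by (rule alt_coeff_not_inj)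
      qed
    qed auto
    finally show ?thesis by simp
  qed
  \<comment> \<open>Each move is a transposition of values of \<open>u\<close> and reverses its
    sign, whence one factor \<open>-1\<close> per part.\<close>
  have step: "alt_coeff N' \<nu> (?c (u \<circ> transpose i (N + j))) =
      ?\<eta> * (-1) ^ length (k # \<nu>) * of_int (sign u) * alt_coeff N \<nu> (u \<circ> transpose i (N + j))" if "(i, j) \<in> P" for i j
  proof -
    have ij: "i < ?M" "N + j < ?M" "i \<noteq> N + j" using that by (auto simp: P_def)
    have t: "transpose i (N + j) permutes {..<?M}" by (rule permutes_swap_id) (use ij in auto)
    have sg: "sign (u \<circ> transpose i (N + j)) = - sign u"
      using ij(3) by (simp add: sign_compose permutation_swap_id sign_swap_id permutation_of_permutes[OF u])
    have "\<forall>k\<in>set \<nu>. 1 \<le> k" using Cons.prems(2) by simp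
    from Cons.IH[OF permutes_compose[OF t u] this] show ?thesis unfolding sg
      by (simp only: length_Cons power_Suc of_int_minus mult_minus_left mult_minus_right mult_1_left)
  qed
  show ?case unfolding L R sum_distrib_left
    by (rule sum.cong) (simp_all only: step split_beta prod.collapse)
qed

section \<open>Cycle types\<close>

lemma orbit_eq_of_mem:
  assumes "permutation f" "y \<in> orbit f x"
  shows "orbit f y = orbit f x"
  using assms by (meson cyclic_on_orbit' orbit_cyclic_eq3)

text \<open>The unfolded recursion: \<open>g\<close> tells which bead each part moves. The parts are
  indexed by the elements of \<open>os\<close>, which will be the cycles of a permutation.\<close>

lemma alt_coeff_map:
  assumes "distinct os"
  shows "alt_coeff N (map s os) m = (\<Sum>g\<in>set os \<rightarrow>\<^sub>E {..<N}.
    \<Sum>w | w permutes {..<N} \<and> (\<forall>i<N. m i = w i + (\<Sum>o'\<in>{o'\<in>set os. g o' = i}. s o')). of_int (sign w))"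
  using assms
proof (induction os arbitrary: m)
  case Nil
  then show ?case by simp
next
  case (Cons a os)
  let ?C = "\<lambda>m os g. {w. w permutes {..<N} \<and> (\<forall>i<N. m i = w i + (\<Sum>o'\<in>{o'\<in>set os. g o' = i}. s o'))}"
  let ?S = "\<lambda>m os g. \<Sum>w\<in>?C m os g. of_int (sign w) :: rat"
  have a: "a \<notin> set os" using Cons.prems by simp
  \<comment> \<open>If the new part \<open>a\<close> is sent to bead \<open>i\<close>, lowering
    \<open>m i\<close> by \<open>s a\<close> gives the same condition on \<open>w\<close>; for
    \<open>m i < s a\<close> no \<open>w\<close> exists.\<close>
  have C: "?C m (a # os) (g(a := i)) = (if s a \<le> m i then ?C (m(i := m i - s a)) os g else {})" if i: "i < N" for i g
  proof -
    have S: "(\<Sum>o'\<in>{o'\<in>set (a # os). (g(a := i)) o' = i'}. s o') =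
      (if i' = i then s a else 0) + (\<Sum>o'\<in>{o'\<in>set os. g o' = i'}. s o')" for i'
    proof (cases "i' = i")
      case True
      have "{o'\<in>set (a # os). (g(a := i)) o' = i'} = insert a {o'\<in>set os. g o' = i'}"
        using a True by auto
      then show ?thesis using a True by simp
    next
      case False
      then have "{o'\<in>set (a # os). (g(a := i)) o' = i'} = {o'\<in>set os. g o' = i'}" using a by auto
      then show ?thesis using False by simp
    qed
    show ?thesis
    proof (cases "s a \<le> m i")
      case True
      have "(m i' = w i' + ((if i' = i then s a else 0) + S)) \<longleftrightarrow> ((m(i := m i - s a)) i' = w i' + S)" for i' S and w :: "nat \<Rightarrow> nat"
        using True by auto
      then show ?thesis unfolding S using True by simp
    next
      case False
      then have "m i \<noteq> w i + ((if i = i then s a else 0) + S)" for w :: "nat \<Rightarrow> nat" and S by simp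
      then show ?thesis unfolding S using False i by auto
    qed
  qed
  have "(\<Sum>g\<in>set (a # os) \<rightarrow>\<^sub>E {..<N}. ?S m (a # os) g)
      = (\<Sum>(i, g)\<in>{..<N} \<times> (set os \<rightarrow>\<^sub>E {..<N}). ?S m (a # os) (g(a := i)))"
    unfolding list.set(2) PiE_insert_eq
    by (subst sum.reindex) (use a inj_combinator[of a "set os" "\<lambda>_. {..<N}"] in \<open>simp_all add: case_prod_beta\<close>)
  also have "\<dots> = (\<Sum>i<N. \<Sum>g\<in>set os \<rightarrow>\<^sub>E {..<N}. ?S m (a # os) (g(a := i)))"
    by (simp add: sum.cartesian_product)
  also have "\<dots> = (\<Sum>i<N. if s a \<le> m i then \<Sum>g\<in>set os \<rightarrow>\<^sub>E {..<N}. ?S (m(i := m i - s a)) os g else 0)"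
    by (intro sum.cong refl) (simp only: C lessThan_iff if_split, simp)
  also have "\<dots> = (\<Sum>i | i < N \<and> s a \<le> m i. \<Sum>g\<in>set os \<rightarrow>\<^sub>E {..<N}. ?S (m(i := m i - s a)) os g)"
    by (simp add: sum.If_cases Int_def)
  also have "\<dots> = alt_coeff N (map s (a # os)) m"
    using Cons.prems by (simp only: list.map alt_coeff.simps Cons.IH distinct.simps)
  finally show ?case by (rule sym)
qed

text \<open>The words constant on the cycles of \<open>\<sigma>\<close>. With \<open>content\<close>
  as weight they index the terms of the power sum of the cycle type of
  \<open>\<sigma>\<close>.\<close>

definition fixed_words :: "nat \<Rightarrow> nat \<Rightarrow> (nat \<Rightarrow> nat) \<Rightarrow> (nat \<Rightarrow> nat) set" where
  "fixed_words n N \<sigma> = {f \<in> {..<n} \<rightarrow>\<^sub>E {..<N}. \<forall>x<n. f (\<sigma> x) = f x}"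

definition content :: "nat \<Rightarrow> (nat \<Rightarrow> nat) \<Rightarrow> nat \<Rightarrow> nat" where
  "content n f i = card {x. x < n \<and> f x = i}"

lemma list_of_image_mset:
  assumes "mset \<nu> = image_mset h (mset_set A)" "finite A"
  obtains os where "distinct os" "set os = A" "map h os = \<nu>"
proof -
  obtain os0 where os0: "set os0 = A" "distinct os0" using finite_distinct_list assms(2) by blast
  then have "mset (map h os0) = mset \<nu>" using assms(1) by (simp add: mset_set_set[symmetric])
  then obtain p where p: "p permutes {..<length (map h os0)}" "permute_list p (map h os0) = \<nu>"
    using mset_eq_permutation by metis
  show thesis
    by (rule that[of "permute_list p os0"]) (use p os0 in \<open>auto simp: permute_list_map\<close>)
qed

text \<open>Sending each cycle to a bead is the same as choosing a word constant on cycles, and the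
  total length of the cycles sent to bead \<open>i\<close> is the number of letters
  \<open>i\<close>.\<close>

lemma alt_coeff_cycle_type:
  assumes \<sigma>: "\<sigma> permutes {..<n}" and \<nu>: "mset \<nu> = cycle_type n \<sigma>"
  shows "alt_coeff N \<nu> m = (\<Sum>f\<in>fixed_words n N \<sigma>.
    \<Sum>w | w permutes {..<N} \<and> (\<forall>i<N. m i = w i + content n f i). of_int (sign w))"
proof -
  let ?O = "orbit \<sigma> ` {..<n}"
  have perm: "permutation \<sigma>" using \<sigma> by (rule permutation_of_permutes)
  have sub: "orbit \<sigma> x \<subseteq> {..<n}" if "x < n" for x using permutes_orbit_subset[OF \<sigma>] that by simp
  have self: "x \<in> orbit \<sigma> x" for x by (rule permutation_self_in_orbit[OF perm])
  have eq: "orbit \<sigma> y = orbit \<sigma> x" if "y \<in> orbit \<sigma> x" for x y using that by (rule orbit_eq_of_mem[OF perm])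
  obtain os where os: "distinct os" "set os = ?O" "map card os = \<nu>"
    using list_of_image_mset[of \<nu> card ?O] \<nu> by (auto simp: cycle_type_def)
  have const: "f y = f x" if f: "f \<in> fixed_words n N \<sigma>" and x: "x < n" and y: "y \<in> orbit \<sigma> x" for f x y
    using y
  proof induction
    case base
    then show ?case using f x by (auto simp: fixed_words_def)
  next
    case (step y)
    then have "y < n" using sub[OF x] by auto
    then show ?case using f step by (auto simp: fixed_words_def)
  qed
  \<comment> \<open>\<open>?i\<close> and \<open>?j\<close> translate between functions on cycles
    and words; the chosen representative of a cycle is irrelevant because the word is constant
    there.\<close>
  let ?i = "\<lambda>f. \<lambda>o'\<in>?O. f (SOME x. x \<in> o')"
  let ?j = "\<lambda>g. \<lambda>x\<in>{..<n}. g (orbit \<sigma> x)"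
  have some: "(SOME y. y \<in> orbit \<sigma> x) \<in> orbit \<sigma> x" for x using self by (rule someI)
  have val: "f (SOME y. y \<in> orbit \<sigma> x) = f x" if "f \<in> fixed_words n N \<sigma>" "x < n" for f x
    using const[OF that some] .
  have cont: "(\<Sum>o'\<in>{o'\<in>?O. g o' = i}. card o') = content n (?j g) i" for g :: "nat set \<Rightarrow> nat" and i
  proof -
    have disj: "A \<inter> B = {}" if "A \<in> ?O" "B \<in> ?O" "A \<noteq> B" for A B
      using that eq by (metis disjoint_iff imageE)
    have "{x. x < n \<and> ?j g x = i} = \<Union>{o'\<in>?O. g o' = i}"
      using self sub eq by (auto; blast)
    also have "card \<dots> = (\<Sum>o'\<in>{o'\<in>?O. g o' = i}. card o')"
    proof (rule card_Union_disjoint)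
      show "finite A" if "A \<in> {o'\<in>?O. g o' = i}" for A
        using that sub finite_subset[OF _ finite_lessThan] by blast
    qed (use disj in \<open>auto simp: pairwise_def disjnt_def\<close>)
    finally show ?thesis by (simp add: content_def)
  qed
  have "alt_coeff N \<nu> m = (\<Sum>g\<in>?O \<rightarrow>\<^sub>E {..<N}.
    \<Sum>w | w permutes {..<N} \<and> (\<forall>i<N. m i = w i + content n (?j g) i). of_int (sign w))"
    using alt_coeff_map[OF os(1), of N card m] unfolding os cont .
  also have "\<dots> = (\<Sum>f\<in>fixed_words n N \<sigma>.
    \<Sum>w | w permutes {..<N} \<and> (\<forall>i<N. m i = w i + content n f i). of_int (sign w))"
  proof (rule sum.reindex_bij_witness[where i = ?i and j = ?j])
    fix g assume g: "g \<in> ?O \<rightarrow>\<^sub>E {..<N}"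
    have "orbit \<sigma> (\<sigma> x) = orbit \<sigma> x" for x using eq orbit.base by metis
    then show "?j g \<in> fixed_words n N \<sigma>"
      using g permutes_in_image[OF \<sigma>] by (auto simp: fixed_words_def)
    show "?i (?j g) = g"
    proof
      fix o'
      show "?i (?j g) o' = g o'"
      proof (cases "o' \<in> ?O")
        case True
        then obtain x where x: "o' = orbit \<sigma> x" "x < n" by auto
        then have "(SOME y. y \<in> o') \<in> orbit \<sigma> x" using some by simp
        then have "(SOME y. y \<in> o') < n" "orbit \<sigma> (SOME y. y \<in> o') = o'" using sub[OF x(2)] eq x(1) by auto
        then show ?thesis using True by simp
      qed (use g in \<open>auto simp: PiE_def extensional_def\<close>)
    qed
  next
    fix f assume f: "f \<in> fixed_words n N \<sigma>"
    show "?j (?i f) = f"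
      using f val[OF f] by (auto simp: fun_eq_iff fixed_words_def PiE_def extensional_def)
    show "?i f \<in> ?O \<rightarrow>\<^sub>E {..<N}"
      using f val[OF f] by (auto simp: fixed_words_def)
  qed simp
  finally show ?thesis .
qed

section \<open>Permutations of equal cycle type are conjugate\<close>

lemma orbit_conv_range: "permutation p \<Longrightarrow> orbit p a = range (\<lambda>i. (p ^^ i) a)"
  using orbit_altdef_permutation[of p a] by auto

lemma card_orbit_conv_least_power: "permutation p \<Longrightarrow> card (orbit p a) = least_power p a"
  using distinct_card[OF cycle_of_permutation[of p a]]
  by (simp only: support_set orbit_conv_range length_map length_upt diff_zero)

lemma funpow_eq_iff:
  assumes "permutation p" "i \<le> j"
  shows "(p ^^ i) a = (p ^^ j) a \<longleftrightarrow> card (orbit p a) dvd j - i"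
proof -
  have b: "bij p" using assms(1) permutation_bijective by blast
  have "(p ^^ j) a = (p ^^ i) ((p ^^ (j - i)) a)" using assms(2) by (metis comp_apply funpow_add le_add_diff_inverse)
  moreover have "inj (p ^^ i)" using b by (simp add: bij_is_inj inj_fn)
  ultimately have "(p ^^ i) a = (p ^^ j) a \<longleftrightarrow> (p ^^ (j - i)) a = a" by (metis injD)
  then show ?thesis using least_power_dvd[OF assms(1)] card_orbit_conv_least_power[OF assms(1)] by metis
qed

text \<open>Send \<open>(\<sigma> ^^ i) x\<close> to \<open>(\<tau> ^^ i) y\<close>; both depend
  exactly on \<open>i\<close> modulo the common orbit length.\<close>

lemma orbit_equivariant_bij:
  assumes \<sigma>: "permutation \<sigma>" and \<tau>: "permutation \<tau>" and card: "card (orbit \<sigma> x) = card (orbit \<tau> y)"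
  obtains g where "bij_betw g (orbit \<sigma> x) (orbit \<tau> y)" "\<And>z. z \<in> orbit \<sigma> x \<Longrightarrow> g (\<sigma> z) = \<tau> (g z)"
proof -
  have key: "(\<sigma> ^^ i) x = (\<sigma> ^^ j) x \<longleftrightarrow> (\<tau> ^^ i) y = (\<tau> ^^ j) y" for i j
  proof (induction i j rule: linorder_wlog)
    case (le i j)
    then show ?case using funpow_eq_iff[OF \<sigma>] funpow_eq_iff[OF \<tau>] card by metis
  next
    case (sym i j)
    then show ?case by metis
  qed
  define g where "g z = (\<tau> ^^ (SOME i. (\<sigma> ^^ i) x = z)) y" for z
  have g: "g ((\<sigma> ^^ i) x) = (\<tau> ^^ i) y" for i
  proof -
    have "(\<sigma> ^^ (SOME i'. (\<sigma> ^^ i') x = (\<sigma> ^^ i) x)) x = (\<sigma> ^^ i) x"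
      by (rule someI[of "\<lambda>i'. (\<sigma> ^^ i') x = (\<sigma> ^^ i) x" i]) simp
    then show ?thesis unfolding g_def using key by blast
  qed
  have "g ` range (\<lambda>i. (\<sigma> ^^ i) x) = range (\<lambda>i. (\<tau> ^^ i) y)" by (auto simp: g image_iff)
  moreover have "inj_on g (range (\<lambda>i. (\<sigma> ^^ i) x))" by (auto simp: inj_on_def g key)
  ultimately have "bij_betw g (orbit \<sigma> x) (orbit \<tau> y)"
    by (simp add: bij_betw_def orbit_conv_range[OF \<sigma>] orbit_conv_range[OF \<tau>])
  moreover have "g (\<sigma> z) = \<tau> (g z)" if "z \<in> orbit \<sigma> x" for z
  proof -
    obtain i where i: "z = (\<sigma> ^^ i) x" using \<open>z \<in> orbit \<sigma> x\<close> unfolding orbit_conv_range[OF \<sigma>] by blast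
    have "\<sigma> z = (\<sigma> ^^ Suc i) x" by (simp add: i)
    then show ?thesis unfolding i using g[of "Suc i"] g[of i] by simp
  qed
  ultimately show thesis by (rule that)
qed

text \<open>The orbits are listed so that corresponding ones have equal size, and equivariant
  bijections between them are glued together.\<close>

lemma conjugate_of_cycle_type_eq:
  assumes \<sigma>: "\<sigma> permutes {..<n}" and \<tau>: "\<tau> permutes {..<n}" and eq: "cycle_type n \<sigma> = cycle_type n \<tau>"
  obtains g where "g permutes {..<n}" "\<tau> = g \<circ> \<sigma> \<circ> inv g"
proof -
  let ?A = "orbit \<sigma> ` {..<n}" and ?B = "orbit \<tau> ` {..<n}"
  have p\<sigma>: "permutation \<sigma>" and p\<tau>: "permutation \<tau>" using \<sigma> \<tau> permutation_of_permutes by blast+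
  obtain as where as: "distinct as" "set as = ?A"
    using finite_distinct_list[of ?A] by auto
  have "mset (map card as) = image_mset card (mset_set ?A)" using as by (simp add: mset_set_set[symmetric])
  then obtain bs where bs: "distinct bs" "set bs = ?B" "map card bs = map card as"
    using list_of_image_mset[of "map card as" card ?B] eq by (auto simp: cycle_type_def)
  have len: "length bs = length as" using bs(3) by (metis length_map)
  have "\<exists>h. bij_betw h (as ! i) (bs ! i) \<and> (\<forall>z\<in>as ! i. h (\<sigma> z) = \<tau> (h z))" if i: "i < length as" for i
  proof -
    have "as ! i \<in> ?A" "bs ! i \<in> ?B" using as bs i len nth_mem by metis+
    then obtain x y where xy: "as ! i = orbit \<sigma> x" "bs ! i = orbit \<tau> y" by auto
    have "card (as ! i) = card (bs ! i)" using bs(3) i len by (metis nth_map)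
    then show ?thesis using orbit_equivariant_bij[OF p\<sigma> p\<tau>, of x y] unfolding xy by metis
  qed
  then have "\<forall>i. \<exists>h. i < length as \<longrightarrow> bij_betw h (as ! i) (bs ! i) \<and> (\<forall>z\<in>as ! i. h (\<sigma> z) = \<tau> (h z))"
    by blast
  then obtain h where hh: "\<forall>i. i < length as \<longrightarrow> bij_betw (h i) (as ! i) (bs ! i) \<and> (\<forall>z\<in>as ! i. h i (\<sigma> z) = \<tau> (h i z))"
    by (rule choice[THEN exE])
  have h: "bij_betw (h i) (as ! i) (bs ! i)" "z \<in> as ! i \<Longrightarrow> h i (\<sigma> z) = \<tau> (h i z)" if "i < length as" for i z
    using hh that by blast+
  have self: "x \<in> orbit \<sigma> x" "x \<in> orbit \<tau> x" for x
    by (rule permutation_self_in_orbit[OF p\<sigma>], rule permutation_self_in_orbit[OF p\<tau>])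
  have disjA: "A = orbit \<sigma> z" if "A \<in> ?A" "z \<in> A" for A z
    using that orbit_eq_of_mem[OF p\<sigma>, of z] by (auto simp del: lessThan_iff)
  have disjB: "B = orbit \<tau> z" if "B \<in> ?B" "z \<in> B" for B z
    using that orbit_eq_of_mem[OF p\<tau>, of z] by (auto simp del: lessThan_iff)
  \<comment> \<open>The number of the orbit of \<open>z\<close> in the list \<open>as\<close>; it
    selects the bijection to be used at \<open>z\<close>.\<close>
  define ix where "ix z = (SOME i. i < length as \<and> as ! i = orbit \<sigma> z)" for z
  have ix: "ix z < length as \<and> as ! ix z = orbit \<sigma> z" if "z < n" for z
  proof -
    have "orbit \<sigma> z \<in> set as" using that as by auto
    then have "\<exists>i. i < length as \<and> as ! i = orbit \<sigma> z" by (metis in_set_conv_nth)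
    then show ?thesis unfolding ix_def by (rule someI_ex)
  qed
  define g where "g z = (if z < n then h (ix z) z else z)" for z
  have gin: "g z \<in> bs ! ix z" if "z < n" for z
    using h(1)[of "ix z"] ix[OF that] self(1)[of z] that by (auto simp: g_def bij_betw_def)
  have glt: "g z < n" if "z < n" for z
  proof -
    have "bs ! ix z \<in> ?B" using ix[OF that] len bs(2) by (metis nth_mem)
    then obtain y where "y < n" "bs ! ix z = orbit \<tau> y" by auto
    then show ?thesis using gin[OF that] permutes_orbit_subset[OF \<tau>, of y] by auto
  qed
  have gp: "g permutes {..<n}"
  proof (rule inj_imp_permutes)
    show "inj_on g {..<n}"
    proof (rule inj_onI)
      fix x y assume xy: "x \<in> {..<n}" "y \<in> {..<n}" "g x = g y"
      have x: "x < n" and y: "y < n" using xy by auto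
      have "bs ! ix x \<in> ?B" "bs ! ix y \<in> ?B" using ix[OF x] ix[OF y] len bs(2) by (metis nth_mem)+
      then have "bs ! ix x = bs ! ix y" using disjB gin[OF x] gin[OF y] xy(3) by metis
      then have "ix x = ix y" using bs(1) ix[OF x] ix[OF y] len by (metis nth_eq_iff_index_eq)
      moreover have "x \<in> as ! ix x" "y \<in> as ! ix y" using ix[OF x] ix[OF y] self by auto
      ultimately show "x = y" using h(1)[of "ix x"] ix[OF x] xy(3) x y
        by (simp add: g_def bij_betw_def inj_on_def)
    qed
  qed (use glt in \<open>auto simp: g_def\<close>)
  have comm: "g (\<sigma> z) = \<tau> (g z)" for z
  proof (cases "z < n")
    case True
    then have sz: "\<sigma> z < n" using permutes_in_image[OF \<sigma>, of z] by simp
    have "orbit \<sigma> (\<sigma> z) = orbit \<sigma> z" by (rule permutation_orbit_step[OF p\<sigma>])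
    then have "ix (\<sigma> z) = ix z" by (simp add: ix_def)
    then show ?thesis using True sz h(2)[of "ix z" z] ix[OF True] self by (simp add: g_def)
  next
    case False
    then show ?thesis using permutes_not_in[OF \<sigma>] permutes_not_in[OF \<tau>] by (simp add: g_def)
  qed
  have "\<tau> = g \<circ> \<sigma> \<circ> inv g"
    by (simp add: fun_eq_iff comm permutes_inverses[OF gp])
  with gp show thesis by (rule that)
qed

section \<open>The sign in terms of the number of cycles\<close>

lemma sign_cycle_of_list: "distinct cs \<Longrightarrow> cs \<noteq> [] \<Longrightarrow> sign (cycle_of_list cs) = (-1) ^ (length cs + 1)"
proof (induction cs rule: cycle_of_list.induct)
  case (1 i j cs)
  have "sign (cycle_of_list (i # j # cs)) = sign (transpose i j) * sign (cycle_of_list (j # cs))"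
    unfolding cycle_of_list.simps by (rule sign_compose[OF permutation_swap_id permutation_of_cycle])
  then show ?case using 1 by (simp add: sign_swap_id del: cycle_of_list.simps)
qed auto

lemma orbit_cycle_of_list:
  assumes "distinct cs" "x \<in> set cs"
  shows "orbit (cycle_of_list cs) x = set cs"
proof
  show "orbit (cycle_of_list cs) x \<subseteq> set cs"
    by (rule permutes_orbit_subset[OF cycle_permutes assms(2)])
  obtain i where i: "i < length cs" "x = cs ! i" using assms(2) by (metis in_set_conv_nth)
  have "y \<in> orbit (cycle_of_list cs) x" if y: "y \<in> set cs" for y
  proof -
    obtain j where j: "j < length cs" "y = cs ! j" using y by (metis in_set_conv_nth)
    let ?n = "length cs - i + j"
    have "(cycle_of_list cs ^^ ?n) x = map (cycle_of_list cs ^^ ?n) cs ! i" using i by simp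
    also have "\<dots> = cs ! ((?n + i) mod length cs)"
      unfolding cyclic_rotation[OF assms(1)] using i by (simp add: nth_rotate add.commute)
    also have "(?n + i) mod length cs = j" using i j by simp
    finally have "y = (cycle_of_list cs ^^ ?n) x" using j by simp
    then show ?thesis unfolding orbit_altdef using i by auto
  qed
  then show "set cs \<subseteq> orbit (cycle_of_list cs) x" by blast
qed

text \<open>A cycle of length \<open>c\<close> has sign \<open>(-1) ^ (c + 1)\<close> and adds
  \<open>c\<close> points and one orbit. Fixed points in \<open>S\<close> count as orbits
  too.\<close>

lemma sign_cycle_decomp:
  assumes "cycle_decomp S p"
  shows "finite S \<and> p permutes S \<and> sign p = (-1) ^ (card S + card (orbit p ` S))"
  using assms
proof induction
  case empty
  then show ?case by (auto simp: id_def)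
next
  case (comp I p cs)
  let ?c = "cycle_of_list cs" and ?q = "cycle_of_list cs \<circ> p"
  have fin: "finite I" and p: "p permutes I" and sp: "sign p = (-1) ^ (card I + card (orbit p ` I))"
    using comp.IH by auto
  have c: "?c permutes set cs" by (rule cycle_permutes)
  have q: "?q permutes (set cs \<union> I)"
    by (rule permutes_compose) (use p c in \<open>auto intro: permutes_subset\<close>)
  have pp: "permutation p" using p fin permutation_permutes by blast
  have s: "sign ?q = sign ?c * sign p" by (rule sign_compose[OF permutation_of_cycle pp])
  have oI: "orbit ?q x = orbit p x" if "x \<in> I" for x
  proof (rule orbit_cong0[OF that, symmetric])
    show "p \<in> I \<rightarrow> I" using p by (auto simp: permutes_in_image)
    show "p y = ?q y" if "y \<in> I" for y
    proof -
      have "p y \<notin> set cs" using that p comp.hyps(3) by (auto simp: permutes_in_image)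
      then show ?thesis using permutes_not_in[OF c] by simp
    qed
  qed
  have oc: "orbit ?q x = set cs" if "x \<in> set cs" for x
  proof -
    have "orbit ?q x = orbit ?c x"
    proof (rule orbit_cong0[OF that, symmetric])
      show "?c \<in> set cs \<rightarrow> set cs" using c by (auto simp: permutes_in_image)
      show "?c y = ?q y" if "y \<in> set cs" for y
      proof -
        have "y \<notin> I" using that comp.hyps(3) by auto
        then show ?thesis using permutes_not_in[OF p] by simp
      qed
    qed
    then show ?thesis using orbit_cycle_of_list[OF comp.hyps(2) that] by simp
  qed
  show ?case
  proof (cases "cs = []")
    case True
    then have "?q = p" "set cs \<union> I = I" by auto
    then show ?thesis using fin p sp by metis
  next
    case False
    have "orbit ?q ` (set cs \<union> I) = insert (set cs) (orbit p ` I)"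
    proof -
      have "orbit ?q ` set cs = {set cs}" using False oc by (auto simp: image_constant_conv cong: image_cong)
      moreover have "orbit ?q ` I = orbit p ` I" by (rule image_cong[OF refl oI])
      ultimately show ?thesis by (simp only: image_Un insert_is_Un[symmetric])
    qed
    moreover have "set cs \<notin> orbit p ` I"
    proof
      assume "set cs \<in> orbit p ` I"
      then obtain x where "x \<in> I" "set cs = orbit p x" by blast
      then have "set cs \<subseteq> I" using permutes_orbit_subset[OF p] by metis
      then show False using comp.hyps(3) False by (metis Int_absorb2 set_empty)
    qed
    ultimately have c1: "card (orbit ?q ` (set cs \<union> I)) = Suc (card (orbit p ` I))" using fin by simp
    have c2: "card (set cs \<union> I) = length cs + card I"
      using comp.hyps fin by (simp add: card_Un_disjoint distinct_card)
    have "sign ?q = (-1) ^ (card (set cs \<union> I) + card (orbit ?q ` (set cs \<union> I)))"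
      unfolding c1 c2 s sp sign_cycle_of_list[OF comp.hyps(2) False] by (simp add: power_add)
    then show ?thesis using q fin by blast
  qed
qed

lemma sign_cycle_type:
  assumes "\<sigma> permutes {..<n}" "mset \<nu> = cycle_type n \<sigma>"
  shows "sign \<sigma> = (-1) ^ (n + length \<nu>)"
proof -
  have "length \<nu> = card (orbit \<sigma> ` {..<n})"
    using assms(2) by (metis cycle_type_def size_image_mset size_mset size_mset_set)
  then show ?thesis
    using sign_cycle_decomp[OF cycle_decomposition[OF assms(1)]] by simp
qed

lemma cycle_type_positive: 
  assumes "\<sigma> permutes {..<n}" "k \<in># cycle_type n \<sigma>"
  shows "1 \<le> k"
proof -
  obtain x where x: "x < n" "k = card (orbit \<sigma> x)" using assms(2) by (auto simp: cycle_type_def)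
  have "finite (orbit \<sigma> x)" using permutes_orbit_subset[OF assms(1), of x] x finite_subset by auto
  then show ?thesis using x orbit_nonempty[of \<sigma> x] by (simp add: card_gt_0_iff Suc_le_eq)
qed

lemma sum_mset_cycle_type:
  assumes \<sigma>: "\<sigma> permutes {..<n}"
  shows "sum_mset (cycle_type n \<sigma>) = n"
proof -
  have p: "permutation \<sigma>" using \<sigma> permutation_of_permutes by blast
  have sub: "orbit \<sigma> x \<subseteq> {..<n}" if "x < n" for x using permutes_orbit_subset[OF \<sigma>] that by simp
  have "{..<n} = \<Union>(orbit \<sigma> ` {..<n})"
  proof
    show "{..<n} \<subseteq> \<Union>(orbit \<sigma> ` {..<n})"
      using permutation_self_in_orbit[OF p] by (auto simp del: lessThan_iff)
  qed (use sub in auto)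
  also have "card \<dots> = sum card (orbit \<sigma> ` {..<n})"
  proof (rule card_Union_disjoint)
    show "pairwise disjnt (orbit \<sigma> ` {..<n})"
    proof (rule pairwiseI)
      fix A B assume AB: "A \<in> orbit \<sigma> ` {..<n}" "B \<in> orbit \<sigma> ` {..<n}" "A \<noteq> B"
      then obtain x y where "A = orbit \<sigma> x" "B = orbit \<sigma> y" by auto
      then show "disjnt A B" using AB(3) orbit_eq_of_mem[OF p] by (metis disjnt_iff)
    qed
  qed (use sub finite_subset in blast)
  also have "\<dots> = sum_mset (cycle_type n \<sigma>)" by (simp add: cycle_type_def sum_unfold_sum_mset)
  finally show ?thesis by simp
qed

section \<open>Class functions\<close>

definition cycle_list :: "nat \<Rightarrow> (nat \<Rightarrow> nat) \<Rightarrow> nat list" where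
  "cycle_list n \<sigma> = sorted_list_of_multiset (cycle_type n \<sigma>)"

lemma mset_cycle_list [simp]: "mset (cycle_list n \<sigma>) = cycle_type n \<sigma>"
  by (simp add: cycle_list_def)

lemma cycle_list_positive: "\<sigma> permutes {..<n} \<Longrightarrow> \<forall>k\<in>set (cycle_list n \<sigma>). 1 \<le> k"
  using cycle_type_positive[of \<sigma> n] by (metis mset_cycle_list set_mset_mset)

lemma sum_list_cycle_list: "\<sigma> permutes {..<n} \<Longrightarrow> sum_list (cycle_list n \<sigma>) = n"
  using sum_mset_cycle_type[of \<sigma> n] by (metis mset_cycle_list sum_mset_sum_list)

text \<open>Up to the factor \<open>n!\<close>, the scalar product of \<open>\<chi>\<close> with the virtual character whose value at
  cycle type \<open>\<nu>\<close> is \<open>alt_coeff N \<nu> m\<close>.\<close>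

definition alt_inner :: "nat \<Rightarrow> ((nat \<Rightarrow> nat) \<Rightarrow> rat) \<Rightarrow> nat \<Rightarrow> (nat \<Rightarrow> nat) \<Rightarrow> rat" where
  "alt_inner n \<chi> N m = (\<Sum>\<sigma> | \<sigma> permutes {..<n}. \<chi> \<sigma> * alt_coeff N (cycle_list n \<sigma>) m)"

lemma alt_inner_not_inj: "\<not> inj_on m {..<N} \<Longrightarrow> alt_inner n \<chi> N m = 0"
  by (simp add: alt_inner_def alt_coeff_not_inj)

text \<open>The Young subgroup of the level sets of the word \<open>f\<close>.\<close>

definition stabilizer :: "nat \<Rightarrow> (nat \<Rightarrow> nat) \<Rightarrow> (nat \<Rightarrow> nat) set" where
  "stabilizer n f = {\<sigma>. \<sigma> permutes {..<n} \<and> (\<forall>x<n. f (\<sigma> x) = f x)}"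

lemma finite_stabilizer [simp]: "finite (stabilizer n f)"
  by (rule finite_subset[OF _ finite_permutations[OF finite_lessThan]]) (auto simp: stabilizer_def)

text \<open>A form of Frobenius reciprocity: after exchanging the sums over permutations and fixed
  words, a word \<open>f\<close> contributes the sum of \<open>\<psi>\<close> over its
  stabilizer.\<close>

lemma alt_inner_nonzeroE:
  assumes "alt_inner n \<psi> N m \<noteq> 0"
  obtains w f where "w permutes {..<N}" "f \<in> {..<n} \<rightarrow>\<^sub>E {..<N}" "\<forall>i<N. m i = w i + content n f i"
    "sum \<psi> (stabilizer n f) \<noteq> 0"
proof -
  let ?P = "{\<sigma>. \<sigma> permutes {..<n}}" and ?W = "{..<n} \<rightarrow>\<^sub>E {..<N}"
  let ?S = "\<lambda>f. \<Sum>w | w permutes {..<N} \<and> (\<forall>i<N. m i = w i + content n f i). of_int (sign w) :: rat"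
  have fin: "finite ?P" "finite ?W" by (auto simp: finite_permutations finite_PiE)
  have "alt_inner n \<psi> N m = (\<Sum>\<sigma>\<in>?P. \<Sum>f\<in>fixed_words n N \<sigma>. \<psi> \<sigma> * ?S f)"
    unfolding alt_inner_def
    by (intro sum.cong refl) (simp add: alt_coeff_cycle_type sum_distrib_left)
  also have "\<dots> = (\<Sum>\<sigma>\<in>?P. \<Sum>f | f \<in> ?W \<and> \<sigma> \<in> stabilizer n f. \<psi> \<sigma> * ?S f)"
    by (intro sum.cong refl) (auto simp: fixed_words_def stabilizer_def)
  also have "\<dots> = (\<Sum>f\<in>?W. \<Sum>\<sigma> | \<sigma> \<in> ?P \<and> \<sigma> \<in> stabilizer n f. \<psi> \<sigma> * ?S f)"
    by (rule sum.swap_restrict[OF fin])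
  also have "\<dots> = (\<Sum>f\<in>?W. sum \<psi> (stabilizer n f) * ?S f)"
    unfolding sum_distrib_right by (intro sum.cong refl) (auto simp: stabilizer_def)
  finally obtain f where f: "f \<in> ?W" "sum \<psi> (stabilizer n f) * ?S f \<noteq> 0"
    using assms by (metis (no_types, lifting) sum.neutral)
  then have "?S f \<noteq> 0" by auto
  then obtain w where "w permutes {..<N}" "\<forall>i<N. m i = w i + content n f i"
    by (auto elim: sum.not_neutral_contains_not_neutral)
  then show thesis using f that by auto
qed

definition class_function :: "nat \<Rightarrow> ((nat \<Rightarrow> nat) \<Rightarrow> rat) \<Rightarrow> bool" where
  "class_function n \<chi> \<longleftrightarrow> (\<forall>\<sigma> \<tau>. \<sigma> permutes {..<n} \<longrightarrow> \<tau> permutes {..<n} \<longrightarrow>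
     cycle_type n \<sigma> = cycle_type n \<tau> \<longrightarrow> \<chi> \<sigma> = \<chi> \<tau>)"

definition cycle_class :: "nat \<Rightarrow> nat list \<Rightarrow> (nat \<Rightarrow> nat) set" where
  "cycle_class n \<kappa> = {\<sigma>. \<sigma> permutes {..<n} \<and> cycle_type n \<sigma> = mset \<kappa>}"

lemma finite_cycle_class [simp]: "finite (cycle_class n \<kappa>)"
  by (rule finite_subset[OF _ finite_permutations[OF finite_lessThan]]) (auto simp: cycle_class_def)

text \<open>By column orthogonality only the permutations of cycle type \<open>\<kappa>\<close>
  survive; this recovers \<open>\<chi>\<close> from its products with the virtual
  characters.\<close>

lemma sum_alt_coeff_alt_inner:
  assumes "\<forall>k\<in>set \<kappa>. 1 \<le> k" "sum_list \<kappa> = n" "2 * n \<le> N" "N + n \<le> M"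
  shows "(\<Sum>m\<in>{..<N} \<rightarrow>\<^sub>E {..<M}. alt_coeff N \<kappa> m * alt_inner n \<chi> N m) = sum \<chi> (cycle_class n \<kappa>) * alt_pair N M \<kappa> \<kappa>"
proof -
  let ?P = "{\<sigma>. \<sigma> permutes {..<n}}"
  have finP: "finite ?P" by (simp add: finite_permutations)
  have "(\<Sum>m\<in>{..<N} \<rightarrow>\<^sub>E {..<M}. alt_coeff N \<kappa> m * alt_inner n \<chi> N m)
    = (\<Sum>\<sigma>\<in>?P. \<chi> \<sigma> * alt_pair N M \<kappa> (cycle_list n \<sigma>))"
    unfolding alt_inner_def alt_pair_def sum_distrib_left
    by (subst sum.swap) (simp only: mult.assoc mult.left_commute)
  also have "\<dots> = (\<Sum>\<sigma>\<in>cycle_class n \<kappa>. \<chi> \<sigma> * alt_pair N M \<kappa> (cycle_list n \<sigma>))"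
  proof (rule sum.mono_neutral_right[OF finP])
    show "\<forall>\<sigma>\<in>?P - cycle_class n \<kappa>. \<chi> \<sigma> * alt_pair N M \<kappa> (cycle_list n \<sigma>) = 0"
    proof
      fix \<sigma> assume "\<sigma> \<in> ?P - cycle_class n \<kappa>"
      then have \<sigma>: "\<sigma> permutes {..<n}" "mset \<kappa> \<noteq> mset (cycle_list n \<sigma>)" by (auto simp: cycle_class_def)
      have "alt_pair N M \<kappa> (cycle_list n \<sigma>) = 0"
        by (rule alt_pair_orthogonal[OF assms(1) cycle_list_positive[OF \<sigma>(1)] _ _ \<sigma>(2)]) (use assms in auto)
      then show "\<chi> \<sigma> * alt_pair N M \<kappa> (cycle_list n \<sigma>) = 0" by simp
    qed
  qed (auto simp: cycle_class_def)
  also have "\<dots> = (\<Sum>\<sigma>\<in>cycle_class n \<kappa>. \<chi> \<sigma> * alt_pair N M \<kappa> \<kappa>)"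
    unfolding alt_pair_def
    by (intro sum.cong refl arg_cong2[where f = "(*)"] alt_coeff_mset) (simp add: cycle_class_def)
  finally show ?thesis by (simp add: sum_distrib_right)
qed

text \<open>The added values are the gaps of the bead configuration, as required for taking the
  complement.\<close>

lemma extend_to_permutation:
  fixes N N' :: nat
  assumes "inj_on m {..<N}" "\<forall>i<N. m i < N + N'"
  obtains u where "u permutes {..<N + N'}" "\<forall>i<N. u i = m i"
proof -
  have "card ({..<N + N'} - m ` {..<N}) = card {N..<N + N'}"
    using assms by (subst card_Diff_subset) (auto simp: card_image)
  then obtain h where h: "bij_betw h {N..<N + N'} ({..<N + N'} - m ` {..<N})"
    by (metis finite_Diff finite_atLeastLessThan finite_lessThan finite_same_card_bij)
  define u where "u i = (if i < N then m i else if i < N + N' then h i else i)" for i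
  have hin: "h i < N + N' \<and> (\<forall>k<N. h i \<noteq> m k \<and> m k \<noteq> h i)" if "N \<le> i" "i < N + N'" for i
    using bij_betwE[OF h] that by force
  have hinj: "h i = h j \<Longrightarrow> i = j" if "N \<le> i" "i < N + N'" "N \<le> j" "j < N + N'" for i j
    using h that by (auto simp: bij_betw_def inj_on_def)
  have "u permutes {..<N + N'}"
  proof (rule inj_imp_permutes)
    show "inj_on u {..<N + N'}"
    proof (rule inj_onI)
      fix i j assume "i \<in> {..<N + N'}" "j \<in> {..<N + N'}" "u i = u j"
      then show "i = j" using hin[of i] hin[of j] hinj[of i j] inj_onD[OF assms(1), of i j]
        by (auto simp: u_def split: if_splits)
    qed
  qed (use assms(2) hin in \<open>auto simp: u_def\<close>)
  then show thesis by (rule that) (simp add: u_def)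
qed

text \<open>Conjugation is the twist by the sign character: the sign
  \<open>(-1) ^ (n + length \<nu>)\<close> absorbs the factor of \<open>alt_coeff_complement\<close>
  that depends on the cycle type.\<close>

lemma alt_inner_complement:
  assumes u: "u permutes {..<N + N'}" and nz: "alt_inner n \<chi> N u \<noteq> 0"
  shows "alt_inner n (\<lambda>\<sigma>. of_int (sign \<sigma>) * \<chi> \<sigma>) N' (complement_beads N N' u) \<noteq> 0"
proof -
  let ?\<eta> = "alt_coeff N' [] (complement_beads N N' id)"
  have "alt_inner n (\<lambda>\<sigma>. of_int (sign \<sigma>) * \<chi> \<sigma>) N' (complement_beads N N' u)
    = (?\<eta> * (-1) ^ n * of_int (sign u)) * alt_inner n \<chi> N u"
    unfolding alt_inner_def sum_distrib_left
  proof (rule sum.cong[OF refl])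
    fix \<sigma> assume "\<sigma> \<in> {\<sigma>. \<sigma> permutes {..<n}}"
    then have \<sigma>: "\<sigma> permutes {..<n}" by simp
    have sg: "of_int (sign \<sigma>) = ((-1) ^ n * (-1) ^ length (cycle_list n \<sigma>) :: rat)"
      using sign_cycle_type[OF \<sigma>, of "cycle_list n \<sigma>"] by (simp add: power_add)
    have one: "(-1) ^ k * (-1) ^ k = (1 :: rat)" "(-1) ^ k * ((-1) ^ k * x) = (x :: rat)" for k x
      by (simp_all flip: power_add mult.assoc)
    show "of_int (sign \<sigma>) * \<chi> \<sigma> * alt_coeff N' (cycle_list n \<sigma>) (complement_beads N N' u) =
      ?\<eta> * (-1) ^ n * of_int (sign u) * (\<chi> \<sigma> * alt_coeff N (cycle_list n \<sigma>) u)"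
      unfolding sg alt_coeff_complement[OF u cycle_list_positive[OF \<sigma>]]
      by (simp only: ac_simps one mult_1_right)
  qed
  moreover have "?\<eta> \<noteq> 0" by (rule complement_beads_id_Nil_nonzero)
  ultimately show ?thesis using nz by (simp del: alt_coeff.simps)
qed

section \<open>The trivial character\<close>

lemma content_le_1: "inj_on f {..<n} \<Longrightarrow> content n f i \<le> 1"
proof -
  assume "inj_on f {..<n}"
  then have "card {x. x < n \<and> f x = i} \<le> 1" by (subst card_le_Suc0_iff_eq[simplified One_nat_def[symmetric]]) (auto simp: inj_on_def)
  then show ?thesis by (simp add: content_def)
qed

text \<open>A repeated letter puts a transposition into the stabilizer, and multiplication by it
  reverses all signs.\<close>

lemma sum_sign_stabilizer:
  assumes "\<not> inj_on f {..<n}"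
  shows "(\<Sum>\<sigma>\<in>stabilizer n f. of_int (sign \<sigma>)) = (0 :: rat)"
proof -
  obtain a b where ab: "a < n" "b < n" "a \<noteq> b" "f a = f b" using assms by (auto simp: inj_on_def)
  let ?t = "transpose a b"
  have t: "?t permutes {..<n}" using ab by (intro permutes_swap_id) auto
  have ft: "f (?t x) = f x" for x using ab by (auto simp: transpose_def)
  have mem: "?t \<circ> \<sigma> \<in> stabilizer n f" if "\<sigma> \<in> stabilizer n f" for \<sigma>
    using that permutes_compose[OF _ t] ft by (auto simp: stabilizer_def)
  have sg: "sign (?t \<circ> \<sigma>) = - sign \<sigma>" if "\<sigma> \<in> stabilizer n f" for \<sigma>
    using that ab permutation_of_permutes[of \<sigma> n]
    by (subst sign_compose) (auto simp: stabilizer_def permutation_swap_id sign_swap_id)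
  have tt: "?t \<circ> (?t \<circ> \<sigma>) = \<sigma>" for \<sigma> :: "nat \<Rightarrow> nat" by (simp add: fun_eq_iff)
  have "(\<Sum>\<sigma>\<in>stabilizer n f. of_int (sign \<sigma>)) = (\<Sum>\<sigma>\<in>stabilizer n f. - of_int (sign \<sigma>) :: rat)"
    by (rule sum.reindex_bij_witness[where i = "\<lambda>\<sigma>. ?t \<circ> \<sigma>" and j = "\<lambda>\<sigma>. ?t \<circ> \<sigma>"])
      (simp_all only: tt mem sg of_int_minus minus_minus)
  also have "\<dots> = - (\<Sum>\<sigma>\<in>stabilizer n f. of_int (sign \<sigma>))" by (rule sum_negf)
  finally show ?thesis by (simp only: equal_neg_zero)
qed

text \<open>The other beads fill all positions below \<open>N - 1\<close>, so moving one of them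
  causes a collision. All parts must move bead \<open>p\<close>, and only their sum matters.\<close>

lemma alt_coeff_one_row:
  assumes "p < N" "{..<N - 1} \<subseteq> m ` ({..<N} - {p})" "\<forall>k\<in>set \<kappa>. 1 \<le> k"
  shows "alt_coeff N \<kappa> m = (if sum_list \<kappa> \<le> m p then alt_coeff N [] (m(p := m p - sum_list \<kappa>)) else 0)"
  using assms(2,3)
proof (induction \<kappa> arbitrary: m)
  case Nil
  then show ?case by (simp only: sum_list.Nil fun_upd_triv diff_zero le0 if_True)
next
  case (Cons k \<kappa>)
  have im: "m ` ({..<N} - {p}) = {..<N - 1}"
  proof (rule card_subset_eq[symmetric])
    have "card (m ` ({..<N} - {p})) \<le> card ({..<N} - {p})" by (rule card_image_le) simp
    then have "card (m ` ({..<N} - {p})) \<le> card {..<N - 1}" using assms(1) by simp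
    then show "card {..<N - 1} = card (m ` ({..<N} - {p}))"
      using card_mono[OF _ Cons.prems(1)] by simp
  qed (use Cons.prems in auto)
  have zero: "alt_coeff N \<kappa> (m(i := m i - k)) = 0" if i: "i < N" "k \<le> m i" "i \<noteq> p" for i
  proof (rule alt_coeff_not_inj)
    have "m i \<in> {..<N - 1}" using i im by auto
    then have "m i - k \<in> m ` ({..<N} - {p})" unfolding im by auto
    then obtain j where "m i - k = m j" "j \<in> {..<N} - {p}" by (rule imageE)
    then have j: "j < N" "m j = m i - k" by simp_all
    then have "j \<noteq> i" using i Cons.prems(2) by auto
    then show "\<not> inj_on (m(i := m i - k)) {..<N}"
      unfolding inj_on_def using i j by (metis fun_upd_other fun_upd_same lessThan_iff)
  qed
  have img: "{..<N - 1} \<subseteq> (m(p := v)) ` ({..<N} - {p})" for v using Cons.prems(1) by (auto simp: image_iff subset_iff)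
  show ?case
  proof (cases "k \<le> m p")
    case True
    have "alt_coeff N (k # \<kappa>) m = (\<Sum>i\<in>{p}. alt_coeff N \<kappa> (m(i := m i - k)))"
      unfolding alt_coeff.simps
      by (rule sum.mono_neutral_right) (use zero True assms(1) in auto)
    also have "\<dots> = alt_coeff N \<kappa> (m(p := m p - k))" by simp
    also have "\<dots> = (if sum_list \<kappa> \<le> m p - k then alt_coeff N [] (m(p := m p - k - sum_list \<kappa>)) else 0)"
    proof -
      have "\<forall>k\<in>set \<kappa>. 1 \<le> k" using Cons.prems(2) by simp
      from Cons.IH[OF img this, of "m p - k"] show ?thesis
        by (simp only: fun_upd_same fun_upd_upd)
    qed
    also have "\<dots> = (if sum_list (k # \<kappa>) \<le> m p then alt_coeff N [] (m(p := m p - sum_list (k # \<kappa>))) else 0)"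
      using True by (intro if_cong) auto
    finally show ?thesis .
  next
    case False
    then have "alt_coeff N (k # \<kappa>) m = 0"
      unfolding alt_coeff.simps by (intro sum.neutral) (use zero in auto)
    then show ?thesis using False by (simp del: alt_coeff.simps)
  qed
qed

text \<open>The sign twist makes a stabilizer sum of signs nonzero, so the word of the complement
  has distinct letters. This leaves only partitions with one row, where
  \<open>alt_coeff_one_row\<close> applies.\<close>

lemma alt_inner_one_row:
  assumes "m \<in> {..<N} \<rightarrow>\<^sub>E {..<N + n}" "alt_inner n (\<lambda>_. 1) N m \<noteq> 0" "1 \<le> N"
    and "\<forall>k\<in>set \<kappa>. 1 \<le> k" "\<forall>k\<in>set \<kappa>'. 1 \<le> k" "sum_list \<kappa> = sum_list \<kappa>'"
  shows "alt_coeff N \<kappa> m = alt_coeff N \<kappa>' m"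
proof -
  have inj: "inj_on m {..<N}"
    using assms(2) alt_inner_not_inj by blast
  obtain u where u: "u permutes {..<N + n}" "\<forall>i<N. u i = m i"
    using extend_to_permutation[OF inj, of n] assms(1) by (auto simp: PiE_iff)
  have "alt_inner n (\<lambda>_. 1) N u = alt_inner n (\<lambda>_. 1) N m"
    unfolding alt_inner_def using u(2) by (intro sum.cong refl arg_cong2[where f = "(*)"] alt_coeff_cong) auto
  then have "alt_inner n (\<lambda>\<sigma>. of_int (sign \<sigma>) * 1) n (complement_beads N n u) \<noteq> 0"
    using alt_inner_complement[OF u(1), of n "\<lambda>_. 1"] assms(2) by simp
  then obtain w f where w: "w permutes {..<n}" "\<forall>i<n. complement_beads N n u i = w i + content n f i"
    "(\<Sum>\<sigma>\<in>stabilizer n f. of_int (sign \<sigma>) * 1 :: rat) \<noteq> 0"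
    by (rule alt_inner_nonzeroE)
  have "inj_on f {..<n}" using w(3) sum_sign_stabilizer[of f n] by force
  \<comment> \<open>The beads of the complement lie at most at \<open>(n - 1) + 1\<close>; reversing
    positions puts every gap at \<open>N - 1\<close> or above.\<close>
  then have hole: "N - 1 \<le> u (N + j)" if "j < n" for j
  proof -
    have "w j < n" using permutes_in_image[OF w(1), of j] that by simp
    moreover have "content n f j \<le> 1" by (rule content_le_1) fact
    moreover have "complement_beads N n u j = w j + content n f j" using w(2) that by blast
    ultimately have "complement_beads N n u j \<le> n" by linarith
    then show ?thesis unfolding complement_beads_def by linarith
  qed
  have sub: "{..<N - 1} \<subseteq> m ` {..<N}"
  proof
    fix y assume y: "y \<in> {..<N - 1}"
    then have "y \<in> u ` {..<N + n}" unfolding permutes_image[OF u(1)] by simp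
    then obtain p where p: "p < N + n" "u p = y" by auto
    have "p < N"
    proof (rule ccontr)
      assume "\<not> p < N"
      then have "p - N < n" "N + (p - N) = p" using p(1) by auto
      then have "N - 1 \<le> u p" using hole by metis
      then show False using p(2) y by simp
    qed
    then show "y \<in> m ` {..<N}" using p u(2) by force
  qed
  obtain p where p: "p < N" "m p \<notin> {..<N - 1}"
  proof -
    have "card (m ` {..<N}) = N" using inj by (simp add: card_image)
    then have "\<not> m ` {..<N} \<subseteq> {..<N - 1}" using card_mono[of "{..<N - 1}" "m ` {..<N}"] assms(3) by auto
    then show thesis using that by auto
  qed
  have row: "{..<N - 1} \<subseteq> m ` ({..<N} - {p})"
  proof
    fix y assume y: "y \<in> {..<N - 1}"
    then obtain i where "y = m i" "i \<in> {..<N}" using sub by blast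
    then show "y \<in> m ` ({..<N} - {p})" using p(2) y by blast
  qed
  show ?thesis
    unfolding alt_coeff_one_row[OF p(1) row assms(4)] alt_coeff_one_row[OF p(1) row assms(5)] assms(6) ..
qed

text \<open>For the trivial character the sum of Lemma \<open>sum_alt_coeff_alt_inner\<close> does not depend on
  \<open>\<kappa>\<close>. This replaces the computation of the sizes of the conjugacy classes, and shows that they are nonempty.\<close>

lemma class_size_constant:
  assumes "1 \<le> N" "2 * n \<le> N"
  obtains C where "C \<noteq> 0"
    "\<And>\<kappa>. \<forall>k\<in>set \<kappa>. 1 \<le> k \<Longrightarrow> sum_list \<kappa> = n \<Longrightarrow> of_nat (card (cycle_class n \<kappa>)) * alt_pair N (N + n) \<kappa> \<kappa> = C"
proof -
  \<comment> \<open>The cycle type of the identity serves as reference, since its class is visibly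
    nonempty.\<close>
  let ?\<kappa>0 = "cycle_list n id"
  let ?C = "\<lambda>\<kappa>. of_nat (card (cycle_class n \<kappa>)) * alt_pair N (N + n) \<kappa> \<kappa>"
  have id: "id permutes {..<n}" by (rule permutes_id)
  have \<kappa>0: "\<forall>k\<in>set ?\<kappa>0. 1 \<le> k" "sum_list ?\<kappa>0 = n"
    using cycle_list_positive[OF id] sum_list_cycle_list[OF id] by auto
  have "id \<in> cycle_class n ?\<kappa>0" using id unfolding cycle_class_def by (intro CollectI conjI) (simp_all only: mset_cycle_list)
  then have "card (cycle_class n ?\<kappa>0) \<noteq> 0" by (metis card_0_eq empty_iff finite_cycle_class)
  then have nz: "?C ?\<kappa>0 \<noteq> 0" using alt_pair_pos[of ?\<kappa>0 N "N + n"] \<kappa>0 assms by force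
  have C: "?C \<kappa> = (\<Sum>m\<in>{..<N} \<rightarrow>\<^sub>E {..<N + n}. alt_coeff N \<kappa> m * alt_inner n (\<lambda>_. 1) N m)"
    if "\<forall>k\<in>set \<kappa>. 1 \<le> k" "sum_list \<kappa> = n" for \<kappa>
    using sum_alt_coeff_alt_inner[OF that assms(2) le_refl, of "\<lambda>_. 1"] by simp
  have "?C \<kappa> = ?C ?\<kappa>0" if \<kappa>: "\<forall>k\<in>set \<kappa>. 1 \<le> k" "sum_list \<kappa> = n" for \<kappa>
    unfolding C[OF \<kappa>] C[OF \<kappa>0]
  proof (rule sum.cong[OF refl])
    fix m assume m: "m \<in> {..<N} \<rightarrow>\<^sub>E {..<N + n}"
    show "alt_coeff N \<kappa> m * alt_inner n (\<lambda>_. 1) N m = alt_coeff N ?\<kappa>0 m * alt_inner n (\<lambda>_. 1) N m"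
    proof (cases "alt_inner n (\<lambda>_. 1) N m = 0")
      case False
      then have "alt_coeff N \<kappa> m = alt_coeff N ?\<kappa>0 m"
        using alt_inner_one_row[OF m False assms(1) \<kappa>(1) \<kappa>0(1)] \<kappa>(2) \<kappa>0(2) by simp
      then show ?thesis by simp
    qed simp
  qed
  then show thesis using that[OF nz] by blast
qed

text \<open>Up to the constant \<open>C\<close>, \<open>X \<kappa>\<close> is a combination of the
  \<open>alt_coeff N \<kappa> m\<close> with coefficients independent of \<open>\<kappa>\<close>,
  and every \<open>m\<close> that occurs has enough large beads for
  \<open>sum_two_part_removals\<close>.\<close>

lemma class_function_two_part_sum:
  assumes \<chi>: "class_function n \<chi>"
    and X: "\<And>\<kappa> \<sigma>. \<sigma> \<in> cycle_class n \<kappa> \<Longrightarrow> X \<kappa> = \<chi> \<sigma>"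
    and N: "1 \<le> N" "2 * n \<le> N"
    and large: "\<And>m. m \<in> {..<N} \<rightarrow>\<^sub>E {..<N + n} \<Longrightarrow> alt_inner n \<chi> N m \<noteq> 0 \<Longrightarrow>
      length \<rho> + 2 \<le> card {i. i < N \<and> N \<le> m i}"
    and \<rho>: "\<forall>k\<in>set \<rho>. 1 \<le> k" "s + sum_list \<rho> = n"
  shows "(\<Sum>i\<in>{1..<s}. X (i # (s - i) # \<rho>)) = 0"
proof -
  obtain C where C: "C \<noteq> 0"
    "\<And>\<kappa>. \<forall>k\<in>set \<kappa>. 1 \<le> k \<Longrightarrow> sum_list \<kappa> = n \<Longrightarrow> of_nat (card (cycle_class n \<kappa>)) * alt_pair N (N + n) \<kappa> \<kappa> = C"
    using class_size_constant[OF N] by metis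
  have CX: "C * X \<kappa> = (\<Sum>m\<in>{..<N} \<rightarrow>\<^sub>E {..<N + n}. alt_coeff N \<kappa> m * alt_inner n \<chi> N m)"
    if \<kappa>: "\<forall>k\<in>set \<kappa>. 1 \<le> k" "sum_list \<kappa> = n" for \<kappa>
  proof -
    have "sum \<chi> (cycle_class n \<kappa>) = (\<Sum>\<sigma>\<in>cycle_class n \<kappa>. X \<kappa>)"
      by (intro sum.cong refl X[symmetric])
    then have "sum \<chi> (cycle_class n \<kappa>) = of_nat (card (cycle_class n \<kappa>)) * X \<kappa>" by simp
    then show ?thesis unfolding sum_alt_coeff_alt_inner[OF \<kappa> N(2) le_refl] C(2)[OF \<kappa>, symmetric]
      by (simp only: ac_simps)
  qed
  have "C * (\<Sum>i\<in>{1..<s}. X (i # (s - i) # \<rho>)) =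
    (\<Sum>i\<in>{1..<s}. \<Sum>m\<in>{..<N} \<rightarrow>\<^sub>E {..<N + n}. alt_coeff N (i # (s - i) # \<rho>) m * alt_inner n \<chi> N m)"
    unfolding sum_distrib_left using \<rho> by (intro sum.cong refl CX) auto
  also have "\<dots> = (\<Sum>m\<in>{..<N} \<rightarrow>\<^sub>E {..<N + n}. (\<Sum>i\<in>{1..<s}. alt_coeff N (i # (s - i) # \<rho>) m) * alt_inner n \<chi> N m)"
    by (subst sum.swap) (simp only: sum_distrib_right)
  also have "\<dots> = 0"
  proof (rule sum.neutral, rule ballI)
    fix m assume m: "m \<in> {..<N} \<rightarrow>\<^sub>E {..<N + n}"
    show "(\<Sum>i\<in>{1..<s}. alt_coeff N (i # (s - i) # \<rho>) m) * alt_inner n \<chi> N m = 0"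
    proof (cases "alt_inner n \<chi> N m = 0")
      case False
      show ?thesis unfolding sum_two_part_removals[OF large[OF m False]] by simp
    qed simp
  qed
  finally show ?thesis using C(1) by simp
qed

section \<open>The rank of a configuration not orthogonal to a class function\<close>

lemma sum_content:
  assumes "finite Q"
  shows "(\<Sum>i\<in>Q. content n f i) = card {x. x < n \<and> f x \<in> Q}"
proof -
  have "{x. x < n \<and> f x \<in> Q} = (\<Union>i\<in>Q. {x. x < n \<and> f x = i})" by auto
  also have "card \<dots> = (\<Sum>i\<in>Q. content n f i)"
    unfolding content_def by (rule card_UN_disjoint) (use assms in auto)
  finally show ?thesis by simp
qed

text \<open>Distinct values below \<open>N\<close> sum to at most
  \<open>(N - 1) + (N - 2) + ...\<close>.\<close>

lemma sum_permutes_le: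
  assumes "w permutes {..<N}" "Q \<subseteq> {..<N}"
  shows "sum w Q + \<Sum>{..<card Q} \<le> card Q * (N - 1)"
proof -
  have fin: "finite Q" using assms(2) finite_subset by blast
  have lt: "w i < N" if "i \<in> Q" for i using that assms permutes_in_image[OF assms(1), of i] by auto
  have inj: "inj_on (\<lambda>i. N - 1 - w i) Q"
  proof (rule inj_onI)
    fix i j assume "i \<in> Q" "j \<in> Q" "N - 1 - w i = N - 1 - w j"
    then have "w i = w j" using lt[of i] lt[of j] by linarith
    then show "i = j" using permutes_inj[OF assms(1)] by (simp add: inj_eq)
  qed
  have "\<Sum>{..<card Q} \<le> (\<Sum>i\<in>Q. N - 1 - w i)"
    using sum_lessThan_card_le[of "(\<lambda>i. N - 1 - w i) ` Q"] fin inj by (simp add: card_image sum.reindex)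
  moreover have "sum w Q + (\<Sum>i\<in>Q. N - 1 - w i) = (\<Sum>i\<in>Q. N - 1)"
    unfolding sum.distrib[symmetric] using lt by (intro sum.cong refl) force
  ultimately show ?thesis by simp
qed

text \<open>\<open>R q\<close> and \<open>K q\<close> stand for the numbers of cells in the first \<open>q\<close> rows and in the first
  \<open>q\<close> columns of \<open>\<lambda>\<close>. A bead configuration with only \<open>q\<close> beads beyond \<open>N\<close> is a partition of
  rank \<open>q\<close>, whose first \<open>q\<close> rows and columns cover it, which is too much for \<open>\<lambda>\<close> if
  \<open>q < rank \<lambda>\<close>.\<close>

lemma alt_inner_large_beads:
  assumes m: "m \<in> {..<N} \<rightarrow>\<^sub>E {..<N + N'}" and nz: "alt_inner n \<chi> N m \<noteq> 0"
    and R: "\<And>f Q. finite Q \<Longrightarrow> sum \<chi> (stabilizer n f) \<noteq> 0 \<Longrightarrow> card {x. x < n \<and> f x \<in> Q} \<le> R (card Q)"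
    and K: "\<And>f Q. finite Q \<Longrightarrow> (\<Sum>\<sigma>\<in>stabilizer n f. of_int (sign \<sigma>) * \<chi> \<sigma>) \<noteq> 0 \<Longrightarrow> card {x. x < n \<and> f x \<in> Q} \<le> K (card Q)"
    and RK: "\<And>q. q < r \<Longrightarrow> R q + K q < n + q * q"
  shows "r \<le> card {i. i < N \<and> N \<le> m i}"
proof (rule ccontr)
  define Q where "Q = {i. i < N \<and> N \<le> m i}"
  define q where "q = card Q"
  assume "\<not> ?thesis"
  then have "q < r" by (simp add: q_def Q_def)
  have inj: "inj_on m {..<N}"
    using nz alt_inner_not_inj by blast
  obtain u where u: "u permutes {..<N + N'}" "\<forall>i<N. u i = m i"
    using extend_to_permutation[OF inj, of N'] m by (auto simp: PiE_iff)
  have "alt_inner n \<chi> N u = alt_inner n \<chi> N m"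
    unfolding alt_inner_def using u(2) by (intro sum.cong refl arg_cong2[where f = "(*)"] alt_coeff_cong) auto
  then have nz': "alt_inner n (\<lambda>\<sigma>. of_int (sign \<sigma>) * \<chi> \<sigma>) N' (complement_beads N N' u) \<noteq> 0"
    using alt_inner_complement[OF u(1)] nz by simp
  obtain w f where w: "w permutes {..<N}" "f \<in> {..<n} \<rightarrow>\<^sub>E {..<N}" "\<forall>i<N. m i = w i + content n f i"
    "sum \<chi> (stabilizer n f) \<noteq> 0" using nz by (rule alt_inner_nonzeroE)
  obtain w' f' where w': "w' permutes {..<N'}" "\<forall>i<N'. complement_beads N N' u i = w' i + content n f' i"
    "(\<Sum>\<sigma>\<in>stabilizer n f'. of_int (sign \<sigma>) * \<chi> \<sigma>) \<noteq> 0" using nz' by (rule alt_inner_nonzeroE)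
  \<comment> \<open>The gaps below \<open>N\<close>; there are as many of them as beads beyond
    \<open>N\<close>.\<close>
  define Q' where "Q' = {j. j < N' \<and> u (N + j) < N}"
  have fin: "finite Q" "finite Q'" by (auto simp: Q_def Q'_def)
  have QN: "Q \<subseteq> {..<N}" "Q' \<subseteq> {..<N'}" by (auto simp: Q_def Q'_def)
  have split: "{i. i < N + N' \<and> u i < N} = {i. i < N \<and> m i < N} \<union> (+) N ` Q'"
  proof (intro equalityI subsetI)
    fix i assume i: "i \<in> {i. i < N + N' \<and> u i < N}"
    show "i \<in> {i. i < N \<and> m i < N} \<union> (+) N ` Q'"
    proof (cases "i < N")
      case True
      then show ?thesis using i u(2) by simp
    next
      case False
      then obtain j where j: "i = N + j" by (metis le_Suc_ex not_less)
      then have "j \<in> Q'" using i by (simp add: Q'_def)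
      then show ?thesis using j by blast
    qed
  qed (use u(2) in \<open>auto simp: Q'_def\<close>)
  have im: "u ` {i. i < N + N' \<and> u i < N} = {..<N}"
  proof (intro equalityI subsetI)
    fix y assume y: "y \<in> {..<N}"
    then have "y \<in> u ` {..<N + N'}" unfolding permutes_image[OF u(1)] by simp
    then show "y \<in> u ` {i. i < N + N' \<and> u i < N}" using y by auto
  qed auto
  have inju: "inj_on u A" for A using permutes_inj[OF u(1)] by (rule inj_on_subset) simp
  have disj: "{i. i < N \<and> m i < N} \<inter> (+) N ` Q' = {}" by auto
  have "card {i. i < N + N' \<and> u i < N} = N" using card_image[OF inju] im by (metis card_lessThan)
  then have c1: "card {i. i < N \<and> m i < N} + card Q' = N"
    unfolding split by (subst (asm) card_Un_disjoint) (use disj fin in \<open>auto simp: card_image\<close>)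
  have Nsplit: "{..<N} = {i. i < N \<and> m i < N} \<union> Q" by (auto simp: Q_def)
  have "card {..<N} = card {i. i < N \<and> m i < N} + q"
    unfolding q_def by (subst Nsplit, rule card_Un_disjoint) (use fin in \<open>auto simp: Q_def\<close>)
  then have q': "card Q' = q" using c1 by simp
  have "\<Sum>{..<N} = sum u {i. i < N + N' \<and> u i < N}"
    using sum.reindex[OF inju, of "\<lambda>x. x" "{i. i < N + N' \<and> u i < N}"] by (simp add: im)
  also have "\<dots> = sum u {i. i < N \<and> m i < N} + sum u ((+) N ` Q')"
    unfolding split by (rule sum.union_disjoint) (use fin disj in auto)
  also have "sum u {i. i < N \<and> m i < N} = sum m {i. i < N \<and> m i < N}" using u(2) by (intro sum.cong) auto
  also have "sum u ((+) N ` Q') = (\<Sum>j\<in>Q'. u (N + j))" by (subst sum.reindex) auto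
  finally have s1: "\<Sum>{..<N} = sum m {i. i < N \<and> m i < N} + (\<Sum>j\<in>Q'. u (N + j))" .
  have "sum m {..<N} = sum m {i. i < N \<and> m i < N} + sum m Q"
    by (subst Nsplit, rule sum.union_disjoint) (use fin in \<open>auto simp: Q_def\<close>)
  moreover have "sum m {..<N} = \<Sum>{..<N} + n"
  proof -
    have "sum m {..<N} = sum w {..<N} + (\<Sum>i<N. content n f i)" using w(3) by (simp add: sum.distrib)
    moreover have "{x. x < n \<and> f x \<in> {..<N}} = {..<n}" using w(2) by auto
    ultimately show ?thesis using sum_permutes_lessThan[OF w(1)] by (simp add: sum_content)
  qed
  \<comment> \<open>The degree \<open>n\<close> is the excess of the large beads over the gaps that
    they left below \<open>N\<close>.\<close>
  ultimately have s2: "sum m Q = (\<Sum>j\<in>Q'. u (N + j)) + n" using s1 by linarith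
  have "(\<Sum>j\<in>Q'. complement_beads N N' u j) + (\<Sum>j\<in>Q'. u (N + j)) = (\<Sum>j\<in>Q'. N + N' - 1)"
  proof -
    have "complement_beads N N' u j + u (N + j) = N + N' - 1" if "j \<in> Q'" for j
      using that by (auto simp: complement_beads_def Q'_def)
    then show ?thesis unfolding sum.distrib[symmetric] by (intro sum.cong) auto
  qed
  then have s3: "(\<Sum>j\<in>Q'. complement_beads N N' u j) + (\<Sum>j\<in>Q'. u (N + j)) = q * (N + N' - 1)" by (simp add: q')
  have s4: "sum m Q = sum w Q + card {x. x < n \<and> f x \<in> Q}"
    using w(3) QN fin by (simp add: sum_content[symmetric] sum.distrib[symmetric] subset_iff)
  have s5: "(\<Sum>j\<in>Q'. complement_beads N N' u j) = sum w' Q' + card {x. x < n \<and> f' x \<in> Q'}"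
    using w'(2) QN fin by (simp add: sum_content[symmetric] sum.distrib[symmetric] subset_iff)
  \<comment> \<open>The two staircases \<open>\<Sum>{..<q}\<close> and a further \<open>q\<close>
    from the reversal of positions add up to \<open>q * q\<close>.\<close>
  have l1: "sum w Q + \<Sum>{..<q} \<le> q * (N - 1)" using sum_permutes_le[OF w(1) QN(1)] by (simp add: q_def)
  have l2: "sum w' Q' + \<Sum>{..<q} \<le> q * (N' - 1)" using sum_permutes_le[OF w'(1) QN(2)] by (simp add: q')
  have gauss: "2 * \<Sum>{..<q} + q = q * q" by (induction q) (auto simp: lessThan_Suc)
  have u1: "card {x. x < n \<and> f x \<in> Q} \<le> R q" using R[OF fin(1) w(4)] by (simp add: q_def)
  have u2: "card {x. x < n \<and> f' x \<in> Q'} \<le> K q" using K[OF fin(2) w'(3)] by (simp add: q')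
  have N: "q * (N - 1) + q * (N' - 1) + q = q * (N + N' - 1)"
  proof (cases "q = 0")
    case False
    then have "Q \<noteq> {}" "Q' \<noteq> {}" using q' by (auto simp: q_def)
    then have "1 \<le> N" "1 \<le> N'" using QN by auto
    then obtain a b where "N = Suc a" "N' = Suc b" by (metis One_nat_def Suc_le_D)
    then show ?thesis by (simp add: algebra_simps)
  qed simp
  have "n + q * q \<le> R q + K q" using s2 s3 s4 s5 l1 l2 gauss u1 u2 N by linarith
  then show False using RK[OF \<open>q < r\<close>] by simp
qed

section \<open>Characters of Specht modules\<close>

lemma sum_fun_apply: "(\<Sum>i\<in>I. F i) x = (\<Sum>i\<in>I. F i x :: rat)"
  by (induction I rule: infinite_finite_induct) auto

section \<open>Traces on subspaces of the group algebra\<close>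

lemma subspace_has_basis:
  assumes "galg.subspace V"
  shows "\<exists>B. galg.independent B \<and> galg.span B = V"
proof -
  obtain B where B: "B \<subseteq> V" "galg.independent B" "V \<subseteq> galg.span B"
    using galg.maximal_independent_subset[of V] by blast
  then have "galg.span B = V" using galg.span_minimal[OF B(1) assms] by blast
  then show ?thesis using B(2) by blast
qed

text \<open>One basis serves all operators, so traces of different operators can be
  compared.\<close>

lemma trace_on_basis:
  assumes "galg.subspace V"
  obtains B where "galg.independent B" "galg.span B = V"
    "\<forall>T. trace_on V T = (\<Sum>b\<in>B. galg.representation B (T b) b)"
proof -
  define B where "B = (SOME B. galg.independent B \<and> galg.span B = V)"
  have "galg.independent B \<and> galg.span B = V"
    unfolding B_def using subspace_has_basis[OF assms] by (rule someI_ex)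
  then show thesis using that[of B] by (auto simp: trace_on_def B_def Let_def)
qed

text \<open>A linear relation between operators on \<open>V\<close> passes to their diagonal entries
  in the common basis.\<close>

lemma trace_on_sum_zero:
  assumes V: "galg.subspace V" and T: "\<And>i v. i \<in> I \<Longrightarrow> v \<in> V \<Longrightarrow> T i v \<in> V"
    and zero: "\<And>v \<pi>. v \<in> V \<Longrightarrow> (\<Sum>i\<in>I. c i * T i v \<pi>) = 0"
  shows "(\<Sum>i\<in>I. c i * trace_on V (T i)) = 0"
proof -
  obtain B where B: "galg.independent B" "galg.span B = V"
    "\<forall>T. trace_on V T = (\<Sum>b\<in>B. galg.representation B (T b) b)"
    by (rule trace_on_basis[OF V])
  have "(\<Sum>i\<in>I. c i * galg.representation B (T i b) b) = 0" if b: "b \<in> B" for b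
  proof -
    have bV: "b \<in> V" using b B(2) galg.span_base by blast
    have "(\<Sum>i\<in>I. (\<lambda>\<pi>. c i * T i b \<pi>)) = 0"
      by (rule ext) (use zero[OF bV] in \<open>simp add: sum_fun_apply\<close>)
    then have "0 = galg.representation B (\<Sum>i\<in>I. (\<lambda>\<pi>. c i * T i b \<pi>)) b"
      by (simp add: galg.representation_zero)
    also have "\<dots> = (\<Sum>i\<in>I. galg.representation B (\<lambda>\<pi>. c i * T i b \<pi>) b)"
      using T[OF _ bV] by (subst galg.representation_sum[OF B(1)]) (auto simp: B(2) galg.subspace_scale[OF V])
    also have "\<dots> = (\<Sum>i\<in>I. c i * galg.representation B (T i b) b)"
      using T[OF _ bV] by (intro sum.cong refl) (simp add: galg.representation_scale[OF B(1)] B(2))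
    finally show ?thesis by simp
  qed
  then show ?thesis unfolding B(3)[rule_format] sum_distrib_left by (subst sum.swap) simp
qed

lemma trace_on_comp_commute:
  assumes V: "galg.subspace V"
    and X: "\<And>v. v \<in> V \<Longrightarrow> X v \<in> V" "\<And>B r. X (\<Sum>b\<in>B. (\<lambda>\<pi>. r b * b \<pi>)) = (\<Sum>b\<in>B. (\<lambda>\<pi>. r b * X b \<pi>))"
    and Y: "\<And>v. v \<in> V \<Longrightarrow> Y v \<in> V" "\<And>B r. Y (\<Sum>b\<in>B. (\<lambda>\<pi>. r b * b \<pi>)) = (\<Sum>b\<in>B. (\<lambda>\<pi>. r b * Y b \<pi>))"
  shows "trace_on V (X \<circ> Y) = trace_on V (Y \<circ> X)"
proof -
  obtain B where B: "galg.independent B" "galg.span B = V"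
    "\<forall>T. trace_on V T = (\<Sum>b\<in>B. galg.representation B (T b) b)"
    by (rule trace_on_basis[OF V])
  show ?thesis
  \<comment> \<open>For an infinite basis both traces take the default value 0 of an infinite
    sum.\<close>
  proof (cases "finite B")
    case True
    have BV: "b \<in> V" if "b \<in> B" for b using that B(2) galg.span_base by blast
    have expand: "galg.representation B (X (Y b)) b
        = (\<Sum>c\<in>B. galg.representation B (Y b) c * galg.representation B (X c) b)"
      if "b \<in> B" and XV: "\<And>v. v \<in> V \<Longrightarrow> X v \<in> V" and YV: "\<And>v. v \<in> V \<Longrightarrow> Y v \<in> V"
        and Xlin: "\<And>B r. X (\<Sum>b\<in>B. (\<lambda>\<pi>. r b * b \<pi>)) = (\<Sum>b\<in>B. (\<lambda>\<pi>. r b * X b \<pi>))" for b X Y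
    proof -
      have YbV: "Y b \<in> V" using YV BV that(1) by blast
      have "Y b = (\<Sum>c\<in>B. (\<lambda>\<pi>. galg.representation B (Y b) c * c \<pi>))"
        using galg.sum_representation_eq[OF B(1) _ True subset_refl, of "Y b"] YbV B(2) by simp
      then have "X (Y b) = (\<Sum>c\<in>B. (\<lambda>\<pi>. galg.representation B (Y b) c * X c \<pi>))"
        using Xlin[of "galg.representation B (Y b)" B] by simp
      then have "galg.representation B (X (Y b)) b
          = (\<Sum>c\<in>B. galg.representation B (\<lambda>\<pi>. galg.representation B (Y b) c * X c \<pi>) b)"
        using XV[OF BV] by (simp add: galg.representation_sum[OF B(1)] B(2) galg.subspace_scale[OF V])
      also have "\<dots> = (\<Sum>c\<in>B. galg.representation B (Y b) c * galg.representation B (X c) b)"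
        using XV[OF BV] by (intro sum.cong refl) (simp add: galg.representation_scale[OF B(1)] B(2))
      finally show ?thesis .
    qed
    have "trace_on V (X \<circ> Y) = (\<Sum>b\<in>B. \<Sum>c\<in>B. galg.representation B (Y b) c * galg.representation B (X c) b)"
      unfolding B(3)[rule_format] comp_apply by (intro sum.cong refl expand) (use X Y in auto)
    also have "\<dots> = (\<Sum>c\<in>B. \<Sum>b\<in>B. galg.representation B (X c) b * galg.representation B (Y b) c)"
      by (subst sum.swap) (simp only: mult.commute)
    also have "\<dots> = trace_on V (Y \<circ> X)"
      unfolding B(3)[rule_format] comp_apply by (intro sum.cong refl expand[symmetric]) (use X Y in auto)
    finally show ?thesis .
  qed (simp add: B(3)[rule_format])
qed

section \<open>Left multiplication on Specht modules\<close>

lemma left_mult_sum: "left_mult \<sigma> (\<Sum>b\<in>B. (\<lambda>\<pi>. r b * b \<pi>)) = (\<Sum>b\<in>B. (\<lambda>\<pi>. r b * left_mult \<sigma> b \<pi>))"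
  by (rule ext) (simp add: left_mult_def sum_fun_apply)

lemma left_mult_comp:
  assumes "bij g" "bij h"
  shows "left_mult g (left_mult h f) = left_mult (g \<circ> h) f"
  by (simp only: left_mult_def o_inv_distrib[OF assms] comp_assoc)

lemma left_mult_galg_mult:
  assumes \<sigma>: "\<sigma> permutes {..<n}"
  shows "left_mult \<sigma> (galg_mult n f e) = galg_mult n (left_mult \<sigma> f) e"
proof
  fix \<pi>
  have inv: "inv \<sigma> permutes {..<n}" by (rule permutes_inv[OF \<sigma>])
  have "(\<Sum>\<tau> | \<tau> permutes {..<n}. f \<tau> * e (inv \<tau> \<circ> (inv \<sigma> \<circ> \<pi>)))
      = (\<Sum>\<tau> | \<tau> permutes {..<n}. f (inv \<sigma> \<circ> \<tau>) * e (inv \<tau> \<circ> \<pi>))"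
  proof (rule sum.reindex_bij_witness[where i = "\<lambda>\<tau>. inv \<sigma> \<circ> \<tau>" and j = "\<lambda>\<tau>. \<sigma> \<circ> \<tau>"])
    fix \<tau> assume "\<tau> \<in> {\<tau>. \<tau> permutes {..<n}}"
    then have \<tau>: "\<tau> permutes {..<n}" by simp
    show "inv \<sigma> \<circ> (\<sigma> \<circ> \<tau>) = \<tau>" "\<sigma> \<circ> (inv \<sigma> \<circ> \<tau>) = \<tau>"
      by (simp_all add: fun_eq_iff permutes_inverses[OF \<sigma>])
    show "\<sigma> \<circ> \<tau> \<in> {\<tau>. \<tau> permutes {..<n}}" "inv \<sigma> \<circ> \<tau> \<in> {\<tau>. \<tau> permutes {..<n}}"
      using permutes_compose[OF \<tau> \<sigma>] permutes_compose[OF \<tau> inv] by auto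
    have "inv (\<sigma> \<circ> \<tau>) = inv \<tau> \<circ> inv \<sigma>" using \<sigma> \<tau> by (intro o_inv_distrib permutes_bij)
    moreover have "inv \<sigma> \<circ> (\<sigma> \<circ> \<tau>) = \<tau>" by (simp add: fun_eq_iff permutes_inverses[OF \<sigma>])
    ultimately show "f (inv \<sigma> \<circ> (\<sigma> \<circ> \<tau>)) * e (inv (\<sigma> \<circ> \<tau>) \<circ> \<pi>) = f \<tau> * e (inv \<tau> \<circ> (inv \<sigma> \<circ> \<pi>))"
      by (simp only: comp_assoc)
  qed
  then show "left_mult \<sigma> (galg_mult n f e) \<pi> = galg_mult n (left_mult \<sigma> f) e \<pi>"
    by (simp only: left_mult_def galg_mult_def)
qed

lemma subspace_specht: "galg.subspace (specht lam)"
proof -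
  let ?n = "sum_list lam" and ?e = "young_symmetrizer lam"
  show ?thesis
  proof (rule galg.subspaceI)
    have "0 = galg_mult ?n 0 ?e" by (rule ext) (simp add: galg_mult_def)
    moreover have "0 \<in> group_algebra ?n" by (simp add: group_algebra_def)
    ultimately show "0 \<in> specht lam" unfolding specht_def by (rule image_eqI)
  next
    fix x y assume "x \<in> specht lam" "y \<in> specht lam"
    then obtain f g where fg: "x = galg_mult ?n f ?e" "y = galg_mult ?n g ?e"
      "f \<in> group_algebra ?n" "g \<in> group_algebra ?n" by (auto simp: specht_def)
    have "x + y = galg_mult ?n (f + g) ?e"
      unfolding fg by (rule ext) (simp add: galg_mult_def algebra_simps sum.distrib)
    moreover have "f + g \<in> group_algebra ?n" using fg(3,4) by (simp add: group_algebra_def)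
    ultimately show "x + y \<in> specht lam" unfolding specht_def by (rule image_eqI)
  next
    fix c x assume "x \<in> specht lam"
    then obtain f where f: "x = galg_mult ?n f ?e" "f \<in> group_algebra ?n" by (auto simp: specht_def)
    have "(\<lambda>\<pi>. c * x \<pi>) = galg_mult ?n (\<lambda>\<pi>. c * f \<pi>) ?e"
      unfolding f by (rule ext) (simp add: galg_mult_def sum_distrib_left mult.assoc)
    moreover have "(\<lambda>\<pi>. c * f \<pi>) \<in> group_algebra ?n" using f(2) by (simp add: group_algebra_def)
    ultimately show "(\<lambda>\<pi>. c * x \<pi>) \<in> specht lam" unfolding specht_def by (rule image_eqI)
  qed
qed

lemma left_mult_specht:
  assumes \<sigma>: "\<sigma> permutes {..<sum_list lam}" and "v \<in> specht lam"
  shows "left_mult \<sigma> v \<in> specht lam"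
proof -
  obtain f where f: "f \<in> group_algebra (sum_list lam)" "v = galg_mult (sum_list lam) f (young_symmetrizer lam)"
    using assms(2) by (auto simp: specht_def)
  have "\<pi> permutes {..<sum_list lam}" if "inv \<sigma> \<circ> \<pi> permutes {..<sum_list lam}" for \<pi>
  proof -
    have "\<sigma> \<circ> (inv \<sigma> \<circ> \<pi>) = \<pi>" by (simp add: fun_eq_iff permutes_inverses[OF \<sigma>])
    then show ?thesis using permutes_compose[OF that \<sigma>] by simp
  qed
  then have "left_mult \<sigma> f \<in> group_algebra (sum_list lam)"
    using f(1) by (auto simp: group_algebra_def left_mult_def)
  then show ?thesis unfolding f(2) left_mult_galg_mult[OF \<sigma>] specht_def by (rule imageI)
qed

text \<open>The character as a function of permutations; \<open>irr_char\<close> evaluates it at a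
  chosen representative of a class.\<close>

definition specht_char :: "nat list \<Rightarrow> (nat \<Rightarrow> nat) \<Rightarrow> rat" where
  "specht_char lam \<sigma> = trace_on (specht lam) (left_mult \<sigma>)"

text \<open>Equal cycle types give conjugate permutations, and
  \<open>trace (X Y) = trace (Y X)\<close> is used with \<open>X\<close> the action of the
  conjugating \<open>g\<close>.\<close>

lemma class_function_specht_char: "class_function (sum_list lam) (specht_char lam)"
  unfolding class_function_def
proof (intro allI impI)
  fix \<sigma> \<tau> :: "nat \<Rightarrow> nat"
  let ?n = "sum_list lam"
  assume \<sigma>: "\<sigma> permutes {..<?n}" and \<tau>: "\<tau> permutes {..<?n}" and eq: "cycle_type ?n \<sigma> = cycle_type ?n \<tau>"
  obtain g where g: "g permutes {..<?n}" "\<tau> = g \<circ> \<sigma> \<circ> inv g"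
    by (rule conjugate_of_cycle_type_eq[OF \<sigma> \<tau> eq])
  have h: "\<sigma> \<circ> inv g permutes {..<?n}" by (rule permutes_compose[OF permutes_inv[OF g(1)] \<sigma>])
  have "left_mult \<tau> = left_mult g \<circ> left_mult (\<sigma> \<circ> inv g)"
    unfolding g(2) comp_assoc fun_eq_iff comp_apply
    using left_mult_comp[OF permutes_bij[OF g(1)] permutes_bij[OF h]] by (simp add: comp_def)
  moreover have "left_mult \<sigma> = left_mult (\<sigma> \<circ> inv g) \<circ> left_mult g"
  proof
    fix f
    have "\<sigma> \<circ> inv g \<circ> g = \<sigma>" by (simp add: fun_eq_iff permutes_inverses[OF g(1)])
    then show "left_mult \<sigma> f = (left_mult (\<sigma> \<circ> inv g) \<circ> left_mult g) f"
      using left_mult_comp[OF permutes_bij[OF h] permutes_bij[OF g(1)], of f] by (simp only: comp_apply)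
  qed
  ultimately show "specht_char lam \<sigma> = specht_char lam \<tau>"
    unfolding specht_char_def
    using trace_on_comp_commute[OF subspace_specht left_mult_specht[OF h] left_mult_sum left_mult_specht[OF g(1)] left_mult_sum]
    by (simp only:)
qed

text \<open>The classical argument with a transposition that lies both in the stabilizer of a labelling and
  in the row (or column) group of a tableau.\<close>

lemma stabilizer_sum_zero:
  assumes g: "g permutes {..<n}" and kl: "k < n" "l < n" "k \<noteq> l" "f (g k) = f (g l)"
    and E: "\<And>x. E (transpose k l \<circ> x) = \<epsilon> * E x"
    and c: "\<And>\<sigma> a b. \<sigma> permutes {..<n} \<Longrightarrow> a \<noteq> b \<Longrightarrow> c (\<sigma> \<circ> transpose a b) = \<delta> * c \<sigma>"
    and "\<delta> * \<epsilon> = (-1 :: rat)"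
  shows "(\<Sum>\<sigma>\<in>stabilizer n f. c \<sigma> * E (inv g \<circ> (inv \<sigma> \<circ> \<pi>))) = 0"
proof -
  \<comment> \<open>The conjugate by \<open>g\<close> of the transposition of cells \<open>k\<close>
    and \<open>l\<close>. It fixes \<open>f\<close>, so right multiplication by it permutes the
    stabilizer and multiplies each term by \<open>\<delta> * \<epsilon> = -1\<close>.\<close>
  let ?s = "transpose (g k) (g l)"
  let ?S = "\<Sum>\<sigma>\<in>stabilizer n f. c \<sigma> * E (inv g \<circ> (inv \<sigma> \<circ> \<pi>))"
  have gkl: "g k < n" "g l < n" "g k \<noteq> g l"
    using g kl permutes_in_image[OF g] permutes_inj[OF g] by (auto simp: inj_eq)
  have s: "?s permutes {..<n}" using gkl by (intro permutes_swap_id) auto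
  have fs: "f (?s x) = f x" for x using kl(4) by (auto simp: transpose_def)
  have ss: "(\<sigma> \<circ> ?s) \<circ> ?s = \<sigma>" for \<sigma> :: "nat \<Rightarrow> nat" by (simp add: fun_eq_iff)
  have mem: "\<sigma> \<circ> ?s \<in> stabilizer n f" if "\<sigma> \<in> stabilizer n f" for \<sigma>
    using that permutes_compose[OF s, of \<sigma>] permutes_in_image[OF s] fs by (auto simp: stabilizer_def)
  have conj: "inv g \<circ> ?s = transpose k l \<circ> inv g"
  proof
    fix x
    obtain y where y: "x = g y" using permutes_surj[OF g] by blast
    have "?s (g y) = g (transpose k l y)" using permutes_inj[OF g] by (auto simp: transpose_def inj_eq)
    then show "(inv g \<circ> ?s) x = (transpose k l \<circ> inv g) x" by (simp add: y permutes_inverses[OF g])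
  qed
  have step: "c (\<sigma> \<circ> ?s) * E (inv g \<circ> (inv (\<sigma> \<circ> ?s) \<circ> \<pi>)) = - (c \<sigma> * E (inv g \<circ> (inv \<sigma> \<circ> \<pi>)))"
    if "\<sigma> \<in> stabilizer n f" for \<sigma>
  proof -
    have \<sigma>: "\<sigma> permutes {..<n}" using that by (simp add: stabilizer_def)
    have "inv (\<sigma> \<circ> ?s) = ?s \<circ> inv \<sigma>" using \<sigma> s by (simp add: o_inv_distrib permutes_bij)
    then have "inv g \<circ> (inv (\<sigma> \<circ> ?s) \<circ> \<pi>) = (inv g \<circ> ?s) \<circ> (inv \<sigma> \<circ> \<pi>)" by (simp only: comp_assoc)
    then have "E (inv g \<circ> (inv (\<sigma> \<circ> ?s) \<circ> \<pi>)) = \<epsilon> * E (inv g \<circ> (inv \<sigma> \<circ> \<pi>))"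
      by (simp only: conj E comp_assoc)
    moreover have "c (\<sigma> \<circ> ?s) = \<delta> * c \<sigma>" by (rule c[OF \<sigma> gkl(3)])
    ultimately have "c (\<sigma> \<circ> ?s) * E (inv g \<circ> (inv (\<sigma> \<circ> ?s) \<circ> \<pi>)) = (\<delta> * \<epsilon>) * (c \<sigma> * E (inv g \<circ> (inv \<sigma> \<circ> \<pi>)))"
      by (simp only: ac_simps)
    then show ?thesis using assms(8) by (simp only: mult_minus1)
  qed
  have "?S = (\<Sum>\<sigma>\<in>stabilizer n f. c (\<sigma> \<circ> ?s) * E (inv g \<circ> (inv (\<sigma> \<circ> ?s) \<circ> \<pi>)))"
    by (rule sum.reindex_bij_witness[where i = "\<lambda>\<sigma>. \<sigma> \<circ> ?s" and j = "\<lambda>\<sigma>. \<sigma> \<circ> ?s"]) (simp_all only: ss mem)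
  also have "\<dots> = (\<Sum>\<sigma>\<in>stabilizer n f. - (c \<sigma> * E (inv g \<circ> (inv \<sigma> \<circ> \<pi>))))"
    by (rule sum.cong[OF refl step])
  also have "\<dots> = - ?S" by (rule sum_negf)
  finally show ?thesis by (simp only: equal_neg_zero)
qed

text \<open>Every element of the module is a combination of translates of the Young symmetrizer, so
  an operator that kills the translates is 0 on the module and has trace 0.\<close>

lemma specht_char_sum_zero:
  assumes "\<And>g \<pi>. g permutes {..<sum_list lam} \<Longrightarrow>
    (\<Sum>\<sigma>\<in>stabilizer (sum_list lam) f. c \<sigma> * young_symmetrizer lam (inv g \<circ> (inv \<sigma> \<circ> \<pi>))) = 0"
  shows "(\<Sum>\<sigma>\<in>stabilizer (sum_list lam) f. c \<sigma> * specht_char lam \<sigma>) = 0"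
  unfolding specht_char_def
proof (rule trace_on_sum_zero[OF subspace_specht])
  let ?n = "sum_list lam" and ?e = "young_symmetrizer lam"
  show "left_mult \<sigma> v \<in> specht lam" if "\<sigma> \<in> stabilizer ?n f" "v \<in> specht lam" for \<sigma> v
    using that left_mult_specht by (simp add: stabilizer_def)
  fix v \<pi> assume "v \<in> specht lam"
  then obtain y where v: "v = galg_mult ?n y ?e" by (auto simp: specht_def)
  have "(\<Sum>\<sigma>\<in>stabilizer ?n f. c \<sigma> * left_mult \<sigma> v \<pi>)
    = (\<Sum>g | g permutes {..<?n}. y g * (\<Sum>\<sigma>\<in>stabilizer ?n f. c \<sigma> * ?e (inv g \<circ> (inv \<sigma> \<circ> \<pi>))))"
    unfolding v left_mult_def galg_mult_def sum_distrib_left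
    by (subst sum.swap) (simp only: mult.left_commute)
  also have "\<dots> = 0" using assms by simp
  finally show "(\<Sum>\<sigma>\<in>stabilizer ?n f. c \<sigma> * left_mult \<sigma> v \<pi>) = 0" .
qed

text \<open>The row factor stands on the left and absorbs row permutations.\<close>

lemma young_symmetrizer_row_transpose:
  assumes "k < sum_list lam" "l < sum_list lam" "fst (cells lam ! k) = fst (cells lam ! l)"
  shows "young_symmetrizer lam (transpose k l \<circ> x) = young_symmetrizer lam x"
proof -
  let ?n = "sum_list lam" and ?t = "transpose k l"
  let ?a = "\<lambda>\<pi>. if \<pi> \<in> row_group lam then 1 else 0 :: rat"
  let ?b = "\<lambda>\<pi>. if \<pi> \<in> column_group lam then of_int (sign \<pi>) else 0 :: rat"
  have t: "?t permutes {..<?n}" using assms by (intro permutes_swap_id) auto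
  have tt: "?t \<circ> (?t \<circ> p) = p" for p :: "nat \<Rightarrow> nat" by (simp add: fun_eq_iff)
  have ft: "fst (cells lam ! ?t j) = fst (cells lam ! j)" for j using assms(3) by (auto simp: transpose_def)
  have row: "?t \<circ> p \<in> row_group lam" if "p \<in> row_group lam" for p
    using that permutes_compose[OF _ t, of p] ft by (auto simp: row_group_def)
  have row_iff: "?t \<circ> p \<in> row_group lam \<longleftrightarrow> p \<in> row_group lam" for p
    using row[of p] row[of "?t \<circ> p"] by (auto simp only: tt)
  have "galg_mult ?n ?a ?b (?t \<circ> x) = galg_mult ?n ?a ?b x"
    unfolding galg_mult_def
  proof (rule sum.reindex_bij_witness[where i = "\<lambda>p. ?t \<circ> p" and j = "\<lambda>p. ?t \<circ> p"])
    fix p assume "p \<in> {p. p permutes {..<?n}}"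
    then have p: "p permutes {..<?n}" by simp
    show "?t \<circ> (?t \<circ> p) = p" "?t \<circ> (?t \<circ> p) = p" by (rule tt)+
    show "?t \<circ> p \<in> {p. p permutes {..<?n}}" "?t \<circ> p \<in> {p. p permutes {..<?n}}"
      using permutes_compose[OF p t] by auto
    have "inv (?t \<circ> p) = inv p \<circ> ?t" using p t by (simp add: o_inv_distrib permutes_bij)
    then show "?a (?t \<circ> p) * ?b (inv (?t \<circ> p) \<circ> x) = ?a p * ?b (inv p \<circ> (?t \<circ> x))"
      by (simp only: row_iff comp_assoc)
  qed
  then show ?thesis by (simp only: young_symmetrizer_def)
qed

text \<open>Stated for the column factor by itself, because in the Young symmetrizer the row factor
  stands to its left.\<close>

lemma signed_column_group_transpose:
  assumes "k < sum_list lam" "l < sum_list lam" "k \<noteq> l" "snd (cells lam ! k) = snd (cells lam ! l)"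
  defines "b \<equiv> \<lambda>\<pi>. if \<pi> \<in> column_group lam then of_int (sign \<pi>) else 0 :: rat"
  shows "b (transpose k l \<circ> x) = - b x"
proof -
  let ?n = "sum_list lam" and ?t = "transpose k l"
  have t: "?t permutes {..<?n}" using assms by (intro permutes_swap_id) auto
  have tt: "?t \<circ> (?t \<circ> p) = p" for p :: "nat \<Rightarrow> nat" by (simp add: fun_eq_iff)
  have ft: "snd (cells lam ! ?t j) = snd (cells lam ! j)" for j using assms(4) by (auto simp: transpose_def)
  have col: "?t \<circ> p \<in> column_group lam" if "p \<in> column_group lam" for p
    using that permutes_compose[OF _ t, of p] ft by (auto simp: column_group_def)
  have col_iff: "?t \<circ> p \<in> column_group lam \<longleftrightarrow> p \<in> column_group lam" for p
    using col[of p] col[of "?t \<circ> p"] by (auto simp only: tt)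
  have "sign (?t \<circ> x) = - sign x" if "x \<in> column_group lam"
    using that assms(3) permutation_of_permutes[of x ?n]
    by (subst sign_compose) (auto simp: column_group_def permutation_swap_id sign_swap_id)
  then show ?thesis unfolding b_def col_iff by (simp only: of_int_minus if_cancel minus_zero split: if_split) simp
qed

text \<open>If every numbering \<open>g\<close> of the cells put two equal labels into one column,
  the stabilizer sum would kill all translates of the column factor, hence the module.\<close>

lemma specht_char_stabilizer_columns:
  assumes "sum (specht_char lam) (stabilizer (sum_list lam) f) \<noteq> 0"
  shows "\<exists>g. g permutes {..<sum_list lam} \<and> (\<forall>k l. k < sum_list lam \<and> l < sum_list lam \<and> k \<noteq> l \<and>
      snd (cells lam ! k) = snd (cells lam ! l) \<longrightarrow> f (g k) \<noteq> f (g l))"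
proof (rule ccontr)
  let ?n = "sum_list lam"
  let ?a = "\<lambda>\<pi>. if \<pi> \<in> row_group lam then 1 else 0 :: rat"
  let ?b = "\<lambda>\<pi>. if \<pi> \<in> column_group lam then of_int (sign \<pi>) else 0 :: rat"
  assume a: "\<not> ?thesis"
  then have ex: "\<exists>k l. k < ?n \<and> l < ?n \<and> k \<noteq> l \<and> snd (cells lam ! k) = snd (cells lam ! l) \<and> f (g k) = f (g l)"
    if "g permutes {..<?n}" for g using that a by blast
  have z: "(\<Sum>\<sigma>\<in>stabilizer ?n f. 1 * ?b (inv g \<circ> (inv \<sigma> \<circ> \<pi>))) = 0" if g: "g permutes {..<?n}" for g \<pi>
  proof -
    obtain k l where kl: "k < ?n" "l < ?n" "k \<noteq> l" "snd (cells lam ! k) = snd (cells lam ! l)" "f (g k) = f (g l)"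
      using ex[OF g] by blast
    show ?thesis
      by (rule stabilizer_sum_zero[OF g kl(1-3,5), where \<epsilon> = "-1" and \<delta> = 1])
        (simp_all only: signed_column_group_transpose[OF kl(1-4)] mult_minus1 mult_1_left)
  qed
  have "(\<Sum>\<sigma>\<in>stabilizer ?n f. 1 * specht_char lam \<sigma>) = 0"
  proof (rule specht_char_sum_zero)
    fix g \<pi> assume g: "g permutes {..<?n}"
    have "(\<Sum>\<sigma>\<in>stabilizer ?n f. 1 * young_symmetrizer lam (inv g \<circ> (inv \<sigma> \<circ> \<pi>)))
      = (\<Sum>p | p permutes {..<?n}. ?a p * (\<Sum>\<sigma>\<in>stabilizer ?n f. 1 * ?b (inv p \<circ> (inv g \<circ> (inv \<sigma> \<circ> \<pi>)))))"
      unfolding young_symmetrizer_def galg_mult_def sum_distrib_left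
      by (subst sum.swap) (simp only: mult_1_left)
    also have "\<dots> = 0"
    proof (rule sum.neutral, rule ballI)
      fix p assume "p \<in> {p. p permutes {..<?n}}"
      then have p: "p permutes {..<?n}" by simp
      \<comment> \<open>A row permutation \<open>p\<close> only changes the numbering from
        \<open>g\<close> to \<open>g \<circ> p\<close>, which is covered by
        \<open>z\<close>.\<close>
      have "inv (g \<circ> p) = inv p \<circ> inv g" using p g by (simp add: o_inv_distrib permutes_bij)
      then have "inv p \<circ> (inv g \<circ> y) = inv (g \<circ> p) \<circ> y" for y :: "nat \<Rightarrow> nat" by (simp only: comp_assoc)
      then show "?a p * (\<Sum>\<sigma>\<in>stabilizer ?n f. 1 * ?b (inv p \<circ> (inv g \<circ> (inv \<sigma> \<circ> \<pi>)))) = 0"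
        by (simp only: z[OF permutes_compose[OF p g]] mult_zero_right)
    qed
    finally show "(\<Sum>\<sigma>\<in>stabilizer ?n f. 1 * young_symmetrizer lam (inv g \<circ> (inv \<sigma> \<circ> \<pi>))) = 0" .
  qed
  then show False using assms by simp
qed

text \<open>The same argument with rows; the sign now comes from the weight, and the symmetrizer
  itself is invariant.\<close>

lemma specht_char_stabilizer_rows:
  assumes "(\<Sum>\<sigma>\<in>stabilizer (sum_list lam) f. of_int (sign \<sigma>) * specht_char lam \<sigma>) \<noteq> 0"
  shows "\<exists>g. g permutes {..<sum_list lam} \<and> (\<forall>k l. k < sum_list lam \<and> l < sum_list lam \<and> k \<noteq> l \<and>
      fst (cells lam ! k) = fst (cells lam ! l) \<longrightarrow> f (g k) \<noteq> f (g l))"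
proof (rule ccontr)
  let ?n = "sum_list lam"
  assume a: "\<not> ?thesis"
  then have ex: "\<exists>k l. k < ?n \<and> l < ?n \<and> k \<noteq> l \<and> fst (cells lam ! k) = fst (cells lam ! l) \<and> f (g k) = f (g l)"
    if "g permutes {..<?n}" for g using that a by blast
  have sg: "of_int (sign (\<sigma> \<circ> transpose a b)) = -1 * (of_int (sign \<sigma>) :: rat)"
    if "\<sigma> permutes {..<?n}" "a \<noteq> b" for \<sigma> a b
    using that permutation_of_permutes[of \<sigma> ?n]
    by (subst sign_compose) (auto simp: permutation_swap_id sign_swap_id)
  have "(\<Sum>\<sigma>\<in>stabilizer ?n f. of_int (sign \<sigma>) * specht_char lam \<sigma>) = 0"
  proof (rule specht_char_sum_zero)
    fix g \<pi> assume g: "g permutes {..<?n}"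
    obtain k l where kl: "k < ?n" "l < ?n" "k \<noteq> l" "fst (cells lam ! k) = fst (cells lam ! l)" "f (g k) = f (g l)"
      using ex[OF g] by blast
    show "(\<Sum>\<sigma>\<in>stabilizer ?n f. of_int (sign \<sigma>) * young_symmetrizer lam (inv g \<circ> (inv \<sigma> \<circ> \<pi>))) = 0"
    proof (rule stabilizer_sum_zero[OF g kl(1-3,5), where \<epsilon> = 1 and \<delta> = "-1"])
      show "young_symmetrizer lam (transpose k l \<circ> x) = 1 * young_symmetrizer lam x" for x
        by (simp only: young_symmetrizer_row_transpose[OF kl(1,2,4)] mult_1_left)
    qed (rule sg, assumption+, simp)
  qed
  then show False using assms by simp
qed

section \<open>Counting labelled cells of a Young diagram\<close>

definition diagram :: "nat list \<Rightarrow> (nat \<times> nat) set" where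
  "diagram lam = {(i, j). i < length lam \<and> j < lam ! i}"

lemma set_cells: "set (cells lam) = diagram lam"
  by (auto simp: cells_def diagram_def)

lemma distinct_concat_map_Pair:
  assumes "distinct is" "\<And>i. distinct (g i)"
  shows "distinct (concat (map (\<lambda>i. map (Pair i) (g i)) is))"
  using assms(1) by (induction "is") (use assms(2) in \<open>auto simp: distinct_map inj_on_def\<close>)

lemma distinct_cells: "distinct (cells lam)"
  unfolding cells_def by (rule distinct_concat_map_Pair) auto

lemma length_cells: "length (cells lam) = sum_list lam"
  by (simp add: cells_def length_concat comp_def map_nth)

lemma finite_diagram: "finite (diagram lam)"
  by (simp flip: set_cells)

text \<open>A column of height \<open>h\<close> contains at most \<open>min h (card Q)\<close> cells
  with labels in \<open>Q\<close>, and exactly that many cells in the first \<open>card Q\<close>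
  rows.\<close>

lemma card_labelled_le:
  fixes D :: "(nat \<times> nat) set"
  assumes D: "finite D" and down: "\<And>i i' j. (i, j) \<in> D \<Longrightarrow> i' \<le> i \<Longrightarrow> (i', j) \<in> D"
    and L: "\<And>i i' j. (i, j) \<in> D \<Longrightarrow> (i', j) \<in> D \<Longrightarrow> L (i, j) = L (i', j) \<Longrightarrow> i = i'"
    and Q: "finite Q"
  shows "card {c \<in> D. L c \<in> Q} \<le> card {c \<in> D. fst c < card Q}"
proof -
  let ?J = "snd ` D"
  let ?col = "\<lambda>P j. {i. (i, j) \<in> D \<and> P (i, j)}"
  have fincol: "finite (?col P j)" for P j
    by (rule finite_subset[of _ "fst ` D"]) (use D in force)+
  have count: "card {c \<in> D. P c} = (\<Sum>j\<in>?J. card (?col P j))" for P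
  proof -
    have "{c \<in> D. P c} = prod.swap ` (SIGMA j:?J. ?col P j)" by force
    then have "card {c \<in> D. P c} = card (SIGMA j:?J. ?col P j)" by (simp add: card_image)
    then show ?thesis using D fincol by (simp add: card_SigmaI)
  qed
  have "card (?col (\<lambda>c. L c \<in> Q) j) \<le> card (?col (\<lambda>c. fst c < card Q) j)" for j
  proof (cases "\<exists>i. (i, j) \<in> D \<and> card Q \<le> i")
    case True
    then have "{..<card Q} \<subseteq> ?col (\<lambda>c. fst c < card Q) j" using down by fastforce
    then have "card {..<card Q} \<le> card (?col (\<lambda>c. fst c < card Q) j)" by (rule card_mono[OF fincol])
    then have "card Q \<le> card (?col (\<lambda>c. fst c < card Q) j)" by (simp only: card_lessThan)
    moreover have "card (?col (\<lambda>c. L c \<in> Q) j) \<le> card Q"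
      by (rule card_inj_on_le[of "\<lambda>i. L (i, j)"]) (use L Q in \<open>auto simp: inj_on_def\<close>)
    ultimately show ?thesis by simp
  next
    case False
    then show ?thesis by (intro card_mono fincol) force
  qed
  then show ?thesis unfolding count by (intro sum_mono)
qed

lemma card_labels_conv_cells:
  assumes g: "g permutes {..<sum_list lam}"
  obtains L where "\<forall>k < sum_list lam. L (cells lam ! k) = f (g k)"
    "\<forall>Q. card {x. x < sum_list lam \<and> f x \<in> Q} = card {c \<in> diagram lam. L c \<in> Q}"
proof -
  let ?n = "sum_list lam"
  define L where "L c = f (g (SOME k. k < ?n \<and> cells lam ! k = c))" for c
  have L: "L (cells lam ! k) = f (g k)" if "k < ?n" for k
  proof -
    have "(SOME k'. k' < ?n \<and> cells lam ! k' = cells lam ! k) = k"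
      by (rule some_equality) (use that nth_eq_iff_index_eq[OF distinct_cells] in \<open>auto simp: length_cells\<close>)
    then show ?thesis by (simp add: L_def)
  qed
  have "card {x. x < ?n \<and> f x \<in> Q} = card {c \<in> diagram lam. L c \<in> Q}" for Q
  proof -
    have b1: "bij_betw (\<lambda>k. cells lam ! k) {k. k < ?n \<and> f (g k) \<in> Q} {c \<in> diagram lam. L c \<in> Q}"
      unfolding bij_betw_def
    proof
      show "inj_on ((!) (cells lam)) {k. k < ?n \<and> f (g k) \<in> Q}"
        using nth_eq_iff_index_eq[OF distinct_cells] by (auto simp: inj_on_def length_cells)
      show "(!) (cells lam) ` {k. k < ?n \<and> f (g k) \<in> Q} = {c \<in> diagram lam. L c \<in> Q}"
      proof (intro equalityI subsetI)
        fix c assume c: "c \<in> {c \<in> diagram lam. L c \<in> Q}"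
        then obtain k where k: "k < ?n" "c = cells lam ! k"
          by (metis (no_types, lifting) mem_Collect_eq set_cells in_set_conv_nth length_cells)
        then have "k \<in> {k. k < ?n \<and> f (g k) \<in> Q}" using c L[OF k(1)] by simp
        then show "c \<in> (!) (cells lam) ` {k. k < ?n \<and> f (g k) \<in> Q}" unfolding k(2) by (rule imageI)
      next
        fix c assume "c \<in> (!) (cells lam) ` {k. k < ?n \<and> f (g k) \<in> Q}"
        then obtain k where k: "k < ?n" "f (g k) \<in> Q" "c = cells lam ! k" by auto
        have "c \<in> diagram lam" unfolding k(3) set_cells[symmetric] using k(1) by (simp add: length_cells)
        then show "c \<in> {c \<in> diagram lam. L c \<in> Q}" using k L[OF k(1)] by simp
      qed
    qed
    have b2: "bij_betw g {k. k < ?n \<and> f (g k) \<in> Q} {x. x < ?n \<and> f x \<in> Q}"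
      unfolding bij_betw_def
    proof
      show "inj_on g {k. k < ?n \<and> f (g k) \<in> Q}" using permutes_inj[OF g] by (rule inj_on_subset) simp
      show "g ` {k. k < ?n \<and> f (g k) \<in> Q} = {x. x < ?n \<and> f x \<in> Q}"
      proof (intro equalityI subsetI)
        fix x assume x: "x \<in> {x. x < ?n \<and> f x \<in> Q}"
        then have "x \<in> g ` {..<?n}" unfolding permutes_image[OF g] by simp
        then show "x \<in> g ` {k. k < ?n \<and> f (g k) \<in> Q}" using x by auto
      qed (use permutes_in_image[OF g] in auto)
    qed
    show ?thesis using bij_betw_same_card[OF b1] bij_betw_same_card[OF b2] by (simp only:)
  qed
  then show thesis using L that by blast
qed

lemma diagram_down:
  assumes "is_partition lam" "(i, j) \<in> diagram lam" "i' \<le> i" "j' \<le> j"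
  shows "(i', j') \<in> diagram lam"
proof -
  have "lam ! i \<le> lam ! i'"
    using assms sorted_wrt_nth_less[of "(\<ge>)" lam i' i] by (cases "i' = i") (auto simp: is_partition_def diagram_def)
  then show ?thesis using assms by (auto simp: diagram_def)
qed

lemma partition_rank_diagram:
  assumes "is_partition lam" "q < partition_rank lam"
  shows "(q, q) \<in> diagram lam"
proof -
  let ?S = "{i. i \<le> nth_part lam i}"
  have "?S \<subseteq> {..length lam}" by (auto simp: nth_part_def split: if_splits)
  then have "finite ?S" by (rule finite_subset) simp
  \<comment> \<open>Index 0 belongs to the set because \<open>nth_part lam 0 = 0\<close>, so the
    maximum is attained.\<close>
  then have "partition_rank lam \<in> ?S" unfolding partition_rank_def by (rule Max_in) auto
  then have "partition_rank lam \<le> length lam" "partition_rank lam \<le> lam ! (partition_rank lam - 1)"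
    using assms(2) by (auto simp: nth_part_def split: if_splits)
  then have "(partition_rank lam - 1, partition_rank lam - 1) \<in> diagram lam"
    using assms(2) by (auto simp: diagram_def)
  then show ?thesis by (rule diagram_down[OF assms(1)]) (use assms(2) in auto)
qed

text \<open>Here \<open>R q\<close> and \<open>K q\<close> are the actual numbers of cells in the
  first \<open>q\<close> rows and columns of \<open>lam\<close>.\<close>

lemma specht_char_large_beads:
  assumes lam: "is_partition lam"
    and "m \<in> {..<N} \<rightarrow>\<^sub>E {..<N + N'}" "alt_inner (sum_list lam) (specht_char lam) N m \<noteq> 0"
  shows "partition_rank lam \<le> card {i. i < N \<and> N \<le> m i}"
proof (rule alt_inner_large_beads[OF assms(2,3)])
  let ?n = "sum_list lam" and ?D = "diagram lam"
  fix f :: "nat \<Rightarrow> nat" and Q :: "nat set" assume Q: "finite Q"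
  show "card {x. x < ?n \<and> f x \<in> Q} \<le> card {c \<in> ?D. fst c < card Q}"
    if nz: "sum (specht_char lam) (stabilizer ?n f) \<noteq> 0"
  proof -
    obtain g where g: "g permutes {..<?n}" "\<forall>k l. k < ?n \<and> l < ?n \<and> k \<noteq> l \<and>
      snd (cells lam ! k) = snd (cells lam ! l) \<longrightarrow> f (g k) \<noteq> f (g l)"
      using specht_char_stabilizer_columns[OF nz] by blast
    obtain L where L: "\<forall>k < ?n. L (cells lam ! k) = f (g k)"
      "\<forall>Q. card {x. x < ?n \<and> f x \<in> Q} = card {c \<in> ?D. L c \<in> Q}"
      by (rule card_labels_conv_cells[OF g(1), of f])
    have "i = i'" if c: "(i, j) \<in> ?D" "(i', j) \<in> ?D" "L (i, j) = L (i', j)" for i i' j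
    proof -
      obtain k l where kl: "k < ?n" "cells lam ! k = (i, j)" "l < ?n" "cells lam ! l = (i', j)"
        using c(1,2) by (metis set_cells in_set_conv_nth length_cells)
      then have "f (g k) = f (g l)" using L(1) c(3) by metis
      then have "k = l" using g(2)[rule_format, of k l] kl by auto
      then show ?thesis using kl by simp
    qed
    then show ?thesis unfolding L(2)[rule_format]
      using diagram_down[OF lam] by (intro card_labelled_le finite_diagram Q) auto
  qed
  show "card {x. x < ?n \<and> f x \<in> Q} \<le> card {c \<in> ?D. snd c < card Q}"
    if nz: "(\<Sum>\<sigma>\<in>stabilizer ?n f. of_int (sign \<sigma>) * specht_char lam \<sigma>) \<noteq> 0"
  proof -
    obtain g where g: "g permutes {..<?n}" "\<forall>k l. k < ?n \<and> l < ?n \<and> k \<noteq> l \<and>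
      fst (cells lam ! k) = fst (cells lam ! l) \<longrightarrow> f (g k) \<noteq> f (g l)"
      using specht_char_stabilizer_rows[OF nz] by blast
    obtain L where L: "\<forall>k < ?n. L (cells lam ! k) = f (g k)"
      "\<forall>Q. card {x. x < ?n \<and> f x \<in> Q} = card {c \<in> ?D. L c \<in> Q}"
      by (rule card_labels_conv_cells[OF g(1), of f])
    have inj: "j = j'" if c: "(i, j) \<in> ?D" "(i, j') \<in> ?D" "L (i, j) = L (i, j')" for i j j'
    proof -
      obtain k l where kl: "k < ?n" "cells lam ! k = (i, j)" "l < ?n" "cells lam ! l = (i, j')"
        using c(1,2) by (metis set_cells in_set_conv_nth length_cells)
      then have "f (g k) = f (g l)" using L(1) c(3) by metis
      then have "k = l" using g(2)[rule_format, of k l] kl by auto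
      then show ?thesis using kl by simp
    qed
    \<comment> \<open>The transposed diagram turns the bound for rows into the one for
      columns.\<close>
    let ?D' = "prod.swap ` ?D"
    have swap: "card {c \<in> ?D. P c} = card {c \<in> ?D'. P (prod.swap c)}" for P
    proof -
      have "{c \<in> ?D'. P (prod.swap c)} = prod.swap ` {c \<in> ?D. P c}" by force
      then show ?thesis by (simp add: card_image)
    qed
    have "card {c \<in> ?D'. (L \<circ> prod.swap) c \<in> Q} \<le> card {c \<in> ?D'. fst c < card Q}"
    proof (rule card_labelled_le)
      fix i i' j assume "(i, j) \<in> ?D'" "i' \<le> i"
      then show "(i', j) \<in> ?D'" using diagram_down[OF lam, of j i j i'] by (force simp: image_iff)
    next
      fix i i' j assume "(i, j) \<in> ?D'" "(i', j) \<in> ?D'" "(L \<circ> prod.swap) (i, j) = (L \<circ> prod.swap) (i', j)"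
      then show "i = i'" using inj[of j i i'] by (auto simp: image_iff)
    qed (use finite_diagram Q in auto)
    then show ?thesis unfolding L(2)[rule_format] swap[of "\<lambda>c. L c \<in> Q"] swap[of "\<lambda>c. snd c < card Q"] by simp
  qed
next
  let ?D = "diagram lam"
  fix q assume q: "q < partition_rank lam"
  let ?A = "{c \<in> ?D. fst c < q}" and ?B = "{c \<in> ?D. snd c < q}"
  have "card (?A \<union> ?B) < card ?D"
  proof (rule psubset_card_mono[OF finite_diagram])
    \<comment> \<open>The diagonal cell lies outside the first \<open>q\<close> rows and columns,
      which overlap in at most a square of side \<open>q\<close>.\<close>
    have "(q, q) \<in> ?D - (?A \<union> ?B)" using partition_rank_diagram[OF lam q] by simp
    then show "?A \<union> ?B \<subset> ?D" by blast
  qed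
  moreover have "card ?D = sum_list lam"
    using distinct_card[OF distinct_cells] by (simp add: set_cells length_cells)
  moreover have "card (?A \<inter> ?B) \<le> card ({..<q} \<times> {..<q})" by (rule card_mono) auto
  moreover have "card ?A + card ?B = card (?A \<union> ?B) + card (?A \<inter> ?B)"
    by (rule card_Un_Int) (use finite_diagram in auto)
  ultimately show "card ?A + card ?B < sum_list lam + q * q" by simp
qed

text \<open>The choice of a representative in \<open>irr_char\<close> is harmless, the character
  being a class function.\<close>

lemma irr_char_conv_specht_char:
  assumes "\<sigma> \<in> cycle_class (sum_list lam) \<kappa>"
  shows "irr_char lam \<kappa> = specht_char lam \<sigma>"
proof -
  let ?P = "\<lambda>\<pi>. \<pi> permutes {..<sum_list lam} \<and> cycle_type (sum_list lam) \<pi> = mset \<kappa>"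
  have \<sigma>: "?P \<sigma>" using assms by (simp add: cycle_class_def)
  then have "?P (SOME \<pi>. ?P \<pi>)" by (rule someI[of ?P])
  then show ?thesis
    using class_function_specht_char[of lam] \<sigma>
    unfolding irr_char_def class_function_def specht_char_def[symmetric] by metis
qed

lemma irr_char_two_part_sum:
  assumes lam: "is_partition lam" and \<rho>: "\<forall>k\<in>set \<rho>. 1 \<le> k" "s + sum_list \<rho> = sum_list lam"
    and "length \<rho> + 2 \<le> partition_rank lam"
  shows "(\<Sum>i\<in>{1..<s}. irr_char lam (i # (s - i) # \<rho>)) = 0"
proof (rule class_function_two_part_sum[OF class_function_specht_char irr_char_conv_specht_char])
  \<comment> \<open>The value of \<open>N\<close> is twice the degree, for orthogonality, plus one
    to be positive for the empty partition.\<close>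
  show "1 \<le> 2 * sum_list lam + 1" by simp
  show "length \<rho> + 2 \<le> card {i. i < 2 * sum_list lam + 1 \<and> 2 * sum_list lam + 1 \<le> m i}"
    if "m \<in> {..<2 * sum_list lam + 1} \<rightarrow>\<^sub>E {..<2 * sum_list lam + 1 + sum_list lam}"
      "alt_inner (sum_list lam) (specht_char lam) (2 * sum_list lam + 1) m \<noteq> 0" for m
    using specht_char_large_beads[OF lam that] assms(4) by simp
qed (use \<rho> in auto)

lemma irr_char_mset_cong: "mset \<kappa> = mset \<kappa>' \<Longrightarrow> irr_char lam \<kappa> = irr_char lam \<kappa>'"
  by (simp add: irr_char_def)

section \<open>Coefficients of symmetric functions\<close>

lemma series_coeff_sum: "series_coeff (\<Sum>i\<in>I. F i) \<alpha> = (\<Sum>i\<in>I. series_coeff (F i) \<alpha>)"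
  by (induction I rule: infinite_finite_induct) (auto simp: zero_series.rep_eq plus_series.rep_eq)

lemma series_coeff_sum_scale: "series_coeff (\<Sum>i\<in>I. a i \<cdot> F i) \<alpha> = (\<Sum>i\<in>I. a i * series_coeff (F i) \<alpha>)"
  by (simp add: series_coeff_sum scale_series.rep_eq)

lemma series_coeff_scale: "series_coeff (a \<cdot> F) \<alpha> = a * series_coeff F \<alpha>"
  by (simp add: scale_series.rep_eq)

lemma power_sum_tilde_conv: "power_sum_tilde \<mu> = (1 / of_nat (prod_list \<mu>)) \<cdot> power_sum \<mu>"
proof -
  have scale_mult: "(a \<cdot> F) * (b \<cdot> G) = (a * b) \<cdot> (F * G)" for a b F G
    by transfer (auto simp: fun_eq_iff sum_distrib_left case_prod_beta algebra_simps)
  have scale_one: "1 \<cdot> F = F" for F by transfer simp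
  show ?thesis
    unfolding power_sum_tilde_def power_sum_def
    by (induction \<mu>) (simp_all add: scale_mult scale_one)
qed

text \<open>The monomial obtained from the product of the power sums by picking the variable with
  index \<open>f ! t\<close> in the factor of \<open>\<beta> ! t\<close>.\<close>

definition word_monomial :: "nat list \<Rightarrow> nat list \<Rightarrow> nat multiset" where
  "word_monomial \<beta> f = (\<Sum>t<length f. replicate_mset (\<beta> ! t) (f ! t))"

definition monomial_words :: "nat list \<Rightarrow> nat multiset \<Rightarrow> nat list set" where
  "monomial_words \<beta> \<alpha> = {f. length f = length \<beta> \<and> word_monomial \<beta> f = \<alpha>}"

lemma word_monomial_Cons: "word_monomial (k # \<beta>) (i # f) = replicate_mset k i + word_monomial \<beta> f"
  by (simp add: word_monomial_def sum.lessThan_Suc_shift del: sum.lessThan_Suc)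

lemma count_word_monomial: "count (word_monomial \<beta> f) x = (\<Sum>t<length f. if f ! t = x then \<beta> ! t else 0)"
  by (simp add: word_monomial_def count_sum) (intro sum.cong refl, auto)

lemma set_word_monomial:
  assumes "length f = length \<beta>" "\<forall>k\<in>set \<beta>. 1 \<le> k"
  shows "set_mset (word_monomial \<beta> f) = set f"
proof -
  have "x \<in># word_monomial \<beta> f \<longleftrightarrow> x \<in> set f" for x
  proof -
    have "x \<in># word_monomial \<beta> f \<longleftrightarrow> count (word_monomial \<beta> f) x \<noteq> 0" by simp
    also have "\<dots> \<longleftrightarrow> (\<exists>t<length f. (if f ! t = x then \<beta> ! t else 0) \<noteq> 0)"
      unfolding count_word_monomial by auto
    also have "\<dots> \<longleftrightarrow> (\<exists>t<length f. f ! t = x)"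
    proof (intro ex_cong1 conj_cong refl)
      fix t assume "t < length f"
      then have "1 \<le> \<beta> ! t" using assms by simp
      then show "(if f ! t = x then \<beta> ! t else 0) \<noteq> 0 \<longleftrightarrow> f ! t = x" by simp
    qed
    finally show ?thesis by (simp add: in_set_conv_nth)
  qed
  then show ?thesis by blast
qed

text \<open>With distinct letters each variable receives a single entry of \<open>\<beta>\<close>,
  so \<open>\<beta>\<close> can be read back.\<close>

lemma map_count_word_monomial:
  assumes "distinct f" "length f = length \<beta>"
  shows "map (count (word_monomial \<beta> f)) f = \<beta>"
proof (rule nth_equalityI)
  fix t assume "t < length (map (count (word_monomial \<beta> f)) f)"
  then have t: "t < length f" by simp
  have "(\<Sum>t'<length f. if f ! t' = f ! t then \<beta> ! t' else 0) = (\<Sum>t'<length f. if t' = t then \<beta> ! t' else 0)"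
    using assms(1) t by (intro sum.cong refl) (simp add: nth_eq_iff_index_eq)
  then show "map (count (word_monomial \<beta> f)) f ! t = \<beta> ! t" using t by (simp add: count_word_monomial)
qed (use assms in simp)

definition exponents :: "nat multiset \<Rightarrow> nat multiset" where
  "exponents \<alpha> = image_mset (count \<alpha>) (mset_set (set_mset \<alpha>))"

lemma exponents_word_monomial:
  assumes "distinct f" "length f = length \<beta>" "\<forall>k\<in>set \<beta>. 1 \<le> k"
  shows "exponents (word_monomial \<beta> f) = mset \<beta>"
proof -
  have "exponents (word_monomial \<beta> f) = mset (map (count (word_monomial \<beta> f)) f)"
    unfolding exponents_def set_word_monomial[OF assms(2,3)] using assms(1) by (simp add: mset_set_set)
  then show ?thesis by (simp only: map_count_word_monomial[OF assms(1,2)])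
qed

lemma finite_monomial_words:
  assumes "\<forall>k\<in>set \<beta>. 1 \<le> k"
  shows "finite (monomial_words \<beta> \<alpha>)"
  by (rule finite_subset[OF _ finite_lists_length_eq[of "set_mset \<alpha>" "length \<beta>"]])
    (use set_word_monomial assms in \<open>auto simp: monomial_words_def\<close>)

lemma monomial_words_Cons:
  "monomial_words (k # \<beta>) \<alpha> = (\<lambda>(i, f). i # f) `
    (SIGMA i:{i. replicate_mset k i \<subseteq># \<alpha>}. monomial_words \<beta> (\<alpha> - replicate_mset k i))" (is "?L = ?R")
proof (intro equalityI subsetI)
  fix f assume "f \<in> ?L"
  then obtain i g where f: "f = i # g" "length g = length \<beta>" "word_monomial (k # \<beta>) (i # g) = \<alpha>"
    by (cases f) (auto simp: monomial_words_def)
  then have "replicate_mset k i + word_monomial \<beta> g = \<alpha>" by (simp add: word_monomial_Cons)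
  then have "(i, g) \<in> (SIGMA i:{i. replicate_mset k i \<subseteq># \<alpha>}. monomial_words \<beta> (\<alpha> - replicate_mset k i))"
    using f by (auto simp: monomial_words_def)
  then show "f \<in> ?R" using f(1) by force
next
  fix f assume "f \<in> ?R"
  then obtain i g where f: "f = i # g" "replicate_mset k i \<subseteq># \<alpha>" "g \<in> monomial_words \<beta> (\<alpha> - replicate_mset k i)"
    by auto
  then show "f \<in> ?L" by (auto simp: monomial_words_def word_monomial_Cons)
qed

lemma series_coeff_power_sum:
  assumes "\<forall>k\<in>set \<beta>. 1 \<le> k"
  shows "series_coeff (power_sum \<beta>) \<alpha> = of_nat (card (monomial_words \<beta> \<alpha>))"
  using assms
proof (induction \<beta> arbitrary: \<alpha>)
  case Nil
  have "monomial_words [] \<alpha> = (if \<alpha> = {#} then {[]} else {})"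
    by (auto simp: monomial_words_def word_monomial_def)
  then show ?case by (simp add: power_sum_def one_series.rep_eq)
next
  case (Cons k \<beta>)
  then have k: "1 \<le> k" and \<beta>: "\<forall>k\<in>set \<beta>. 1 \<le> k" by auto
  let ?I = "{i. replicate_mset k i \<subseteq># \<alpha>}"
  let ?h = "\<lambda>i. (replicate_mset k i, \<alpha> - replicate_mset k i)"
  let ?F = "\<lambda>(\<gamma>, \<delta>). series_coeff (power_sum1 k) \<gamma> * series_coeff (power_sum \<beta>) \<delta>"
  have "?I \<subseteq> set_mset \<alpha>"
  proof
    fix i assume "i \<in> ?I"
    then have "replicate_mset k i \<subseteq># \<alpha>" by simp
    moreover have "i \<in># replicate_mset k i" using k by simp
    ultimately show "i \<in># \<alpha>" by (rule mset_subset_eqD)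
  qed
  then have finI: "finite ?I" by (rule finite_subset) simp
  have inj: "replicate_mset k i = replicate_mset k j \<Longrightarrow> i = j" for i j :: nat
    using k by (metis not_one_le_zero count_replicate_mset)
  have "series_coeff (power_sum (k # \<beta>)) \<alpha> = sum ?F {(\<gamma>, \<delta>). \<gamma> + \<delta> = \<alpha>}"
    by (simp add: power_sum_def times_series.rep_eq)
  \<comment> \<open>Only powers of a single variable have a nonzero coefficient in the first
    factor.\<close>
  also have "\<dots> = sum ?F (?h ` ?I)"
  proof (rule sum.mono_neutral_right[OF finite_splittings])
    show "?h ` ?I \<subseteq> {(\<gamma>, \<delta>). \<gamma> + \<delta> = \<alpha>}" by auto
    show "\<forall>p\<in>{(\<gamma>, \<delta>). \<gamma> + \<delta> = \<alpha>} - ?h ` ?I. ?F p = 0"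
    proof clarify
      fix \<gamma> \<delta> assume *: "\<alpha> = \<gamma> + \<delta>" "(\<gamma>, \<delta>) \<notin> (\<lambda>i. (replicate_mset k i, \<gamma> + \<delta> - replicate_mset k i)) ` {i. replicate_mset k i \<subseteq># \<gamma> + \<delta>}"
      have "\<not> (\<exists>i. \<gamma> = replicate_mset k i)" using *(2) by auto
      then show "series_coeff (power_sum1 k) \<gamma> * series_coeff (power_sum \<beta>) \<delta> = 0"
        by (simp add: power_sum1.rep_eq)
    qed
  qed
  also have "\<dots> = (\<Sum>i\<in>?I. ?F (?h i))"
    by (rule sum.reindex[unfolded comp_def]) (auto simp: inj_on_def dest: inj)
  also have "\<dots> = (\<Sum>i\<in>?I. of_nat (card (monomial_words \<beta> (\<alpha> - replicate_mset k i))))"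
    using Cons.IH[OF \<beta>] by (intro sum.cong refl) (auto simp: power_sum1.rep_eq)
  also have "\<dots> = of_nat (card (SIGMA i:?I. monomial_words \<beta> (\<alpha> - replicate_mset k i)))"
    using finI finite_monomial_words[OF \<beta>] by (subst card_SigmaI) auto
  also have "\<dots> = of_nat (card (monomial_words (k # \<beta>) \<alpha>))"
    unfolding monomial_words_Cons by (subst card_image) (auto simp: inj_on_def)
  finally show ?case .
qed

section \<open>Linear independence of the power sums\<close>

lemma partition_positive: "is_partition \<mu> \<Longrightarrow> \<forall>k\<in>set \<mu>. 1 \<le> k"
  by (metis is_partition_def less_one not_le)

lemma partition_eq_iff_mset: "is_partition \<mu> \<Longrightarrow> is_partition \<nu> \<Longrightarrow> mset \<mu> = mset \<nu> \<longleftrightarrow> \<mu> = \<nu>"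
proof
  assume "is_partition \<mu>" "is_partition \<nu>" "mset \<mu> = mset \<nu>"
  then have "sorted (rev \<mu>)" "sorted (rev \<nu>)" "mset (rev \<mu>) = mset (rev \<nu>)"
    by (auto simp: is_partition_def sorted_wrt_rev)
  then show "\<mu> = \<nu>" by (metis properties_for_sort rev_rev_ident)
qed simp

text \<open>Choose \<open>\<nu>\<close> of maximal length with nonzero coefficient, and a monomial
  with exponents \<open>\<nu>\<close> in \<open>length \<nu>\<close> variables. A word for a
  partition of at most this length can produce it only with distinct letters, so the partition is
  \<open>\<nu>\<close>.\<close>

lemma power_sum_independent:
  assumes "finite S" "\<And>\<mu>. \<mu> \<in> S \<Longrightarrow> is_partition \<mu>" "(\<Sum>\<mu>\<in>S. a \<mu> \<cdot> power_sum \<mu>) = 0" "\<mu> \<in> S"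
  shows "a \<mu> = 0"
proof (rule ccontr)
  assume "a \<mu> \<noteq> 0"
  let ?S = "{\<mu> \<in> S. a \<mu> \<noteq> 0}"
  have S: "finite ?S" "?S \<noteq> {}" using assms \<open>a \<mu> \<noteq> 0\<close> by auto
  then have "Max (length ` ?S) \<in> length ` ?S" by (intro Max_in) auto
  then obtain \<nu> where \<nu>: "length \<nu> = Max (length ` ?S)" "\<nu> \<in> ?S" by auto
  have max: "length \<kappa> \<le> length \<nu>" if "\<kappa> \<in> ?S" for \<kappa>
    unfolding \<nu>(1) by (rule Max_ge) (use S that in auto)
  have pos: "\<forall>k\<in>set \<kappa>. 1 \<le> k" if "\<kappa> \<in> S" for \<kappa> using assms(2)[OF that] by (rule partition_positive)
  have \<nu>S: "\<nu> \<in> S" "a \<nu> \<noteq> 0" using \<nu>(2) by auto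
  define \<alpha> where "\<alpha> = word_monomial \<nu> [0..<length \<nu>]"
  have set\<alpha>: "set_mset \<alpha> = {..<length \<nu>}"
    unfolding \<alpha>_def
    by (subst set_word_monomial[OF _ pos[OF \<nu>S(1)]]) (simp_all add: atLeast0LessThan)
  have exp\<alpha>: "exponents \<alpha> = mset \<nu>"
    unfolding \<alpha>_def by (rule exponents_word_monomial[OF _ _ pos[OF \<nu>S(1)]]) simp_all
  have other: "a \<kappa> * of_nat (card (monomial_words \<kappa> \<alpha>)) = 0" if \<kappa>: "\<kappa> \<in> S" "\<kappa> \<noteq> \<nu>" for \<kappa>
  proof (cases "a \<kappa> = 0")
    case False
    have "monomial_words \<kappa> \<alpha> = {}"
    proof (rule ccontr)
      assume "monomial_words \<kappa> \<alpha> \<noteq> {}"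
      then obtain f where f: "length f = length \<kappa>" "word_monomial \<kappa> f = \<alpha>" by (auto simp: monomial_words_def)
      have "set f = {..<length \<nu>}" using set_word_monomial[OF f(1) pos[OF \<kappa>(1)]] set\<alpha> f(2) by simp
      then have "card (set f) = length \<nu>" by simp
      moreover have "length \<kappa> \<le> length \<nu>" using max \<kappa> False by simp
      ultimately have "distinct f" using f(1) card_length[of f] by (intro card_distinct) simp
      then have "mset \<kappa> = mset \<nu>" using exponents_word_monomial[OF _ f(1) pos[OF \<kappa>(1)]] f(2) exp\<alpha> by simp
      then show False using partition_eq_iff_mset assms(2) \<kappa> \<nu>S(1) by blast
    qed
    then show ?thesis by simp
  qed simp
  have "0 = series_coeff (\<Sum>\<mu>\<in>S. a \<mu> \<cdot> power_sum \<mu>) \<alpha>" using assms(3) by (simp add: zero_series.rep_eq)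
  also have "\<dots> = (\<Sum>\<kappa>\<in>S. a \<kappa> * of_nat (card (monomial_words \<kappa> \<alpha>)))"
    unfolding series_coeff_sum_scale by (intro sum.cong refl) (simp add: series_coeff_power_sum[OF pos])
  also have "\<dots> = (\<Sum>\<kappa>\<in>{\<nu>}. a \<kappa> * of_nat (card (monomial_words \<kappa> \<alpha>)))"
    by (rule sum.mono_neutral_right) (use assms(1) \<nu>S other in auto)
  finally have "card (monomial_words \<nu> \<alpha>) = 0" using \<nu>S(2) by simp
  moreover have "[0..<length \<nu>] \<in> monomial_words \<nu> \<alpha>" by (simp add: monomial_words_def \<alpha>_def)
  ultimately show False using finite_monomial_words[OF pos[OF \<nu>S(1)], of \<alpha>] by auto
qed

section \<open>Compositions and their sorted rearrangements\<close>

definition compositions :: "nat \<Rightarrow> nat \<Rightarrow> nat list set" where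
  "compositions r n = {\<beta>. length \<beta> = r \<and> sum_list \<beta> = n \<and> (\<forall>k\<in>set \<beta>. 1 \<le> k)}"

definition partitions_of_length :: "nat \<Rightarrow> nat \<Rightarrow> nat list set" where
  "partitions_of_length r n = {\<nu>. \<nu> \<in> partitions_of n \<and> length \<nu> = r}"

lemma finite_compositions: "finite (compositions r n)"
proof (rule finite_subset)
  show "compositions r n \<subseteq> {xs. set xs \<subseteq> {..n} \<and> length xs = r}"
    by (auto simp: compositions_def elim: member_le_sum_list)
qed (simp add: finite_lists_length_eq)

lemma partitions_of_length_subset: "partitions_of_length r n \<subseteq> compositions r n"
  using partition_positive by (auto simp: partitions_of_length_def partitions_of_def compositions_def)

lemma finite_partitions_of_length: "finite (partitions_of_length r n)"
  by (rule finite_subset[OF partitions_of_length_subset finite_compositions])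

lemma rev_sort_composition:
  assumes "\<beta> \<in> compositions r n"
  shows "rev (sort \<beta>) \<in> partitions_of_length r n"
proof -
  have "0 \<notin> set \<beta>" using assms by (auto simp: compositions_def)
  moreover have "sum_list (sort \<beta>) = n" using assms
    by (metis (mono_tags, lifting) compositions_def mem_Collect_eq mset_sort sum_mset_sum_list)
  ultimately show ?thesis
    using assms by (simp add: partitions_of_length_def partitions_of_def is_partition_def compositions_def sorted_wrt_rev)
qed

lemma partitions_of_length_unique:
  assumes "\<mu> \<in> partitions_of_length r n" "\<nu> \<in> partitions_of_length r n" "mset \<mu> = mset \<nu>"
  shows "\<mu> = \<nu>"
  using assms partition_eq_iff_mset by (auto simp: partitions_of_length_def partitions_of_def)

lemma compositions_mset_cong:
  assumes "mset \<beta> = mset \<beta>'" "\<beta> \<in> compositions r n"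
  shows "\<beta>' \<in> compositions r n"
proof -
  have "length \<beta>' = length \<beta>" "set \<beta>' = set \<beta>" "sum_list \<beta>' = sum_list \<beta>"
    using mset_eq_length[OF assms(1)] mset_eq_setD[OF assms(1)] arg_cong[OF assms(1), of sum_mset]
    by (simp_all add: sum_mset_sum_list)
  then show ?thesis using assms(2) by (simp add: compositions_def)
qed

text \<open>Compositions are grouped by their sorted form; the weight is the multinomial number of
  rearrangements.\<close>

lemma sum_compositions:
  fixes g :: "nat list \<Rightarrow> rat"
  assumes "\<And>\<beta> \<beta>'. mset \<beta> = mset \<beta>' \<Longrightarrow> g \<beta> = g \<beta>'"
  shows "sum g (compositions r n) = (\<Sum>\<mu>\<in>partitions_of_length r n.
    fact r / of_nat (\<Prod>i\<in>set \<mu>. fact (count_list \<mu> i)) * g \<mu>)"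
proof -
  have "sum g (compositions r n)
    = (\<Sum>\<mu>\<in>partitions_of_length r n. \<Sum>\<beta> | \<beta> \<in> compositions r n \<and> rev (sort \<beta>) = \<mu>. g \<beta>)"
    by (rule sum.group[symmetric]) (use finite_compositions finite_partitions_of_length rev_sort_composition in auto)
  also have "\<dots> = (\<Sum>\<mu>\<in>partitions_of_length r n. fact r / of_nat (\<Prod>i\<in>set \<mu>. fact (count_list \<mu> i)) * g \<mu>)"
  proof (rule sum.cong[OF refl])
    fix \<mu> assume \<mu>: "\<mu> \<in> partitions_of_length r n"
    let ?p = "\<Prod>i\<in>set \<mu>. fact (count_list \<mu> i) :: nat"
    have "{\<beta>. \<beta> \<in> compositions r n \<and> rev (sort \<beta>) = \<mu>} = permutations_of_multiset (mset \<mu>)"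
    proof (intro equalityI subsetI)
      fix \<beta> assume "\<beta> \<in> permutations_of_multiset (mset \<mu>)"
      then have m: "mset \<beta> = mset \<mu>" by (rule permutations_of_multisetD)
      have c: "\<beta> \<in> compositions r n" using compositions_mset_cong[OF m[symmetric]] \<mu> partitions_of_length_subset by blast
      have "rev (sort \<beta>) = \<mu>"
        by (rule partitions_of_length_unique[OF rev_sort_composition[OF c] \<mu>]) (simp add: m)
      then show "\<beta> \<in> {\<beta>. \<beta> \<in> compositions r n \<and> rev (sort \<beta>) = \<mu>}" using c by simp
    qed (auto simp: permutations_of_multiset_def)
    then have "(\<Sum>\<beta> | \<beta> \<in> compositions r n \<and> rev (sort \<beta>) = \<mu>. g \<beta>) = (\<Sum>\<beta>\<in>permutations_of_multiset (mset \<mu>). g \<mu>)"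
      by (rule sum.cong) (rule assms, erule permutations_of_multisetD)
    also have "\<dots> = of_nat (card (permutations_of_multiset (mset \<mu>))) * g \<mu>" by simp
    also have "card (permutations_of_multiset (mset \<mu>)) = fact r div ?p"
      using \<mu> by (simp add: card_permutations_of_multiset partitions_of_length_def count_mset)
    also have "of_nat (fact r div ?p) = (fact r / of_nat ?p :: rat)"
    proof -
      have "?p dvd fact r"
        using card_permutations_of_multiset(2)[of "mset \<mu>"] \<mu> by (simp add: partitions_of_length_def count_mset)
      then obtain q where q: "fact r = ?p * q" by blast
      have p: "?p \<noteq> 0" by simp
      have "(fact r :: rat) = of_nat ?p * of_nat q"
        using arg_cong[OF q, of "of_nat :: nat \<Rightarrow> rat"] by (simp only: of_nat_fact of_nat_mult)
      then show ?thesis using p by (simp only: q nonzero_mult_div_cancel_left of_nat_eq_0_iff not_False_eq_True)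
    qed
    finally show "(\<Sum>\<beta> | \<beta> \<in> compositions r n \<and> rev (sort \<beta>) = \<mu>. g \<beta>) = fact r / of_nat ?p * g \<mu>" .
  qed
  finally show ?thesis .
qed

lemma zee_conv: "zee \<mu> = prod_list \<mu> * (\<Prod>i\<in>set \<mu>. fact (count_list \<mu> i))"
proof -
  have "prod_list \<mu> = (\<Prod>i\<in>set \<mu>. i ^ count_list \<mu> i)"
    using prod_mset_multiplicity[of "mset \<mu>"] by (simp add: prod_mset_prod_list count_mset)
  then show ?thesis by (simp add: zee_def prod.distrib)
qed

section \<open>Cancellation for words with a repeated letter\<close>

lemma mset_conv_two_nth:
  assumes "k < length xs" "l < length xs" "k \<noteq> l"
  shows "mset xs = add_mset (xs ! k) (add_mset (xs ! l) (image_mset ((!) xs) (mset_set ({..<length xs} - {k, l}))))"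
proof -
  have "mset xs = image_mset ((!) xs) (mset_set {..<length xs})"
    by (metis map_nth mset_map mset_upt atLeast0LessThan)
  also have "mset_set {..<length xs} = add_mset k (mset_set ({..<length xs} - {k}))"
    using assms by (intro mset_set.remove) auto
  also have "mset_set ({..<length xs} - {k}) = add_mset l (mset_set ({..<length xs} - {k} - {l}))"
    using assms by (intro mset_set.remove) auto
  also have "{..<length xs} - {k} - {l} = {..<length xs} - {k, l}" by auto
  finally show ?thesis by simp
qed

lemma word_monomial_two:
  assumes "k < length f" "l < length f" "k \<noteq> l" "f ! k = f ! l"
  shows "word_monomial \<beta> f = replicate_mset (\<beta> ! k + \<beta> ! l) (f ! k)
    + (\<Sum>t\<in>{..<length f} - {k} - {l}. replicate_mset (\<beta> ! t) (f ! t))"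
proof -
  have "replicate_mset (a + b) x = replicate_mset a x + replicate_mset b x" for a b and x :: nat
    by (simp add: multiset_eq_iff)
  then show ?thesis using assms
    by (simp add: word_monomial_def sum.remove[of _ k] sum.remove[of "{..<length f} - {k}" l] add.assoc)
qed

text \<open>Compositions with the same entries outside two positions carrying the same variable, and with the
  same sum of the two entries there, contribute to the same monomial.\<close>

lemma irr_char_sum_not_distinct:
  assumes lam: "is_partition lam" and f: "length f = partition_rank lam" "\<not> distinct f"
  shows "(\<Sum>\<beta> | \<beta> \<in> compositions (partition_rank lam) (sum_list lam) \<and> word_monomial \<beta> f = \<alpha>. irr_char lam \<beta>) = 0"
proof -
  let ?r = "partition_rank lam" and ?n = "sum_list lam"
  obtain k l where kl: "k < length f" "l < length f" "k \<noteq> l" "f ! k = f ! l"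
    using f(2) by (auto simp: distinct_conv_nth)
  let ?S = "{\<beta>. \<beta> \<in> compositions ?r ?n \<and> word_monomial \<beta> f = \<alpha>}"
  \<comment> \<open>Collects both entries in slot \<open>k\<close>, with 0 as a mark in slot
    \<open>l\<close>; compositions in a fibre differ only in how the sum is divided.\<close>
  let ?g = "\<lambda>\<beta> :: nat list. \<beta>[k := \<beta> ! k + \<beta> ! l, l := 0]"
  have finS: "finite ?S" using finite_compositions by simp
  have "sum (irr_char lam) {\<beta> \<in> ?S. ?g \<beta> = \<gamma>} = 0" if \<gamma>: "\<gamma> \<in> ?g ` ?S" for \<gamma>
  proof -
    obtain \<beta>0 where \<beta>0: "\<beta>0 \<in> ?S" "\<gamma> = ?g \<beta>0" using \<gamma> by blast
    have len0: "length \<beta>0 = ?r" and pos0: "\<forall>k\<in>set \<beta>0. 1 \<le> k" and sum0: "sum_list \<beta>0 = ?n"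
      and mon0: "word_monomial \<beta>0 f = \<alpha>"
      using \<beta>0(1) by (auto simp: compositions_def)
    define s where "s = \<beta>0 ! k + \<beta>0 ! l"
    define b where "b i = \<beta>0[k := i, l := s - i]" for i
    obtain \<rho> where \<rho>: "mset \<rho> = image_mset ((!) \<beta>0) (mset_set ({..<?r} - {k, l}))" using ex_mset by blast
    have m0: "mset \<beta>0 = add_mset (\<beta>0 ! k) (add_mset (\<beta>0 ! l) (mset \<rho>))"
      using mset_conv_two_nth[of k \<beta>0 l] kl f(1) len0 \<rho> by simp
    have nth_b: "b i ! k = i" "b i ! l = s - i" "length (b i) = ?r" "t \<noteq> k \<Longrightarrow> t \<noteq> l \<Longrightarrow> b i ! t = \<beta>0 ! t" for i t
      using kl f(1) len0 by (auto simp: b_def)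
    have mb: "mset (b i) = mset (i # (s - i) # \<rho>)" for i
    proof -
      have "image_mset ((!) (b i)) (mset_set ({..<?r} - {k, l})) = mset \<rho>"
        unfolding \<rho> by (rule image_mset_cong) (use nth_b(4) in auto)
      then show ?thesis using mset_conv_two_nth[of k "b i" l] kl f(1) nth_b by simp
    qed
    have sum\<rho>: "s + sum_list \<rho> = ?n"
      using arg_cong[OF m0, of sum_mset] sum0 by (simp add: sum_mset_sum_list s_def)
    have pos\<rho>: "\<forall>k\<in>set \<rho>. 1 \<le> k" using pos0 arg_cong[OF m0, of set_mset] by simp
    have len\<rho>: "length \<rho> + 2 = ?r" using arg_cong[OF m0, of size] len0 by simp
    \<comment> \<open>Both entries are positive, so the first one runs through
      \<open>{1..<s}\<close>.\<close>
    have fiber: "{\<beta> \<in> ?S. ?g \<beta> = \<gamma>} = b ` {1..<s}"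
    proof (intro equalityI subsetI)
      fix \<beta> assume "\<beta> \<in> {\<beta> \<in> ?S. ?g \<beta> = \<gamma>}"
      then have len: "length \<beta> = ?r" and pos: "\<forall>k\<in>set \<beta>. 1 \<le> k" and g: "?g \<beta> = ?g \<beta>0"
        using \<beta>0(2) by (auto simp: compositions_def)
      have "?g \<beta> ! k = ?g \<beta>0 ! k" using g by simp
      then have s: "\<beta> ! k + \<beta> ! l = s" using kl f(1) len len0 by (simp add: s_def)
      have "1 \<le> \<beta> ! k" "1 \<le> \<beta> ! l" using pos kl f(1) len by simp_all
      then have i: "\<beta> ! k \<in> {1..<s}" "\<beta> ! l = s - \<beta> ! k" using s by auto
      have "\<beta> = b (\<beta> ! k)"
      proof (rule nth_equalityI)
        fix t assume t: "t < length \<beta>"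
        have "?g \<beta> ! t = ?g \<beta>0 ! t" using g by simp
        then show "\<beta> ! t = b (\<beta> ! k) ! t"
          using nth_b i(2) t by (cases "t = k"; cases "t = l") auto
      qed (simp add: nth_b len)
      then show "\<beta> \<in> b ` {1..<s}" using i(1) by blast
    next
      fix \<beta> assume "\<beta> \<in> b ` {1..<s}"
      then obtain i where i: "1 \<le> i" "i < s" "\<beta> = b i" by auto
      have "sum_list (b i) = ?n"
        using arg_cong[OF mb[of i], of sum_mset] sum\<rho> i by (simp add: sum_mset_sum_list)
      moreover have "\<forall>k\<in>set (b i). 1 \<le> k"
        using arg_cong[OF mb[of i], of set_mset] pos\<rho> i by simp
      moreover have "word_monomial (b i) f = \<alpha>"
      proof -
        have "(\<Sum>t\<in>{..<length f} - {k} - {l}. replicate_mset (b i ! t) (f ! t))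
          = (\<Sum>t\<in>{..<length f} - {k} - {l}. replicate_mset (\<beta>0 ! t) (f ! t))"
          by (intro sum.cong refl) (simp add: nth_b(4))
        then show ?thesis
          using word_monomial_two[OF kl, of "b i"] word_monomial_two[OF kl, of \<beta>0] mon0 nth_b(1,2) i
          by (simp add: s_def)
      qed
      moreover have "?g (b i) = \<gamma>"
        unfolding \<beta>0(2)
      proof (rule nth_equalityI)
        fix t assume "t < length (?g (b i))"
        then show "?g (b i) ! t = ?g \<beta>0 ! t"
          using nth_b[of i] nth_b(4)[of t i] i kl f(1) len0
          by (cases "t = k"; cases "t = l") (auto simp: s_def)
      qed (simp add: nth_b(3) len0)
      ultimately show "\<beta> \<in> {\<beta> \<in> ?S. ?g \<beta> = \<gamma>}" using i(3) nth_b(3) by (simp add: compositions_def)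
    qed
    have "inj_on b {1..<s}" using nth_b(1) by (metis inj_onI)
    then have "sum (irr_char lam) {\<beta> \<in> ?S. ?g \<beta> = \<gamma>} = (\<Sum>i\<in>{1..<s}. irr_char lam (b i))"
      unfolding fiber by (simp add: sum.reindex)
    also have "\<dots> = (\<Sum>i\<in>{1..<s}. irr_char lam (i # (s - i) # \<rho>))"
      by (intro sum.cong refl irr_char_mset_cong mb)
    also have "\<dots> = 0"
      by (rule irr_char_two_part_sum[OF lam pos\<rho> sum\<rho>]) (simp only: len\<rho> order_refl)
    finally show ?thesis .
  qed
  then show ?thesis by (subst sum.image_gen[OF finS, of _ ?g]) simp
qed

lemma word_monomial_map_count:
  assumes "distinct f" "set f = set_mset \<alpha>"
  shows "word_monomial (map (count \<alpha>) f) f = \<alpha>"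
proof (rule multiset_eqI)
  fix x
  show "count (word_monomial (map (count \<alpha>) f) f) x = count \<alpha> x"
  proof (cases "x \<in> set f")
    case True
    then obtain t where t: "t < length f" "x = f ! t" by (metis in_set_conv_nth)
    have "map (count (word_monomial (map (count \<alpha>) f) f)) f ! t = map (count \<alpha>) f ! t"
      by (subst map_count_word_monomial) (use assms in auto)
    then show ?thesis using t by simp
  next
    case False
    then have "(\<Sum>t<length f. if f ! t = x then map (count \<alpha>) f ! t else 0) = 0"
      by (intro sum.neutral) auto
    moreover have "count \<alpha> x = 0" using False assms(2) by (simp add: count_eq_zero_iff)
    ultimately show ?thesis by (simp add: count_word_monomial)
  qed
qed

text \<open>Sum over pairs of a composition and a word producing \<open>\<alpha>\<close>, word by
  word. Words with a repeated letter cancel, and each of the \<open>r!\<close> orderings of the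
  variables of \<open>\<alpha>\<close> determines one composition.\<close>

lemma sum_compositions_monomial_words:
  fixes X :: "nat list \<Rightarrow> rat"
  assumes cong: "\<And>\<beta> \<beta>'. mset \<beta> = mset \<beta>' \<Longrightarrow> X \<beta> = X \<beta>'"
    and zero: "\<And>f. length f = r \<Longrightarrow> \<not> distinct f \<Longrightarrow> (\<Sum>\<beta> | \<beta> \<in> compositions r n \<and> word_monomial \<beta> f = \<alpha>. X \<beta>) = 0"
  shows "(\<Sum>\<beta>\<in>compositions r n. X \<beta> * of_nat (card (monomial_words \<beta> \<alpha>)))
    = fact r * (\<Sum>\<mu> | \<mu> \<in> partitions_of_length r n \<and> exponents \<alpha> = mset \<mu>. X \<mu>)"
proof -
  let ?C = "compositions r n" and ?P = "{\<mu>. \<mu> \<in> partitions_of_length r n \<and> exponents \<alpha> = mset \<mu>}"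
  let ?W = "{f. set f \<subseteq> set_mset \<alpha> \<and> length f = r}"
  let ?D = "{f. distinct f \<and> set f = set_mset \<alpha> \<and> length f = r}"
  have finW: "finite ?W" by (rule finite_lists_length_eq) simp
  have "monomial_words \<beta> \<alpha> = {f \<in> ?W. word_monomial \<beta> f = \<alpha>}" if "\<beta> \<in> ?C" for \<beta>
    using that set_word_monomial[of _ \<beta>] by (auto simp: monomial_words_def compositions_def)
  then have "(\<Sum>\<beta>\<in>?C. X \<beta> * of_nat (card (monomial_words \<beta> \<alpha>))) = (\<Sum>\<beta>\<in>?C. \<Sum>f | f \<in> ?W \<and> word_monomial \<beta> f = \<alpha>. X \<beta>)"
    by (intro sum.cong refl) (simp add: mult.commute)
  also have "\<dots> = (\<Sum>f\<in>?W. \<Sum>\<beta> | \<beta> \<in> ?C \<and> word_monomial \<beta> f = \<alpha>. X \<beta>)"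
    by (rule sum.swap_restrict[OF finite_compositions finW])
  also have "\<dots> = (\<Sum>f\<in>?D. \<Sum>\<beta> | \<beta> \<in> ?C \<and> word_monomial \<beta> f = \<alpha>. X \<beta>)"
  proof (rule sum.mono_neutral_right[OF finW])
    show "\<forall>f\<in>?W - ?D. (\<Sum>\<beta> | \<beta> \<in> ?C \<and> word_monomial \<beta> f = \<alpha>. X \<beta>) = 0"
    proof
      fix f assume f: "f \<in> ?W - ?D"
      show "(\<Sum>\<beta> | \<beta> \<in> ?C \<and> word_monomial \<beta> f = \<alpha>. X \<beta>) = 0"
      proof (cases "distinct f")
        case True
        \<comment> \<open>A word whose letters are not exactly the variables of
          \<open>\<alpha>\<close> gives \<open>\<alpha>\<close> for no composition.\<close>
        then have "set f \<noteq> set_mset \<alpha>" using f by auto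
        then have "{\<beta>. \<beta> \<in> ?C \<and> word_monomial \<beta> f = \<alpha>} = {}"
          using f set_word_monomial[of f] by (auto simp: compositions_def)
        then show ?thesis by (simp only: sum.empty)
      qed (use zero f in auto)
    qed
  qed auto
  also have "\<dots> = (\<Sum>f\<in>?D. sum X ?P)"
  proof (rule sum.cong[OF refl])
    fix f assume f: "f \<in> ?D"
    let ?\<beta> = "map (count \<alpha>) f"
    have mon: "word_monomial ?\<beta> f = \<alpha>" using f by (intro word_monomial_map_count) auto
    have "mset f = mset_set (set_mset \<alpha>)" using f by (metis (mono_tags) mem_Collect_eq mset_set_set)
    then have e: "exponents \<alpha> = mset ?\<beta>" by (simp add: exponents_def)
    \<comment> \<open>With distinct letters the composition has to list the exponents of
      \<open>\<alpha>\<close> along \<open>f\<close>.\<close>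
    have L: "{\<beta>. \<beta> \<in> ?C \<and> word_monomial \<beta> f = \<alpha>} = {?\<beta>} \<inter> ?C"
      using f mon map_count_word_monomial[of f] by (auto simp: compositions_def)
    show "(\<Sum>\<beta> | \<beta> \<in> ?C \<and> word_monomial \<beta> f = \<alpha>. X \<beta>) = sum X ?P"
    proof (cases "?\<beta> \<in> ?C")
      case True
      have m: "mset (rev (sort ?\<beta>)) = mset ?\<beta>" by simp
      have "?P = {rev (sort ?\<beta>)}"
        using rev_sort_composition[OF True] partitions_of_length_unique e m by (auto simp del: mset_map)
      then show ?thesis unfolding L using True cong[OF m] by simp
    next
      case False
      have "?P = {}"
      proof (rule ccontr)
        assume "?P \<noteq> {}"
        then obtain \<mu> where \<mu>: "\<mu> \<in> partitions_of_length r n" "exponents \<alpha> = mset \<mu>" by blast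
        have "mset \<mu> = mset ?\<beta>" using \<mu>(2) e by simp
        moreover have "\<mu> \<in> ?C" using \<mu>(1) partitions_of_length_subset by blast
        ultimately have "?\<beta> \<in> ?C" by (rule compositions_mset_cong)
        then show False using False by contradiction
      qed
      moreover have "{?\<beta>} \<inter> ?C = {}" using False by simp
      ultimately show ?thesis unfolding L by (simp only: sum.empty)
    qed
  qed
  also have "\<dots> = of_nat (card ?D) * sum X ?P" by simp
  also have "\<dots> = fact r * sum X ?P"
  \<comment> \<open>If \<open>?P\<close> is nonempty, \<open>\<alpha>\<close> has exactly
    \<open>r\<close> variables, with \<open>r!\<close> orderings; otherwise both sides are
    0.\<close>
  proof (cases "?P = {}")
    case True
    then show ?thesis by (simp only: sum.empty mult_zero_right)
  next
    case False
    then obtain \<mu> where "length \<mu> = r" "exponents \<alpha> = mset \<mu>" by (auto simp: partitions_of_length_def)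
    then have c: "card (set_mset \<alpha>) = r" by (metis exponents_def size_image_mset size_mset size_mset_set)
    have "?D = permutations_of_set (set_mset \<alpha>)"
      using c by (auto simp: permutations_of_set_def) (metis distinct_card)
    then show ?thesis using c by simp
  qed
  finally show ?thesis .
qed

theorem theorem7p6:
  fixes lam :: "nat list" and c :: "nat list \<Rightarrow> rat"
  assumes "is_partition lam"
    and "finite {\<mu>. is_partition \<mu> \<and> c \<mu> \<noteq> 0}"
    and "bottom_schur lam = (\<Sum>\<mu> | is_partition \<mu> \<and> c \<mu> \<noteq> 0. c \<mu> \<cdot> power_sum_tilde \<mu>)"
  shows "(\<Sum>\<mu> | is_partition \<mu> \<and> c \<mu> \<noteq> 0. c \<mu> \<cdot> power_sum \<mu>)
       = (\<Sum>\<mu> | is_partition \<mu> \<and> c \<mu> \<noteq> 0. c \<mu> \<cdot> augmented_monomial_sym \<mu>)"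
proof -
  let ?r = "partition_rank lam" and ?n = "sum_list lam" and ?\<chi> = "irr_char lam"
  let ?P = "partitions_of_length ?r ?n" and ?S = "{\<mu>. is_partition \<mu> \<and> c \<mu> \<noteq> 0}"
  let ?m = "\<lambda>\<mu>. \<Prod>i\<in>set \<mu>. fact (count_list \<mu> i) :: nat"
  \<comment> \<open>The coefficients of the power sums in the two expressions for
    \<open>bottom_schur lam\<close>, extended by 0 to the union of the index sets.\<close>
  define a where "a \<mu> = (if \<mu> \<in> ?P then ?\<chi> \<mu> / of_nat (zee \<mu>) else 0)" for \<mu>
  define b where "b \<mu> = (if \<mu> \<in> ?S then c \<mu> / of_nat (prod_list \<mu>) else 0)" for \<mu>
  have fin: "finite ?P" "finite ?S" using finite_partitions_of_length assms(2) by auto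
  have part: "is_partition \<mu>" if "\<mu> \<in> ?P \<union> ?S" for \<mu>
    using that by (auto simp: partitions_of_length_def partitions_of_def)
  have scale_scale: "x \<cdot> y \<cdot> F = (x * y) \<cdot> F" for x y F by transfer (simp add: mult.assoc)
  have scale_zero: "0 \<cdot> F = 0" for F by transfer simp
  have scale_diff: "(x - y) \<cdot> F = x \<cdot> F - y \<cdot> F" for x y F by transfer (simp add: left_diff_distrib)
  have "(\<Sum>\<mu>\<in>?P \<union> ?S. a \<mu> \<cdot> power_sum \<mu>) = (\<Sum>\<mu>\<in>?P. a \<mu> \<cdot> power_sum \<mu>)"
    by (rule sum.mono_neutral_right) (use fin in \<open>auto simp: a_def scale_zero\<close>)
  also have "\<dots> = bottom_schur lam"
    unfolding bottom_schur_def partitions_of_length_def by (intro sum.cong refl) (auto simp: a_def partitions_of_length_def)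
  also have "\<dots> = (\<Sum>\<mu>\<in>?S. b \<mu> \<cdot> power_sum \<mu>)"
    unfolding assms(3) by (intro sum.cong refl) (simp add: b_def power_sum_tilde_conv scale_scale)
  also have "\<dots> = (\<Sum>\<mu>\<in>?P \<union> ?S. b \<mu> \<cdot> power_sum \<mu>)"
    by (rule sum.mono_neutral_left) (use fin in \<open>auto simp: b_def scale_zero\<close>)
  finally have diff: "(\<Sum>\<mu>\<in>?P \<union> ?S. (a \<mu> - b \<mu>) \<cdot> power_sum \<mu>) = 0"
    by (simp add: scale_diff sum_subtractf)
  have ab: "a \<mu> = b \<mu>" if "\<mu> \<in> ?P \<union> ?S" for \<mu>
  proof -
    have "a \<mu> - b \<mu> = 0"
      by (rule power_sum_independent[OF finite_UnI[OF fin] part diff that])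
    then show ?thesis by simp
  qed
  have pos: "\<forall>k\<in>set \<mu>. 1 \<le> k" if "\<mu> \<in> ?P \<union> ?S" for \<mu> using part[OF that] by (rule partition_positive)
  have prod_pos: "prod_list \<mu> \<noteq> 0" if "\<mu> \<in> ?P \<union> ?S" for \<mu> using pos[OF that] by (auto simp: prod_list_zero_iff)
  have SP: "?S \<subseteq> ?P"
  proof
    fix \<mu> assume \<mu>: "\<mu> \<in> ?S"
    then have "b \<mu> \<noteq> 0" using prod_pos[of \<mu>] by (simp add: b_def)
    then show "\<mu> \<in> ?P" using ab[of \<mu>] \<mu> by (auto simp: a_def split: if_splits)
  qed
  \<comment> \<open>\<open>zee \<mu>\<close> is the product of the parts times the factorials of the
    multiplicities; the parts cancel against the denominators of
    \<open>power_sum_tilde\<close>.\<close>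
  have c: "c \<mu> = ?\<chi> \<mu> / of_nat (?m \<mu>)" if "\<mu> \<in> ?P" for \<mu>
  proof -
    have p: "prod_list \<mu> \<noteq> 0" "is_partition \<mu>" using prod_pos[of \<mu>] part[of \<mu>] that by simp_all
    have "c \<mu> = of_nat (prod_list \<mu>) * b \<mu>" using p by (simp add: b_def)
    also have "\<dots> = of_nat (prod_list \<mu>) * (?\<chi> \<mu> / of_nat (zee \<mu>))" using ab[of \<mu>] that by (simp add: a_def)
    also have "\<dots> = ?\<chi> \<mu> / of_nat (?m \<mu>)" using p(1) by (simp add: zee_conv)
    finally show ?thesis .
  qed
  have toP: "(\<Sum>\<mu>\<in>?S. c \<mu> \<cdot> F \<mu>) = (\<Sum>\<mu>\<in>?P. c \<mu> \<cdot> F \<mu>)" for F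
    by (rule sum.mono_neutral_left[OF fin(1) SP]) (use part in \<open>auto simp: scale_zero\<close>)
  have "series_coeff (\<Sum>\<mu>\<in>?P. c \<mu> \<cdot> power_sum \<mu>) \<alpha> = series_coeff (\<Sum>\<mu>\<in>?P. c \<mu> \<cdot> augmented_monomial_sym \<mu>) \<alpha>" for \<alpha>
  proof -
    let ?g = "\<lambda>\<beta>. ?\<chi> \<beta> * series_coeff (power_sum \<beta>) \<alpha>"
    have gcong: "?g \<beta> = ?g \<beta>'" if "mset \<beta> = mset \<beta>'" for \<beta> \<beta>'
    proof -
      have "power_sum \<beta> = power_sum \<beta>'"
        unfolding power_sum_def using that by (metis mset_map prod_mset_prod_list)
      then show ?thesis using irr_char_mset_cong[OF that] by simp
    qed
    \<comment> \<open>After multiplication by \<open>r!\<close> the denominators of \<open>c\<close>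
      are those of \<open>sum_compositions\<close>, so the sum extends over all
      rearrangements.\<close>
    have "fact ?r * series_coeff (\<Sum>\<mu>\<in>?P. c \<mu> \<cdot> power_sum \<mu>) \<alpha> = (\<Sum>\<mu>\<in>?P. fact ?r / of_nat (?m \<mu>) * ?g \<mu>)"
      unfolding series_coeff_sum_scale sum_distrib_left by (intro sum.cong refl) (simp add: c)
    also have "\<dots> = sum ?g (compositions ?r ?n)"
      by (rule sum_compositions[OF gcong, symmetric])
    also have "\<dots> = (\<Sum>\<beta>\<in>compositions ?r ?n. ?\<chi> \<beta> * of_nat (card (monomial_words \<beta> \<alpha>)))"
      by (intro sum.cong refl arg_cong2[where f = "(*)"] series_coeff_power_sum) (simp add: compositions_def)
    also have "\<dots> = fact ?r * (\<Sum>\<mu> | \<mu> \<in> ?P \<and> exponents \<alpha> = mset \<mu>. ?\<chi> \<mu>)"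
      by (rule sum_compositions_monomial_words[OF irr_char_mset_cong irr_char_sum_not_distinct[OF assms(1)]])
    also have "(\<Sum>\<mu> | \<mu> \<in> ?P \<and> exponents \<alpha> = mset \<mu>. ?\<chi> \<mu>)
      = (\<Sum>\<mu>\<in>?P. if exponents \<alpha> = mset \<mu> then ?\<chi> \<mu> else 0)"
      using fin(1) by (simp add: sum.inter_filter)
    \<comment> \<open>The factorials in the augmented monomial functions cancel the denominators of
      \<open>c\<close>.\<close>
    also have "\<dots> = series_coeff (\<Sum>\<mu>\<in>?P. c \<mu> \<cdot> augmented_monomial_sym \<mu>) \<alpha>"
      unfolding series_coeff_sum_scale
      by (intro sum.cong refl) (simp add: c augmented_monomial_sym_def series_coeff_scale monomial_sym.rep_eq exponents_def)
    finally show ?thesis by simp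
  qed
  then show ?thesis unfolding toP series_eq_iff by blast
qed

end
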